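(* Let $G$ be a finite group. Then $|c(G)|=8$ if and only if there exist primes $p<q<r$ such that $G$ is isomorphic to one of the following groups: (a) $C_{pqr}$, $C_{p^3q}$, $C_{pq^3}$, $C_{p^7}$, or an abelian but non-cyclic group of order $4q$; (b) $C_{2^3}\times C_2$, $C_2\times C_2\times C_2$, or $C_{3^2}\times C_3$; (c) $G_{11}=\langle x,y\mid x^2y^{-8},\ [x,y]y^4\rangle$, $G_{14}=\langle x,y\mid x^4y^{-2},\ [x,y]x^2\rangle$, $\langle a,b\mid a^{3^2}=b^3=1,\ ba=a^4b\rangle$, or $A_4$.
   Context: For a finite group $G$, $c(G)$ denotes the set of all cyclic subgroups of $G$ (including the trivial subgroup), so $|c(G)|$ is the number of cyclic subgroups of $G$. $C_n$ denotes the cyclic group of order $n$, and $A_4$ is the alternating group on four symbols. In the presentations of $G_{11}$ and $G_{14}$ (groups of order $16$), the listed words are relators, and the commutator convention is $[x,y]=x^{-1}y^{-1}xy$. *)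

theory Defs
  imports
    "HOL-Computational_Algebra.Primes"
    "HOL-Algebra.Elementary_Groups"
    "HOL-Algebra.Sym_Groups"
begin

definition cyclic_subgroups :: "('a, 'b) monoid_scheme \<Rightarrow> 'a set set" where
  "cyclic_subgroups G = {H. subgroup H G \<and> cyclic_group (G\<lparr>carrier := H\<rparr>)}"

(* A letter (g, True) stands for the generator g, and (g, False) for its formal inverse. *)
type_synonym 'g word = "('g \<times> bool) list"

inductive free_eq :: "'g word \<Rightarrow> 'g word \<Rightarrow> bool" where
  cancel: "free_eq (u @ (g, b) # (g, \<not> b) # v) (u @ v)"
| refl: "free_eq u u"
| sym: "free_eq u v \<Longrightarrow> free_eq v u"
| trans: "free_eq u v \<Longrightarrow> free_eq v w \<Longrightarrow> free_eq u w"

definition free_class :: "'g word \<Rightarrow> 'g word set" where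
  "free_class u = {v. free_eq u v}"

(* The free group with one free generator for each element of the type parameter. *)
definition free_group :: "'g word set monoid" where
  "free_group =
     \<lparr>carrier = range free_class,
      mult = (\<lambda>A B. \<Union>u\<in>A. \<Union>v\<in>B. free_class (u @ v)),
      one = free_class []\<rparr>"

definition free_gen :: "'g \<Rightarrow> 'g word set" where
  "free_gen g = free_class [(g, True)]"

definition normal_closure :: "('a, 'b) monoid_scheme \<Rightarrow> 'a set \<Rightarrow> 'a set" where
  "normal_closure G S = \<Inter>{N. N \<lhd> G \<and> S \<subseteq> N}"

definition presented_group :: "'g word set set \<Rightarrow> 'g word set set monoid" where
  "presented_group R = free_group Mod normal_closure free_group R"

definition commutator :: "('a, 'b) monoid_scheme \<Rightarrow> 'a \<Rightarrow> 'a \<Rightarrow> 'a" where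
  "commutator G x y = inv\<^bsub>G\<^esub> x \<otimes>\<^bsub>G\<^esub> inv\<^bsub>G\<^esub> y \<otimes>\<^bsub>G\<^esub> x \<otimes>\<^bsub>G\<^esub> y"

datatype generator = Gen1 | Gen2

definition G11 :: "generator word set set monoid" where
  "G11 = (let F = free_group; x = free_gen Gen1; y = free_gen Gen2 in
     presented_group
       {x [^]\<^bsub>F\<^esub> (2::int) \<otimes>\<^bsub>F\<^esub> y [^]\<^bsub>F\<^esub> (-8::int),
        commutator F x y \<otimes>\<^bsub>F\<^esub> y [^]\<^bsub>F\<^esub> (4::int)})"

definition G14 :: "generator word set set monoid" where
  "G14 = (let F = free_group; x = free_gen Gen1; y = free_gen Gen2 in
     presented_group
       {x [^]\<^bsub>F\<^esub> (4::int) \<otimes>\<^bsub>F\<^esub> y [^]\<^bsub>F\<^esub> (-2::int),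
        commutator F x y \<otimes>\<^bsub>F\<^esub> x [^]\<^bsub>F\<^esub> (2::int)})"

(* The relation b a = a^4 b enters as the relator (b a) (a^4 b)^-1. *)
definition G27 :: "generator word set set monoid" where
  "G27 = (let F = free_group; a = free_gen Gen1; b = free_gen Gen2 in
     presented_group
       {a [^]\<^bsub>F\<^esub> ((3::nat) ^ 2),
        b [^]\<^bsub>F\<^esub> (3::nat),
        (b \<otimes>\<^bsub>F\<^esub> a) \<otimes>\<^bsub>F\<^esub> inv\<^bsub>F\<^esub> (a [^]\<^bsub>F\<^esub> (4::nat) \<otimes>\<^bsub>F\<^esub> b)})"

end

(* If G is not cyclic, choose a cyclic subgroup C with the most generators, of order n and index m.
   Each cyclic subgroup outside C has at most totient n generators, so counting the elements outside C
   gives n (m - 1) <= (8 - d) totient n, where d is the number of divisors of n.  Moreover the order of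
   an element x outside C is e f, where e is the order of the intersection of C with the subgroup
   generated by x, and f <= m.  For each value of d <= 6 these constraints leave a short list of pairs
   (n, m) and element orders.  If m is at most every divisor of n other than 1, then C is normal; for
   prime m this makes G metacyclic with known parameters.  The pair (2, 4) gives the elementary abelian
   group of order 8, and (3, 4) gives A_4 through the conjugation action on the four subgroups of
   order 3. *)
theory Submission
  imports Defs
    "HOL-Algebra.Multiplicative_Group"
    "HOL-Algebra.Sylow"
    "HOL-Number_Theory.Totient"
    "HOL-Number_Theory.Cong"
begin

text \<open>Taking the cyclic subgroup with the most generators, not the largest one, makes
  \<open>totient n\<close> bound the generators of all cyclic subgroups at once, and the inequality
  has force because \<open>totient n < n\<close>. Counting alone does not finish the classification:
  the pairs (16, 2), (25, 5), (32, 2) and (81, 3) admit solutions of all counting equations. They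
  fall to a correction argument: an outside element \<open>y\<close> of order \<open>n\<close> is
  replaced by some \<open>c [^] i \<otimes> y\<close> of order \<open>m\<close>, an order that the
  equations forbid. The pair (4, 3) escapes the normality criterion, since 2 divides 4 and 2 < 3;
  there an element of order 6 appears, which has as many generators as one of order 4 and is larger.
  Two of the presentations do not state the order of their normal cyclic subgroup, so they are
  squeezed between consequences of the relators and an explicit model on pairs of numbers. The same
  models reduce the converse to finite counts of roots of the identity.\<close>

locale finite_group = group +
  assumes finite_carrier [simp]: "finite (carrier G)"
begin

section \<open>Cyclic subgroups of a finite group and their generators\<close>

definition cyc :: "'a \<Rightarrow> 'a set" where
  "cyc x = generate G {x}"

lemma ord_pos: "x \<in> carrier G \<Longrightarrow> ord x > 0"
  using ord_ge_1[of x] by simp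

lemma cyc_subset: "x \<in> carrier G \<Longrightarrow> cyc x \<subseteq> carrier G"
  unfolding cyc_def by (simp add: generate_incl)

lemma finite_cyc: "x \<in> carrier G \<Longrightarrow> finite (cyc x)"
  using cyc_subset finite_subset by fastforce

lemma subgroup_cyc: "x \<in> carrier G \<Longrightarrow> subgroup (cyc x) G"
  unfolding cyc_def by (simp add: generate_is_subgroup)

lemma cyc_minimal: "subgroup H G \<Longrightarrow> x \<in> H \<Longrightarrow> cyc x \<subseteq> H"
  unfolding cyc_def by (simp add: generate_subgroup_incl)

lemma cyc_self: "x \<in> cyc x"
  unfolding cyc_def by (simp add: generate.incl)

lemma cyc_mono: "y \<in> cyc x \<Longrightarrow> x \<in> carrier G \<Longrightarrow> cyc y \<subseteq> cyc x"
  by (simp add: cyc_minimal subgroup_cyc)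

lemma cyc_powers: "x \<in> carrier G \<Longrightarrow> cyc x = range (\<lambda>k::nat. x [^] k)"
  unfolding cyc_def using generate_pow_on_finite_carrier by (simp add: full_SetCompr_eq)

lemma card_cyc: "x \<in> carrier G \<Longrightarrow> card (cyc x) = ord x"
  unfolding cyc_def by (simp add: generate_pow_card)

lemma ord_dvd_of_mem_cyc:
  assumes c: "c \<in> carrier G" and x: "x \<in> cyc c"
  shows "ord x dvd ord c"
proof -
  obtain i :: nat where i: "x = c [^] i" using c x cyc_powers by blast
  then have "x [^] ord c = \<one>"
    using c by (simp add: nat_pow_pow pow_eq_id)
  then show ?thesis using c i by (simp add: pow_eq_id)
qed

lemma cyc_eq_iff_ord:
  assumes "x \<in> carrier G" "y \<in> cyc x"
  shows "cyc y = cyc x \<longleftrightarrow> ord y = ord x"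
proof -
  have "y \<in> carrier G" using assms cyc_subset by auto
  then show ?thesis
    using assms card_subset_eq[OF finite_cyc cyc_mono] card_cyc by metis
qed

lemma cyclic_subgroups_eq: "cyclic_subgroups G = cyc ` carrier G"
proof (intro subset_antisym subsetI)
  fix H assume "H \<in> cyclic_subgroups G"
  then have H: "subgroup H G" and "cyclic_group (G\<lparr>carrier := H\<rparr>)"
    by (auto simp: cyclic_subgroups_def)
  then obtain x where x: "x \<in> H"
    and sg: "subgroup_generated (G\<lparr>carrier := H\<rparr>) {x} = G\<lparr>carrier := H\<rparr>"
    by (auto simp: cyclic_group_def)
  have "carrier (subgroup_generated (G\<lparr>carrier := H\<rparr>) {x}) = H"
    using arg_cong[OF sg, of carrier] by simp
  then have gen: "generate (G\<lparr>carrier := H\<rparr>) {x} = H"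
    using x by (simp add: carrier_subgroup_generated)
  have "cyc x = generate (G\<lparr>carrier := H\<rparr>) {x}"
    unfolding cyc_def by (rule generate_consistent[symmetric]) (use H x in simp_all)
  also note gen
  finally have "cyc x = H" .
  moreover have "x \<in> carrier G" using subgroup.mem_carrier[OF H x] .
  ultimately show "H \<in> cyc ` carrier G" by (intro image_eqI[of _ _ x]) simp_all
next
  fix H assume "H \<in> cyc ` carrier G"
  then obtain x where x: "x \<in> carrier G" "H = cyc x" by blast
  have "cyclic_group (subgroup_generated G {x})"
    by (rule cyclic_group_generated)
  then show "H \<in> cyclic_subgroups G"
    using x subgroup_cyc unfolding cyclic_subgroups_def subgroup_generated_def cyc_def by simp
qed

lemma finite_cyclic_subgroups [simp]: "finite (cyclic_subgroups G)"
  by (simp add: cyclic_subgroups_eq)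

lemma card_generators:
  assumes x: "x \<in> carrier G"
  shows "card {y \<in> carrier G. cyc y = cyc x} = totient (ord x)"
proof -
  have "{y \<in> carrier G. cyc y = cyc x} = (\<lambda>k. x [^] k) ` totatives (ord x)" (is "?L = ?R")
  proof (intro subset_antisym subsetI)
    fix y assume "y \<in> ?L"
    then have y: "y \<in> carrier G" "cyc y = cyc x" by auto
    then have "y \<in> cyc x" using cyc_self by blast
    then obtain k :: nat where k: "y = x [^] k" using cyc_powers[OF x] by blast
    \<comment> \<open>\<open>totatives\<close> uses the numbers from 1 to \<open>ord x\<close>, so
      the residue 0 is represented by \<open>ord x\<close>. This is relevant for the trivial
      element, where \<open>ord x = 1\<close>.\<close>
    define j where "j = (if k mod ord x = 0 then ord x else k mod ord x)"
    have "x [^] k = x [^] (k mod ord x)"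
    proof -
      have "x [^] k = x [^] (ord x * (k div ord x)) \<otimes> x [^] (k mod ord x)"
        using x by (simp add: nat_pow_mult)
      also have "x [^] (ord x * (k div ord x)) = \<one>"
        using x by (simp add: pow_eq_id)
      finally show ?thesis using x by simp
    qed
    then have yj: "y = x [^] j" using k x by (auto simp: j_def)
    have "ord y = ord x" using y card_cyc x by metis
    then have "coprime j (ord x)"
      using pow_ord_eq_ord_iff[of x j] x yj by simp
    moreover have "0 < j" "j \<le> ord x" using ord_pos[OF x] by (auto simp: j_def intro: less_imp_le)
    ultimately show "y \<in> ?R" using yj by (auto simp: totatives_def)
  next
    fix y assume "y \<in> ?R"
    then obtain k where k: "k \<in> totatives (ord x)" "y = x [^] k" by blast
    then have "ord y = ord x"
      using pow_ord_eq_ord_iff[of x k] x by (simp add: in_totatives_iff)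
    moreover have "y \<in> cyc x" using k cyc_powers x by blast
    ultimately show "y \<in> ?L" using cyc_eq_iff_ord x k by auto
  qed
  moreover have "inj_on (\<lambda>k. x [^] k) (totatives (ord x))"
    using ord_inj'[OF x] by (rule inj_on_subset) (auto simp: in_totatives_iff)
  ultimately show ?thesis
    by (simp add: card_image totient_def)
qed

text \<open>The fibre of \<open>cyc\<close> over each \<open>D\<close> lies completely in
  \<open>S\<close> and consists of the generators of \<open>D\<close>, so it has
  \<open>totient (card D)\<close> elements.\<close>

lemma card_saturated:
  assumes S: "S \<subseteq> carrier G" and sat: "\<And>x y. x \<in> S \<Longrightarrow> y \<in> carrier G \<Longrightarrow> cyc y = cyc x \<Longrightarrow> y \<in> S"
  shows "card S = (\<Sum>D\<in>cyc ` S. totient (card D))"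
proof -
  have "S = (\<Union>D\<in>cyc ` S. {y \<in> carrier G. cyc y = D})"
    using S sat by auto
  then have "card S = card (\<Union>D\<in>cyc ` S. {y \<in> carrier G. cyc y = D})" by simp
  also have "\<dots> = (\<Sum>D\<in>cyc ` S. card {y \<in> carrier G. cyc y = D})"
    using S finite_subset[OF S] by (intro card_UN_disjoint) auto
  also have "\<dots> = (\<Sum>D\<in>cyc ` S. totient (card D))"
    using S by (intro sum.cong) (auto simp: card_generators card_cyc subsetD)
  finally show ?thesis .
qed

lemma card_ord_eq:
  "card {x \<in> carrier G. ord x = k} = totient k * card {D \<in> cyclic_subgroups G. card D = k}"
proof -
  define S where "S = {x \<in> carrier G. ord x = k}"
  have *: "cyc ` S = {D \<in> cyclic_subgroups G. card D = k}"
    unfolding cyclic_subgroups_eq S_def by (auto simp: card_cyc)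
  have "card S = (\<Sum>D\<in>cyc ` S. totient (card D))"
  proof (rule card_saturated)
    show "S \<subseteq> carrier G" unfolding S_def by blast
    fix x y assume "x \<in> S" and y: "y \<in> carrier G" "cyc y = cyc x"
    then have "ord y = k" using card_cyc[of x] card_cyc[of y] by (simp add: S_def)
    then show "y \<in> S" using y by (simp add: S_def)
  qed
  also have "\<dots> = (\<Sum>D\<in>cyc ` S. totient k)"
    unfolding * by (rule sum.cong) simp_all
  also have "\<dots> = totient k * card {D \<in> cyclic_subgroups G. card D = k}"
    unfolding * by simp
  finally show ?thesis by (simp only: S_def)
qed

text \<open>Turns a census of element orders into the number of cyclic subgroups; the noncyclic
  groups of the list are evaluated this way.\<close>

lemma card_cyclic_subgroups:
  assumes "finite K" "\<And>x. x \<in> carrier G \<Longrightarrow> ord x \<in> K"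
  shows "card (cyclic_subgroups G) = (\<Sum>k\<in>K. card {x \<in> carrier G. ord x = k} div totient k)"
proof -
  have "card (cyclic_subgroups G) = card (\<Union>k\<in>K. {D \<in> cyclic_subgroups G. card D = k})"
    by (rule arg_cong[of _ _ card]) (use assms in \<open>auto simp: cyclic_subgroups_eq card_cyc\<close>)
  also have "\<dots> = (\<Sum>k\<in>K. card {D \<in> cyclic_subgroups G. card D = k})"
    using assms by (intro card_UN_disjoint) auto
  also have "\<dots> = (\<Sum>k\<in>K. card {x \<in> carrier G. ord x = k} div totient k)"
  proof (rule sum.cong)
    fix k assume "k \<in> K"
    show "card {D \<in> cyclic_subgroups G. card D = k} = card {x \<in> carrier G. ord x = k} div totient k"
    \<comment> \<open>For \<open>k = 0\<close> both sides vanish: no subgroup has order 0, and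
      division by \<open>totient 0 = 0\<close> yields 0.\<close>
    proof (cases "k = 0")
      case True
      then have "{D \<in> cyclic_subgroups G. card D = k} = {}"
        by (auto simp: cyclic_subgroups_eq card_cyc ord_pos)
      then show ?thesis using True by (simp only: card.empty totient_0 div_by_0)
    qed (simp add: card_ord_eq)
  qed simp
  finally show ?thesis .
qed

text \<open>Every fibre of the product map injects into \<open>H \<inter> K\<close>: if
  \<open>(h, k)\<close> is a fixed point of the fibre, then
  \<open>a \<otimes> b = h \<otimes> k\<close> forces
  \<open>inv h \<otimes> a = k \<otimes> inv b\<close>, and this common element determines
  \<open>(a, b)\<close>.\<close>

lemma card_mult_le_card_Int:
  assumes "subgroup H G" "subgroup K G"
  shows "card H * card K \<le> card (H <#> K) * card (H \<inter> K)"
proof -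
  interpret H: subgroup H G by fact
  interpret K: subgroup K G by fact
  let ?f = "\<lambda>(h, k). h \<otimes> k"
  have fin: "finite H" "finite K" using H.subset K.subset finite_subset[OF _ finite_carrier] by auto
  have "card (H \<times> K) \<le> (\<Sum>g\<in>?f ` (H \<times> K). card {z \<in> H \<times> K. ?f z = g})"
    using fin by (subst card_eq_sum, subst sum.image_gen[of _ _ ?f]) auto
  also have "\<dots> \<le> (\<Sum>g\<in>?f ` (H \<times> K). card (H \<inter> K))"
  proof (rule sum_mono)
    fix g assume "g \<in> ?f ` (H \<times> K)"
    then obtain h k where hk: "h \<in> H" "k \<in> K" "g = h \<otimes> k" by auto
    have *: "inv h \<otimes> a = k \<otimes> inv b" if "a \<in> H" "b \<in> K" "a \<otimes> b = h \<otimes> k" for a b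
    proof -
      have "a = h \<otimes> k \<otimes> inv b"
        using that hk by (simp add: inv_solve_right)
      then show ?thesis using that hk by (simp add: m_assoc inv_solve_left')
    qed
    show "card {z \<in> H \<times> K. ?f z = g} \<le> card (H \<inter> K)"
    proof (rule card_inj_on_le)
      show "inj_on (\<lambda>(a, b). inv h \<otimes> a) {z \<in> H \<times> K. ?f z = g}"
      proof (rule inj_onI)
        fix z z' assume "z \<in> {z \<in> H \<times> K. ?f z = g}" "z' \<in> {z \<in> H \<times> K. ?f z = g}"
          and eq: "(\<lambda>(a, b). inv h \<otimes> a) z = (\<lambda>(a, b). inv h \<otimes> a) z'"
        then obtain a b a' b' where z: "z = (a, b)" "z' = (a', b')" "a \<in> H" "a' \<in> H" "b \<in> K" "b' \<in> K"
          "a \<otimes> b = g" "a' \<otimes> b' = g" by auto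
        then have "a = a'" using eq hk by simp
        moreover have "b = b'"
          using z \<open>a = a'\<close> Units_l_cancel[of a b b'] by simp
        ultimately show "z = z'" using z by simp
      qed
      show "(\<lambda>(a, b). inv h \<otimes> a) ` {z \<in> H \<times> K. ?f z = g} \<subseteq> H \<inter> K"
      proof (rule image_subsetI)
        fix z assume "z \<in> {z \<in> H \<times> K. ?f z = g}"
        then obtain a b where ab: "z = (a, b)" "a \<in> H" "b \<in> K" "a \<otimes> b = g" by auto
        then have "inv h \<otimes> a \<in> H \<and> inv h \<otimes> a \<in> K"
          using *[of a b] hk by (metis H.m_closed H.m_inv_closed K.m_closed K.m_inv_closed)
        then show "(\<lambda>(a, b). inv h \<otimes> a) z \<in> H \<inter> K" using ab by simp
      qed
    qed (use fin in auto)
  qed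
  also have "\<dots> = card (H <#> K) * card (H \<inter> K)"
  proof -
    have "?f ` (H \<times> K) = H <#> K" by (auto simp: set_mult_def)
    then show ?thesis by simp
  qed
  finally show ?thesis by (simp add: card_cartesian_product)
qed

lemma card_le_card_Int:
  assumes "subgroup H G" "subgroup K G"
  shows "card H * card K \<le> card (carrier G) * card (H \<inter> K)"
proof -
  have "H <#> K \<subseteq> carrier G"
    using assms by (intro set_mult_closed subgroup.subset)
  then have "card (H <#> K) * card (H \<inter> K) \<le> card (carrier G) * card (H \<inter> K)"
    by (intro mult_right_mono card_mono) simp_all
  with card_mult_le_card_Int[OF assms] show ?thesis by (rule le_trans)
qed

text \<open>Sylow's theorem is applied with exponent 1, whatever the multiplicity of
  \<open>p\<close>; any nontrivial element of a subgroup of order \<open>p\<close> will do.\<close>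

lemma cauchy:
  assumes "prime p" "p dvd card (carrier G)"
  obtains x where "x \<in> carrier G" "ord x = p"
proof -
  obtain m where "order G = p ^ 1 * m" using assms by (auto simp: order_def)
  then obtain H where H: "subgroup H G" "card H = p ^ 1"
    using sylow_thm[OF assms(1) is_group] finite_carrier by blast
  interpret H: subgroup H G by fact
  have "\<exists>x\<in>H. x \<noteq> \<one>"
  proof (rule ccontr)
    assume "\<not> (\<exists>x\<in>H. x \<noteq> \<one>)"
    then have "card H \<le> card {\<one>}" by (intro card_mono) auto
    then show False using H(2) prime_gt_1_nat[OF assms(1)] by simp
  qed
  then obtain x where x: "x \<in> H" "x \<noteq> \<one>" by blast
  interpret HG: group "G\<lparr>carrier := H\<rparr>" using H(1) subgroup_imp_group by blast
  have "x [^] p = \<one>"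
    using HG.pow_order_eq_1[of x] x H by (simp add: order_def nat_pow_consistent[symmetric])
  moreover have xc: "x \<in> carrier G" using x by simp
  ultimately have "ord x dvd p" by (simp add: pow_eq_id)
  moreover have "ord x \<noteq> 1" using x xc ord_eq_1 by simp
  ultimately have "ord x = p" using assms(1) by (auto simp: prime_nat_iff)
  then show ?thesis using that xc by blast
qed

text \<open>Both elements are compared with the canonical generator
  \<open>c [^] (ord c div ord x)\<close>, which depends only on the order of
  \<open>x\<close>.\<close>

lemma unique_subgroup_of_cyc:
  assumes c: "c \<in> carrier G" and x: "x \<in> cyc c" and y: "y \<in> cyc c" and xy: "ord x = ord y"
  shows "cyc x = cyc y"
proof -
  have *: "cyc x = cyc (c [^] (ord c div ord x))" if x: "x \<in> cyc c" for x
  proof -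
    obtain i :: nat where i: "x = c [^] i" using x c cyc_powers by blast
    have xc: "x \<in> carrier G" using x c cyc_subset by blast
    obtain e where e: "ord c = ord x * e"
      using ord_dvd_of_mem_cyc[OF c x] by blast
    have x0: "ord x > 0" and e0: "e \<noteq> 0"
      using ord_pos[OF xc] ord_pos[OF c] e by auto
    have dv: "ord c div ord x = e" using e x0 by simp
    have ord_e: "ord (c [^] e) = ord x"
      using ord_pow[OF c _ e0] e e0 by simp
    have "c [^] (i * ord x) = x [^] ord x"
      using nat_pow_pow[OF c, of i "ord x"] i by simp
    then have "c [^] (i * ord x) = \<one>" using xc by simp
    then have "e dvd i" using pow_eq_id[OF c] e x0 by (simp add: mult.commute)
    then obtain k where "i = e * k" by blast
    then have "x \<in> cyc (c [^] e)"
      using i c cyc_powers[of "c [^] e"] by (auto simp: nat_pow_pow)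
    then show ?thesis unfolding dv using cyc_eq_iff_ord[of "c [^] e" x] ord_e c by simp
  qed
  show ?thesis by (subst *[OF x], subst *[OF y]) (simp add: xy)
qed

text \<open>The bijection with the divisors is \<open>card\<close>: injective because a cyclic group
  has one subgroup of each order, onto because \<open>c [^] e\<close> has order \<open>d\<close>
  when \<open>ord c = d * e\<close>.\<close>

lemma card_cyclic_subgroups_cyc:
  assumes c: "c \<in> carrier G"
  shows "card (cyc ` cyc c) = card {d. d dvd ord c}"
proof -
  have inj: "inj_on card (cyc ` cyc c)"
  proof (rule inj_onI)
    fix D E assume "D \<in> cyc ` cyc c" "E \<in> cyc ` cyc c" and DE: "card D = card E"
    then obtain x y where xy: "x \<in> cyc c" "y \<in> cyc c" "D = cyc x" "E = cyc y" by blast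
    then have "x \<in> carrier G" "y \<in> carrier G" using cyc_subset[OF c] by auto
    then have "ord x = ord y" using DE xy card_cyc by simp
    then show "D = E" using unique_subgroup_of_cyc[OF c xy(1,2)] xy(3,4) by blast
  qed
  have "card ` cyc ` cyc c = {d. d dvd ord c}"
  proof (intro subset_antisym subsetI)
    fix d assume "d \<in> {d. d dvd ord c}"
    then obtain e where e: "ord c = d * e" by blast
    then have de: "d > 0" "e \<noteq> 0" using ord_pos[OF c] by auto
    then have "ord (c [^] e) = d" using ord_pow[OF c _ de(2)] e by simp
    moreover have "c [^] e \<in> cyc c" using cyc_powers[OF c] by auto
    ultimately have "card (cyc (c [^] e)) = d" "cyc (c [^] e) \<in> cyc ` cyc c"
      using card_cyc[of "c [^] e"] c by auto
    then show "d \<in> card ` cyc ` cyc c" by blast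
  next
    fix d assume "d \<in> card ` cyc ` cyc c"
    then obtain x where x: "x \<in> cyc c" "d = card (cyc x)" by auto
    then have "x \<in> carrier G" using cyc_subset[OF c] by blast
    then have "d = ord x" using card_cyc x by simp
    then show "d \<in> {d. d dvd ord c}" using ord_dvd_of_mem_cyc[OF c x(1)] by simp
  qed
  then show ?thesis using card_image[OF inj] by simp
qed

end

section \<open>Numbers with few divisors\<close>

lemma card_divisors_mult_coprime:
  fixes a b :: nat
  assumes ab: "coprime a b" "a > 0" "b > 0"
  shows "card {d. d dvd a * b} = card {d. d dvd a} * card {d. d dvd b}"
proof -
  have "bij_betw (\<lambda>(x, y). x * y) ({d. d dvd a} \<times> {d. d dvd b}) {d. d dvd a * b}"
    unfolding bij_betw_def
  proof
    show "inj_on (\<lambda>(x, y). x * y) ({d. d dvd a} \<times> {d. d dvd b})"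
    proof (rule inj_onI, clarsimp)
      fix x y x' y' assume d: "x dvd a" "y dvd b" "x' dvd a" "y' dvd b" "x * y = x' * y'"
      have "coprime x y'" "coprime x' y" "coprime y x'" "coprime y' x"
        using d ab by (meson coprime_divisors coprime_commute)+
      then have "x dvd x'" "x' dvd x" "y dvd y'" "y' dvd y"
        using d(5) by (metis coprime_dvd_mult_left_iff coprime_dvd_mult_right_iff dvd_triv_left dvd_triv_right)+
      then show "x = x' \<and> y = y'" by (simp add: dvd_antisym)
    qed
    show "(\<lambda>(x, y). x * y) ` ({d. d dvd a} \<times> {d. d dvd b}) = {d. d dvd a * b}"
    proof (intro subset_antisym subsetI)
      fix d assume "d \<in> {d. d dvd a * b}"
      then obtain x y where "d = x * y" "x dvd a" "y dvd b" using division_decomp by blast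
      then show "d \<in> (\<lambda>(x, y). x * y) ` ({d. d dvd a} \<times> {d. d dvd b})" by force
    qed (auto simp: mult_dvd_mono)
  qed
  then show ?thesis using bij_betw_same_card card_cartesian_product by metis
qed

lemma card_divisors_prime_power:
  fixes p :: nat
  assumes "prime p"
  shows "card {d. d dvd p ^ a} = Suc a"
proof -
  have "{d. d dvd p ^ a} = (\<lambda>i. p ^ i) ` {..a}"
    using divides_primepow_nat[OF assms] by auto
  moreover have "inj_on (\<lambda>i. p ^ i) {..a}"
    using prime_gt_1_nat[OF assms] by (auto simp: inj_on_def)
  ultimately show ?thesis by (simp add: card_image)
qed

lemma card_divisors_pos: "(n::nat) > 0 \<Longrightarrow> card {d. d dvd n} > 0"
  by (auto simp: card_gt_0_iff intro: exI[of _ 1])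

text \<open>Splitting off the full power of one prime factors the divisor count with a factor
  \<open>a + 2\<close>, so a prescribed count leaves few exponents to inspect.\<close>

lemma card_divisors_split:
  fixes n :: nat
  assumes "n > 1"
  obtains p a k where "prime p" "n = p ^ Suc a * k" "k > 0" "\<not> p dvd k"
    "card {d. d dvd n} = (a + 2) * card {d. d dvd k}"
proof -
  obtain p where p: "prime p" "p dvd n" using assms prime_factor_nat[of n] by auto
  define b where "b = multiplicity p n"
  have "b > 0" using p assms by (simp add: b_def prime_multiplicity_gt_zero_iff)
  then obtain a where a: "b = Suc a" by (cases b) auto
  obtain k where k: "n = p ^ b * k" "\<not> p dvd k"
    using multiplicity_decompose'[of n p] p assms unfolding b_def by (metis not_prime_unit not_less_zero)
  have k0: "k > 0" using k assms by (cases k) auto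
  have "coprime (p ^ b) k" using p k(2) by (simp add: prime_imp_coprime)
  then have "card {d. d dvd n} = card {d. d dvd p ^ b} * card {d. d dvd k}"
    unfolding k(1) using k0 p by (intro card_divisors_mult_coprime) (auto simp: prime_gt_0_nat)
  then show ?thesis
    using that[of p a k] p k k0 card_divisors_prime_power[OF p(1), of b] by (simp del: power_Suc add: a)
qed

lemma card_divisors_eq_1_iff: "(n::nat) > 0 \<Longrightarrow> card {d. d dvd n} = 1 \<longleftrightarrow> n = 1"
proof
  assume n: "n > 0" "card {d. d dvd n} = 1"
  show "n = 1"
  proof (rule ccontr)
    assume "n \<noteq> 1"
    then have "n > 1" using n by simp
    from card_divisors_split[OF this] obtain p a k
      where "prime p" "n = p ^ Suc a * k" "k > 0" "\<not> p dvd k"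
        "card {d. d dvd n} = (a + 2) * card {d. d dvd k}" .
    then show False using n card_divisors_pos[of k] by simp
  qed
qed simp

text \<open>A prime count has no proper factorisation, so the cofactor \<open>k\<close> of the prime
  power has one divisor only and equals 1.\<close>

lemma card_divisors_prime_cases:
  fixes n :: nat
  assumes n: "n > 0" "card {d. d dvd n} = t" and t: "prime t"
  obtains p where "prime p" "n = p ^ (t - 1)"
proof -
  have "n \<noteq> 1" using n t by auto
  then have "n > 1" using n by simp
  from card_divisors_split[OF this] obtain p a k
    where p: "prime p" "n = p ^ Suc a * k" "k > 0" "\<not> p dvd k"
      "card {d. d dvd n} = (a + 2) * card {d. d dvd k}" .
  then have "t = (a + 2) * card {d. d dvd k}" using n(2) by (simp only:)
  then have "card {d. d dvd k} = 1" "a + 2 = t"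
    using prime_product[of "a + 2" "card {d. d dvd k}"] t by auto
  then show ?thesis using that[of p] p card_divisors_eq_1_iff[of k] by auto
qed

lemma card_divisors_eq_4:
  fixes n :: nat
  assumes n: "n > 0" "card {d. d dvd n} = 4"
  obtains p where "prime p" "n = p ^ 3" | p q where "prime p" "prime q" "p < q" "n = p * q"
proof -
  have "n \<noteq> 1" using n by auto
  then have "n > 1" using n by simp
  from card_divisors_split[OF this] obtain p a k
    where p: "prime p" "n = p ^ Suc a * k" "k > 0" "\<not> p dvd k" "card {d. d dvd n} = (a + 2) * card {d. d dvd k}" .
  have 4: "(a + 2) * card {d. d dvd k} = 4" using p n by simp
  then have dv: "a + 2 dvd 4" by (intro dvdI[of _ _ "card {d. d dvd k}"]) simp
  have "b \<in> {2, 4}" if "b dvd 4" "2 \<le> b" for b :: nat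
  proof -
    from dvd_imp_le[OF that(1)] that(2) consider "b = 2" | "b = 3" | "b = 4" by linarith
    then show ?thesis using that by cases auto
  qed
  from this[OF dv le_add2] have "a = 0 \<or> a = 2" by auto
  then show ?thesis
  proof
    assume a: "a = 0"
    then have "card {d. d dvd k} = 2" using 4 by simp
    then obtain q where q: "prime q" "k = q" using card_divisors_prime_cases[OF p(3), of 2] by auto
    then have "p \<noteq> q" using p(4) by auto
    with q show ?thesis using that(2)[of p q] that(2)[of q p] p a by (cases "p < q") (auto simp: mult.commute)
  next
    assume a: "a = 2"
    then have "k = 1" using 4 p card_divisors_eq_1_iff by simp
    then show ?thesis using that(1)[of p] p a by (simp add: eval_nat_numeral)
  qed
qed

lemma card_divisors_eq_6:
  fixes n :: nat
  assumes n: "n > 0" "card {d. d dvd n} = 6"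
  obtains p where "prime p" "n = p ^ 5" | p q where "prime p" "prime q" "p \<noteq> q" "n = p ^ 2 * q"
proof -
  have "n \<noteq> 1" using n by auto
  then have "n > 1" using n by simp
  from card_divisors_split[OF this] obtain p a k
    where p: "prime p" "n = p ^ Suc a * k" "k > 0" "\<not> p dvd k" "card {d. d dvd n} = (a + 2) * card {d. d dvd k}" .
  have 6: "(a + 2) * card {d. d dvd k} = 6" using p n by simp
  then have dv: "a + 2 dvd 6" by (intro dvdI[of _ _ "card {d. d dvd k}"]) simp
  have "b \<in> {2, 3, 6}" if "b dvd 6" "2 \<le> b" for b :: nat
  proof -
    from dvd_imp_le[OF that(1)] that(2) consider "b = 2" | "b = 3" | "b = 4" | "b = 5" | "b = 6" by linarith
    then show ?thesis using that by cases auto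
  qed
  from this[OF dv le_add2] have "a = 0 \<or> a = 1 \<or> a = 4" by auto
  then consider "a = 0" | "a = 1" | "a = 4" by blast
  then show ?thesis
  proof cases
    assume a: "a = 0"
    then have "card {d. d dvd k} = 3" using 6 by simp
    then obtain q where q: "prime q" "k = q ^ 2" using card_divisors_prime_cases[OF p(3), of 3] by auto
    then have "p \<noteq> q" using p(4) by auto
    with q show ?thesis using that(2)[of q p] p a by (auto simp: mult.commute)
  next
    assume a: "a = 1"
    then have "card {d. d dvd k} = 2" using 6 by simp
    then obtain q where q: "prime q" "k = q" using card_divisors_prime_cases[OF p(3), of 2] by auto
    then have "p \<noteq> q" using p(4) by auto
    with q show ?thesis using that(2)[of p q] p a by (auto simp: power2_eq_square)
  next
    assume a: "a = 4"
    then have "k = 1" using 6 p card_divisors_eq_1_iff by simp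
    then show ?thesis using that(1)[of p] p a by (simp add: eval_nat_numeral)
  qed
qed

lemma card_divisors_eq_8:
  fixes n :: nat
  assumes n: "n > 0" "card {d. d dvd n} = 8"
  obtains p where "prime p" "n = p ^ 7"
    | p q where "prime p" "prime q" "p \<noteq> q" "n = p ^ 3 * q"
    | p q r where "prime p" "prime q" "prime r" "p < q" "q < r" "n = p * q * r"
proof -
  have "n \<noteq> 1" using n by auto
  then have "n > 1" using n by simp
  from card_divisors_split[OF this] obtain p a k
    where p: "prime p" "n = p ^ Suc a * k" "k > 0" "\<not> p dvd k" "card {d. d dvd n} = (a + 2) * card {d. d dvd k}" .
  have 8: "(a + 2) * card {d. d dvd k} = 8" using p n by simp
  then have dv: "a + 2 dvd 8" by (intro dvdI[of _ _ "card {d. d dvd k}"]) simp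
  have "b \<in> {2, 4, 8}" if "b dvd 8" "2 \<le> b" for b :: nat
  proof -
    from dvd_imp_le[OF that(1)] that(2) consider "b = 2" | "b = 3" | "b = 4" | "b = 5" | "b = 6" | "b = 7" | "b = 8" by linarith
    then show ?thesis using that by cases auto
  qed
  from this[OF dv le_add2] have "a = 0 \<or> a = 2 \<or> a = 6" by auto
  then consider "a = 0" | "a = 2" | "a = 6" by blast
  then show ?thesis
  proof cases
    assume a: "a = 0"
    then have "card {d. d dvd k} = 4" using 8 by simp
    then consider q where "prime q" "k = q ^ 3" | q r where "prime q" "prime r" "q < r" "k = q * r"
      using card_divisors_eq_4[OF p(3)] by metis
    then show ?thesis
    proof cases
      case (1 q)
      then have "p \<noteq> q" using p(4) by auto
      with 1 show ?thesis using that(2)[of q p] p a by (auto simp: mult.commute)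
    next
      case (2 q r)
      then have "p \<noteq> q" "p \<noteq> r" using p by auto
      then consider "p < q" | "q < p" "p < r" | "r < p" using 2 by linarith
      then show ?thesis
      proof cases
        case 1
        then show ?thesis using that(3)[of p q r] 2 p a by (simp add: ac_simps)
      next
        case c: 2
        then show ?thesis using that(3)[of q p r] 2 p a by (simp add: ac_simps)
      next
        case 3
        then show ?thesis using that(3)[of q r p] 2 p a by (simp add: ac_simps)
      qed
    qed
  next
    assume a: "a = 2"
    then have "card {d. d dvd k} = 2" using 8 by simp
    then obtain q where q: "prime q" "k = q" using card_divisors_prime_cases[OF p(3), of 2] by auto
    then have "p \<noteq> q" using p(4) by auto
    with q show ?thesis using that(2)[of p q] p a by (auto simp: eval_nat_numeral)
  next
    assume a: "a = 6"
    then have "k = 1" using 8 p card_divisors_eq_1_iff by simp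
    then show ?thesis using that(1)[of p] p a by (simp add: eval_nat_numeral)
  qed
qed

text \<open>Division with remainder by \<open>f\<close> embeds the totatives of \<open>e * f\<close>
  into pairs of a quotient below \<open>e\<close> and a totative of \<open>f\<close>;
  \<open>f > 1\<close> keeps the remainder away from 0. It bounds the generators of a cyclic
  subgroup that meets \<open>cyc c\<close> in \<open>e\<close> elements.\<close>

lemma totient_mult_le: "f > 1 \<Longrightarrow> totient (e * f) \<le> e * totient f"
proof (cases "e = 0")
  case False
  assume f: "f > 1"
  have "card (totatives (e * f)) \<le> card ({0..<e} \<times> totatives f)"
  proof (rule card_inj_on_le)
    show "inj_on (\<lambda>x. (x div f, x mod f)) (totatives (e * f))"
      by (rule inj_onI) (metis div_mult_mod_eq prod.inject)
    show "(\<lambda>x. (x div f, x mod f)) ` totatives (e * f) \<subseteq> {0..<e} \<times> totatives f"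
    proof (rule image_subsetI)
      fix x assume x: "x \<in> totatives (e * f)"
      have "e * f > 1" using f False by (metis less_1_mult mult.left_neutral nat_neq_iff less_one)
      then have "x < e * f" using x totatives_less by blast
      then have "x div f < e" using f by (simp add: less_mult_imp_div_less)
      moreover have cop: "coprime (x mod f) f" using x f by (simp add: in_totatives_iff)
      moreover have "x mod f \<noteq> 0"
      proof
        assume "x mod f = 0"
        with cop have "coprime 0 f" by (simp only:)
        then show False using f by simp
      qed
      moreover have "x mod f \<le> f" using f by (simp add: less_imp_le)
      ultimately show "(x div f, x mod f) \<in> {0..<e} \<times> totatives f"
        by (auto simp: in_totatives_iff)
    qed
  qed auto
  then show ?thesis by (simp add: totient_def card_cartesian_product)
qed simp

context finite_group
begin

lemma card_subgroup_dvd: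
  assumes "subgroup H G" "subgroup K G" "H \<subseteq> K"
  shows "card H dvd card K"
proof -
  interpret K: group "G\<lparr>carrier := K\<rparr>" using assms subgroup_imp_group by blast
  have "subgroup H (G\<lparr>carrier := K\<rparr>)" using assms by (rule subgroup_incl)
  from K.lagrange[OF this]
  have "card K = card H * card (rcosets\<^bsub>G\<lparr>carrier := K\<rparr>\<^esub> H)"
    by (simp add: order_def mult.commute)
  then show ?thesis by (rule dvdI)
qed

lemma ex_maximal_cyclic:
  obtains c m where "c \<in> carrier G" "card (carrier G) = ord c * m"
    "\<forall>x\<in>carrier G.
       totient (ord x) < totient (ord c) \<or> totient (ord x) = totient (ord c) \<and> ord x \<le> ord c"
proof -
  let ?g = "card (carrier G)"
  \<comment> \<open>The lexicographic order on the pair of totient and order, as one number: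
    \<open>ord x\<close> is a digit in base \<open>Suc ?g\<close>, because it never exceeds
    \<open>?g\<close>.\<close>
  let ?w = "\<lambda>x. totient (ord x) * Suc ?g + ord x"
  obtain c where c: "c \<in> carrier G" "\<And>x. x \<in> carrier G \<Longrightarrow> ?w x \<le> ?w c"
  proof -
    have "?w ` carrier G \<noteq> {}" by auto
    then have "Max (?w ` carrier G) \<in> ?w ` carrier G" by (intro Max_in) auto
    then obtain c where "c \<in> carrier G" "?w c = Max (?w ` carrier G)" by auto
    then show ?thesis using that[of c] Max_ge[of "?w ` carrier G"] by auto
  qed
  have le: "ord x \<le> ?g" if "x \<in> carrier G" for x
    using that ord_le_group_order by (simp add: order_def)
  have "totient (ord x) < totient (ord c) \<or> totient (ord x) = totient (ord c) \<and> ord x \<le> ord c"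
    if x: "x \<in> carrier G" for x
  proof -
    have *: "?w x \<le> ?w c" using c(2)[OF x] .
    consider "totient (ord x) < totient (ord c)" | "totient (ord x) = totient (ord c)"
      | "totient (ord c) + 1 \<le> totient (ord x)" by linarith
    then show ?thesis
    proof cases
      case 3
      then have "(totient (ord c) + 1) * Suc ?g \<le> totient (ord x) * Suc ?g" by (rule mult_right_mono) simp
      then have False using * le[OF c(1)] by simp
      then show ?thesis ..
    qed (use * in auto)
  qed
  moreover obtain m where "?g = ord c * m"
    using ord_dvd_group_order[OF c(1)] by (auto simp: order_def)
  ultimately show ?thesis using that c(1) by blast
qed

end

section \<open>A cyclic subgroup with the most generators\<close>

text \<open>Maximality refers first to the number of generators and only then to the order, so that every
  cyclic subgroup has at most \<open>totient n\<close> generators.\<close>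

locale max_cyclic = finite_group +
  fixes c :: 'a and m :: nat
  assumes c [simp]: "c \<in> carrier G"
    and card_G: "card (carrier G) = ord c * m"
    and maximal: "x \<in> carrier G \<Longrightarrow>
       totient (ord x) < totient (ord c) \<or> totient (ord x) = totient (ord c) \<and> ord x \<le> ord c"
    and m: "2 \<le> m"
begin

abbreviation "n \<equiv> ord c"

definition out :: "'a set" where
  "out = carrier G - cyc c"

lemma n_pos [simp]: "n > 0"
  by (simp add: ord_pos)

lemma n_neq_0 [simp]: "n \<noteq> 0"
  using n_pos by (rule gr_implies_not0)

lemma outI: "x \<in> carrier G \<Longrightarrow> x \<notin> cyc c \<Longrightarrow> x \<in> out"
  by (simp add: out_def)

lemma out_carrier [simp]: "x \<in> out \<Longrightarrow> x \<in> carrier G"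
  by (simp add: out_def)

lemma card_out: "card out = n * (m - 1)"
proof -
  have "card out = card (carrier G) - card (cyc c)"
    unfolding out_def by (intro card_Diff_subset finite_cyc cyc_subset c)
  then show ?thesis using card_cyc[OF c] card_G by (simp add: diff_mult_distrib2)
qed

text \<open>The product inequality for \<open>cyc x\<close> and \<open>cyc c\<close> in a group of
  order \<open>n * m\<close> gives \<open>f \<le> m\<close>, and \<open>f = 1\<close> would put
  \<open>x\<close> into \<open>cyc c\<close>.\<close>

lemma out_ord:
  assumes x: "x \<in> out"
  obtains e f where "ord x = e * f" "e dvd n" "e < n" "2 \<le> f" "f \<le> m" "e > 0"
    "e = card (cyc x \<inter> cyc c)"
proof -
  have xc: "x \<in> carrier G" using x by simp
  let ?e = "card (cyc x \<inter> cyc c)"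
  have sub: "subgroup (cyc x \<inter> cyc c) G"
    using xc by (intro subgroups_Inter_pair subgroup_cyc) auto
  have dx: "?e dvd ord x" using card_subgroup_dvd[OF sub subgroup_cyc[OF xc]] card_cyc[OF xc] by simp
  have dc: "?e dvd n" using card_subgroup_dvd[OF sub subgroup_cyc[OF c]] card_cyc[OF c] by simp
  have e0: "?e > 0" using dc n_pos by (metis dvd_pos_nat)
  obtain f where f: "ord x = ?e * f" using dx by blast
  have "f \<noteq> 0" using f ord_pos[OF xc] by (intro notI) simp
  moreover have "f \<noteq> 1"
  proof
    assume "f = 1"
    then have "card (cyc x \<inter> cyc c) = card (cyc x)" using f card_cyc[OF xc] by simp
    then have "cyc x \<inter> cyc c = cyc x" by (intro card_subset_eq finite_cyc xc) auto
    then show False using x cyc_self[of x] unfolding out_def by blast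
  qed
  ultimately have f2: "2 \<le> f" by simp
  have "ord x * n \<le> n * m * ?e"
    using card_le_card_Int[OF subgroup_cyc[OF xc] subgroup_cyc[OF c]] card_cyc[OF xc] card_cyc[OF c] card_G
    by simp
  then have "(?e * n) * f \<le> (?e * n) * m" unfolding f by (simp only: mult_ac)
  moreover have "0 < ?e * n" using e0 by simp
  ultimately have fm: "f \<le> m" by simp
  \<comment> \<open>Otherwise \<open>cyc c\<close> lies properly inside \<open>cyc x\<close>, which
    then has at least as many generators and larger order. The tie-break by order is needed here:
    orders 3 and 6 have equal totients.\<close>
  have "?e \<noteq> n"
  proof
    assume en: "?e = n"
    then have "n < ord x" using f f2 n_pos by simp
    moreover have "totient n \<le> totient (ord x)"
      using totient_dvd_mono[of n "ord x"] f en ord_pos[OF xc] by simp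
    ultimately show False using maximal[OF xc] by simp
  qed
  then have "?e < n" using dc dvd_imp_le[of ?e n] by simp
  then show ?thesis using that f dc f2 fm e0 by blast
qed

text \<open>These numbers are the unknowns of the counting equations; subgroups contained in
  \<open>cyc c\<close> are left out because the divisors of \<open>n\<close> account for
  them.\<close>

definition N :: "nat \<Rightarrow> nat" where
  "N k = card {D \<in> cyc ` out. card D = k}"

lemma finite_out [simp]: "finite out"
  by (simp add: out_def)

lemma N_pos_iff: "N k > 0 \<longleftrightarrow> (\<exists>x\<in>out. ord x = k)"
proof -
  have "N k > 0 \<longleftrightarrow> {D \<in> cyc ` out. card D = k} \<noteq> {}"
    unfolding N_def by (subst card_gt_0_iff) simp
  also have "\<dots> \<longleftrightarrow> (\<exists>x\<in>out. card (cyc x) = k)" by blast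
  finally show ?thesis using card_cyc by simp
qed

lemma out_saturated: "x \<in> out \<Longrightarrow> y \<in> carrier G \<Longrightarrow> cyc y = cyc x \<Longrightarrow> y \<in> out"
  using cyc_mono[of y c] cyc_self[of x] unfolding out_def by auto

text \<open>Two linear equations over the naturals: one counts subgroups, the other counts elements
  through their generators. Once all outside orders lie in a short list \<open>K\<close>, they
  decide most cases.\<close>

lemma sum_N:
  assumes K: "finite K" "\<And>x. x \<in> out \<Longrightarrow> ord x \<in> K"
  shows "(\<Sum>k\<in>K. N k) + card {d. d dvd n} = card (cyclic_subgroups G)"
    and "(\<Sum>k\<in>K. totient k * N k) = n * (m - 1)"
proof -
  have U: "cyc ` out = (\<Union>k\<in>K. {D \<in> cyc ` out. card D = k})"
  proof -
    have "card (cyc x) \<in> K" if "x \<in> out" for x using that K card_cyc[of x] by simp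
    then show ?thesis by blast
  qed
  have fin: "finite (cyc ` out)" by simp
  have out: "card (cyc ` out) = (\<Sum>k\<in>K. N k)"
    unfolding N_def by (subst U, rule card_UN_disjoint) (use K in auto)
  have "cyclic_subgroups G = cyc ` out \<union> cyc ` cyc c"
    unfolding cyclic_subgroups_eq out_def using cyc_subset[OF c] by blast
  moreover have "cyc ` out \<inter> cyc ` cyc c = {}"
  proof -
    have "cyc x \<noteq> cyc y" if "x \<in> out" "y \<in> cyc c" for x y
      using that cyc_self[of x] cyc_mono[of y c] unfolding out_def by auto
    then show ?thesis by blast
  qed
  ultimately have "card (cyclic_subgroups G) = card (cyc ` out) + card (cyc ` cyc c)"
    using finite_cyc[OF c] by (simp add: card_Un_disjoint)
  then show "(\<Sum>k\<in>K. N k) + card {d. d dvd n} = card (cyclic_subgroups G)"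
    using out card_cyclic_subgroups_cyc[OF c] by simp
  have "card out = (\<Sum>D\<in>cyc ` out. totient (card D))"
    by (rule card_saturated) (auto intro: out_saturated)
  also have "\<dots> = (\<Sum>k\<in>K. \<Sum>D\<in>{D \<in> cyc ` out. card D = k}. totient (card D))"
    by (subst U, rule sum.UNION_disjoint) (use K in auto)
  also have "\<dots> = (\<Sum>k\<in>K. \<Sum>D\<in>{D \<in> cyc ` out. card D = k}. totient k)"
    by (intro sum.cong) auto
  also have "\<dots> = (\<Sum>k\<in>K. totient k * N k)"
    unfolding N_def by (intro sum.cong) auto
  finally show "(\<Sum>k\<in>K. totient k * N k) = n * (m - 1)"
    using card_out by simp
qed

lemma out_nonempty: "out \<noteq> {}"
proof -
  have "card out > 0" using card_out m by simp
  then show ?thesis by auto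
qed

text \<open>Replaces every totient in the second equation of \<open>sum_N\<close> by the bound
  \<open>B\<close> and removes the unknowns with the first equation.\<close>

lemma card_out_le:
  assumes "\<And>x. x \<in> out \<Longrightarrow> totient (ord x) \<le> B"
  shows "n * (m - 1) \<le> (card (cyclic_subgroups G) - card {d. d dvd n}) * B"
proof -
  let ?K = "ord ` out"
  have "n * (m - 1) = (\<Sum>k\<in>?K. totient k * N k)" by (rule sum_N(2)[symmetric]) auto
  also have "\<dots> \<le> (\<Sum>k\<in>?K. B * N k)" using assms by (intro sum_mono mult_right_mono) auto
  also have "\<dots> = B * (\<Sum>k\<in>?K. N k)" by (simp add: sum_distrib_left)
  also have "(\<Sum>k\<in>?K. N k) = card (cyclic_subgroups G) - card {d. d dvd n}"
    using sum_N(1)[of ?K] by simp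
  finally show ?thesis by (simp add: mult.commute)
qed

lemma card_divisors_less: "card {d. d dvd n} < card (cyclic_subgroups G)"
proof -
  obtain x where x: "x \<in> out" using out_nonempty by blast
  have "N (ord x) > 0" using x N_pos_iff by blast
  moreover have "N (ord x) \<le> (\<Sum>k\<in>ord ` out. N k)" using x by (intro member_le_sum) auto
  ultimately show ?thesis using sum_N(1)[of "ord ` out"] by simp
qed

end

lemma totient_values:
  "totient 3 = 2" "totient 4 = 2" "totient 5 = 4" "totient 6 = 2" "totient 8 = 4" "totient 9 = 6"
  "totient 10 = 4" "totient 12 = 4" "totient 15 = 8" "totient 16 = 8" "totient 18 = 6" "totient 25 = 20"
  "totient 27 = 18" "totient 32 = 16" "totient 54 = 18" "totient 81 = 54"
proof -
  show *: "totient 3 = 2" "totient 5 = 4" by (simp_all add: totient_prime)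
  show "totient 4 = 2" "totient 6 = 2" by simp_all
  show **: "totient 8 = 4" "totient 9 = 6" "totient 16 = 8" "totient 25 = 20" "totient 27 = 18"
    "totient 32 = 16" "totient 81 = 54"
    using totient_power[of 3 2] totient_power[of 2 3] totient_power[of 4 2] totient_power[of 2 5]
      totient_power[of 5 2] totient_power[of 3 3] totient_power[of 5 2] totient_power[of 4 3] *
    by simp_all
  show "totient 10 = 4" "totient 12 = 4" "totient 18 = 6" "totient 54 = 18"
    using totient_double[of 5] totient_double[of 6] totient_double[of 9] totient_double[of 27] * ** by simp_all
  show "totient 15 = 8" using totient_mult_coprime[of 3 5] * by (simp add: coprime_iff_gcd_eq_1 gcd_nat.simps)
qed

section \<open>Numerical constraints from exactly eight cyclic subgroups\<close>

locale eight_cyclic = max_cyclic +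
  assumes eight: "card (cyclic_subgroups G) = 8"
begin

lemma ord_dvd_nm: "x \<in> out \<Longrightarrow> ord x dvd n * m"
  using ord_dvd_group_order[of x] card_G by (simp add: order_def)

lemma out_ord_prime_power:
  assumes "n = p ^ Suc a" "prime p" "x \<in> out"
  obtains i f where "i \<le> a" "ord x = p ^ i * f" "2 \<le> f" "f \<le> m"
proof -
  from out_ord[OF assms(3)] obtain e f
    where e: "ord x = e * f" "e dvd n" "e < n" "2 \<le> f" "f \<le> m" by metis
  have "e dvd p ^ Suc a" using e(2) assms(1) by (simp only:)
  then obtain i where "e = p ^ i" "i \<le> Suc a"
    unfolding divides_primepow_nat[OF assms(2)] by blast
  moreover then have "i \<noteq> Suc a" using e assms(1) by auto
  ultimately show ?thesis using that[of i f] e by simp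
qed

lemma n_prime_power:
  assumes "card {d. d dvd n} = t" "prime t" "t = Suc (Suc a)"
  obtains p where "prime p" "n = p ^ Suc a"
proof -
  obtain p where "prime p" "n = p ^ (t - 1)"
    by (rule card_divisors_prime_cases[OF n_pos assms(1,2)])
  then show ?thesis using that[of p] assms(3) by simp
qed

lemma totient_n_less: "n > 1 \<Longrightarrow> totient n < n"
  by (rule totient_less)

lemma le_totient_n: "n * (m - 1) \<le> (8 - card {d. d dvd n}) * totient n"
proof -
  have "totient (ord x) \<le> totient n" if "x \<in> out" for x
    using maximal[of x] that by auto
  from card_out_le[OF this] show ?thesis by (simp add: eight)
qed

text \<open>If \<open>m - 1\<close> reached \<open>8 - t\<close>, the counting inequality would
  yield \<open>n \<le> totient n\<close>, which is impossible for \<open>n > 1\<close>.\<close>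

lemma m_bound:
  assumes "card {d. d dvd n} = t" "n > 1"
  shows "m \<le> 8 - t"
proof (rule ccontr)
  assume "\<not> m \<le> 8 - t"
  then have "n * (8 - t) \<le> n * (m - 1)" by (intro mult_le_mono2) simp
  also have "\<dots> \<le> (8 - t) * totient n" using le_totient_n assms by simp
  finally have "(8 - t) * n \<le> (8 - t) * totient n" by (simp add: mult.commute)
  moreover have "8 - t > 0" using card_divisors_less eight assms by simp
  ultimately show False using totient_n_less assms by simp
qed

lemma n_gt_1: "n > 1"
proof -
  obtain x where x: "x \<in> out" using out_nonempty by blast
  from out_ord[OF x] obtain e where "e < n" "e > 0" by metis
  then show ?thesis by simp
qed

lemma totient_out_le:
  assumes "n = p ^ Suc a" "prime p" "x \<in> out" and f: "\<And>f. 2 \<le> f \<Longrightarrow> f \<le> m \<Longrightarrow> totient f \<le> t"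
  shows "totient (ord x) \<le> p ^ a * t"
proof -
  from out_ord_prime_power[OF assms(1-3)] obtain i f
    where i: "i \<le> a" "ord x = p ^ i * f" "2 \<le> f" "f \<le> m" by metis
  have "totient (ord x) \<le> p ^ i * totient f" using i by (simp add: totient_mult_le)
  also have "\<dots> \<le> p ^ a * t"
    using i f assms(2) by (intro mult_le_mono power_increasing) (auto simp: Suc_leI prime_gt_0_nat)
  finally show ?thesis .
qed

text \<open>Outside generators are bounded through \<open>ord x = p ^ i * f\<close> with
  \<open>i \<le> a\<close>. After division by \<open>p ^ a\<close> the right side is free of
  \<open>p\<close>, so this bounds \<open>p\<close> from above.\<close>

lemma prime_index_bound:
  assumes "n = p ^ Suc a" "prime p" "card {d. d dvd n} = s"
    and f: "\<And>f. 2 \<le> f \<Longrightarrow> f \<le> m \<Longrightarrow> totient f \<le> t"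
  shows "p * (m - 1) \<le> (8 - s) * t"
proof -
  have "n * (m - 1) \<le> (8 - s) * (p ^ a * t)"
    using card_out_le[of "p ^ a * t"] totient_out_le[OF assms(1,2) _ f] assms(3) eight by simp
  then have "p ^ a * (p * (m - 1)) \<le> p ^ a * ((8 - s) * t)"
    using assms(1) by (simp add: mult_ac)
  then show ?thesis using prime_gt_0_nat[OF assms(2)] by simp
qed

text \<open>The opposite effect, from the bound \<open>totient n\<close>: for large \<open>m\<close>
  it excludes small primes, because \<open>totient n\<close> is then too small compared with
  \<open>n\<close>.\<close>

lemma prime_index_bound_totient:
  assumes "n = p ^ Suc a" "prime p" "card {d. d dvd n} = s"
  shows "p * (m - 1) \<le> (8 - s) * (p - 1)"
proof -
  have "n * (m - 1) \<le> (8 - s) * (p ^ a * (p - 1))"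
    using le_totient_n assms totient_prime_power_Suc[OF assms(2), of a] by simp
  then have "p ^ a * (p * (m - 1)) \<le> p ^ a * ((8 - s) * (p - 1))"
    using assms(1) by (simp add: mult_ac)
  then show ?thesis using prime_gt_0_nat[OF assms(2)] by simp
qed

lemma small_totient:
  fixes f :: nat
  assumes "2 \<le> f"
  shows "f \<le> 2 \<Longrightarrow> totient f \<le> 1" "f \<le> 3 \<Longrightarrow> totient f \<le> 2" "f \<le> 4 \<Longrightarrow> totient f \<le> 2"
    "f \<le> 5 \<Longrightarrow> totient f \<le> 4" "f \<le> 6 \<Longrightarrow> totient f \<le> 4"
proof -
  have "f \<in> {2, 3, 4, 5, 6}" if "f \<le> 6" using that assms by auto
  note this[THEN insertE]
  then have *: "f \<le> 6 \<Longrightarrow> f = 2 \<or> f = 3 \<or> f = 4 \<or> f = 5 \<or> f = 6" by auto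
  show "f \<le> 2 \<Longrightarrow> totient f \<le> 1" "f \<le> 3 \<Longrightarrow> totient f \<le> 2" "f \<le> 4 \<Longrightarrow> totient f \<le> 2"
    "f \<le> 5 \<Longrightarrow> totient f \<le> 4" "f \<le> 6 \<Longrightarrow> totient f \<le> 4"
    using * by (auto simp: totient_values)
qed

lemma ord_out_neq:
  assumes "totient k = totient n" "k > n"
  shows "x \<in> out \<Longrightarrow> ord x \<noteq> k"
  using maximal[of x] assms by auto

lemma card_divisors_not_7: "card {d. d dvd n} \<noteq> 7"
  using m_bound[of 7] m n_gt_1 by auto

end

lemma prime_le_5:
  fixes p :: nat
  assumes "prime p" "p \<le> 6"
  shows "p = 2 \<or> p = 3 \<or> p = 5"
proof -
  have "p = 2 \<or> p = 3 \<or> p = 4 \<or> p = 5 \<or> p = 6"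
    using prime_ge_2_nat[OF assms(1)] assms(2) by linarith
  moreover have "\<not> prime (4::nat)" "\<not> prime (6::nat)" by simp_all
  ultimately show ?thesis using assms(1) by auto
qed

lemma le_1_cases: "(i::nat) \<le> 1 \<Longrightarrow> i = 0 \<or> i = 1" by auto
lemma le_2_cases: "(i::nat) \<le> 2 \<Longrightarrow> i = 0 \<or> i = 1 \<or> i = 2" by auto
lemma le_3_cases: "(i::nat) \<le> 3 \<Longrightarrow> i = 0 \<or> i = 1 \<or> i = 2 \<or> i = 3" by auto
lemma le_4_cases: "(i::nat) \<le> 4 \<Longrightarrow> i = 0 \<or> i = 1 \<or> i = 2 \<or> i = 3 \<or> i = 4" by auto
lemma nat_between_cases:
  assumes "2 \<le> (f::nat)"
  shows "f \<le> 2 \<Longrightarrow> f = 2" "f \<le> 3 \<Longrightarrow> f = 2 \<or> f = 3" "f \<le> 4 \<Longrightarrow> f = 2 \<or> f = 3 \<or> f = 4"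
  "f \<le> 5 \<Longrightarrow> f = 2 \<or> f = 3 \<or> f = 4 \<or> f = 5"
  using assms by auto

section \<open>Candidate pairs (n, m), by the number of divisors of n\<close>

context eight_cyclic
begin

text \<open>Here \<open>n\<close> is the square of a prime. For each admissible \<open>m\<close> and
  \<open>p\<close> the two equations of \<open>sum_N\<close> either are contradictory or leave the
  recorded values of \<open>N\<close>.\<close>

lemma card_divisors_3_cases:
  assumes d: "card {d. d dvd n} = 3"
  shows "n = 4 \<and> m = 3 \<or> n = 9 \<and> m = 2 \<and> N 2 = 1 \<and> ord ` out \<subseteq> {2, 6}
    \<or> n = 9 \<and> m = 3 \<and> N 3 = 3 \<or> n = 25 \<and> m = 5 \<and> ord ` out \<subseteq> {25}"
proof -
  obtain p where p: "prime p" "n = p ^ Suc 1"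
    by (rule n_prime_power[OF d, of 1]) simp_all
  note pb = prime_index_bound_totient[OF p(2,1) d] and pt = prime_index_bound[OF p(2,1) d]
  note o = out_ord_prime_power[OF p(2,1)]
  have p2: "p \<ge> 2" using p prime_ge_2_nat by blast
  have "m \<le> 5" using m_bound[OF d n_gt_1] by simp
  then consider "m = 2" | "m = 3" | "m = 4" | "m = 5" using m by linarith
  then show ?thesis
  proof cases
    case m2: 1
    have "p \<le> 5" using pt[of 1] small_totient(1) m2 by auto
    then consider "p = 2" | "p = 3" | "p = 5" using prime_le_5[OF p(1)] by auto
    then show ?thesis
    proof cases
      case 1
      have "ord x \<in> {2, 4}" if xo: "x \<in> out" for x
        proof -
          obtain i f where "i \<le> 1" "ord x = p ^ i * f" "2 \<le> f" "f \<le> m" by (rule o[OF xo])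
          then show ?thesis using le_1_cases[of i] nat_between_cases(1)[of f] m2 1 by auto
        qed
      then show ?thesis using sum_N[of "{2, 4}"] d 1 m2 p by (simp add: totient_values eight)
    next
      case 2
      have K: "ord x \<in> {2, 6}" if xo: "x \<in> out" for x
        proof -
          obtain i f where "i \<le> 1" "ord x = p ^ i * f" "2 \<le> f" "f \<le> m" by (rule o[OF xo])
          then show ?thesis using le_1_cases[of i] nat_between_cases(1)[of f] m2 2 by auto
        qed
      then show ?thesis using sum_N[of "{2, 6}"] d 2 m2 p by (auto simp: totient_values eight)
    next
      case 3
      have "ord x \<in> {2, 10}" if xo: "x \<in> out" for x
        proof -
          obtain i f where "i \<le> 1" "ord x = p ^ i * f" "2 \<le> f" "f \<le> m" by (rule o[OF xo])
          then show ?thesis using le_1_cases[of i] nat_between_cases(1)[of f] m2 3 by auto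
        qed
      then show ?thesis using sum_N[of "{2, 10}"] d 3 m2 p by (simp add: totient_values eight)
    qed
  next
    case m3: 2
    have "p \<le> 5" using pt[of 2] small_totient(2) m3 by auto
    then consider "p = 2" | "p = 3" | "p = 5" using prime_le_5[OF p(1)] by auto
    then show ?thesis
    proof cases
      case 1
      then show ?thesis using p m3 by simp
    next
      case 2
      have "ord x \<in> {3, 9}" if xo: "x \<in> out" for x
        proof -
          obtain i f where "i \<le> 1" "ord x = p ^ i * f" "2 \<le> f" "f \<le> m" by (rule o[OF xo])
          then show ?thesis using ord_dvd_nm[OF xo] p le_1_cases[of i] nat_between_cases(2)[of f] m3 2 by auto
        qed
      then show ?thesis using sum_N[of "{3, 9}"] d 2 m3 p by (simp add: totient_values eight)
    next
      case 3
      have "ord x \<in> {3, 15}" if xo: "x \<in> out" for x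
        proof -
          obtain i f where "i \<le> 1" "ord x = p ^ i * f" "2 \<le> f" "f \<le> m" by (rule o[OF xo])
          then show ?thesis using ord_dvd_nm[OF xo] p le_1_cases[of i] nat_between_cases(2)[of f] m3 3 by auto
        qed
      then show ?thesis using sum_N[of "{3, 15}"] d 3 m3 p by (simp add: totient_values eight)
    qed
  next
    case m4: 3
    have "p \<le> 3" using pt[of 2] small_totient(3) m4 by auto
    moreover have "p \<noteq> 2" using pb m4 by auto
    ultimately have 3: "p = 3" using p2 by auto
    have K: "ord x \<in> {2, 3, 4, 6, 9, 12}" if xo: "x \<in> out" for x
      proof -
        obtain i f where "i \<le> 1" "ord x = p ^ i * f" "2 \<le> f" "f \<le> m" by (rule o[OF xo])
        then show ?thesis using le_1_cases[of i] nat_between_cases(3)[of f] m4 3 by auto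
      qed
    have 1: "N 2 + N 3 + N 4 + N 6 + N 9 + N 12 = 5"
      and 2: "N 2 + 2 * N 3 + 2 * N 4 + 2 * N 6 + 6 * N 9 + 4 * N 12 = 27"
      using sum_N[of "{2, 3, 4, 6, 9, 12}"] K d 3 m4 p by (simp_all add: totient_values eight)
    \<comment> \<open>Three groups of order 9 give at most 18 + 2 * 4 = 26 of the 27 elements, and
      five give 30. With four, the last group would need 3 generators, but its totient is 1, 2 or
      4.\<close>
    then have "N 9 = 4" by linarith
    then have False using 1 2 by (cases "N 12 = 0") linarith+
    then show ?thesis ..
  next
    case m5: 4
    have "p \<le> 5" using pt[of 4] small_totient(4) m5 by auto
    moreover have "p \<ge> 5" using pb m5 p2 by simp
    ultimately have 5: "p = 5" by auto
    have K: "ord x \<in> {5, 25}" if xo: "x \<in> out" for x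
      proof -
        obtain i f where "i \<le> 1" "ord x = p ^ i * f" "2 \<le> f" "f \<le> m" by (rule o[OF xo])
        then show ?thesis using ord_dvd_nm[OF xo] p le_1_cases[of i] nat_between_cases(4)[of f] m5 5 by auto
      qed
    then have "N 5 = 0" using sum_N[of "{5, 25}"] d 5 m5 p by (simp add: totient_values eight)
    then have "ord x \<noteq> 5" if xo: "x \<in> out" for x using xo N_pos_iff[of 5] by auto
    then show ?thesis using K p m5 5 by auto
  qed
qed

lemma card_divisors_2_cases:
  assumes d: "card {d. d dvd n} = 2"
  shows "n = 2 \<and> m = 4 \<and> ord ` out \<subseteq> {2} \<or> n = 3 \<and> m = 4 \<and> N 2 = 3 \<and> N 3 = 3 \<and> ord ` out \<subseteq> {2, 3}
    \<or> n = 3 \<and> m = 5"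
proof -
  obtain p where p: "prime p" "n = p ^ Suc 0"
    by (rule n_prime_power[OF d, of 0]) simp_all
  note pb = prime_index_bound_totient[OF p(2,1) d] and pt = prime_index_bound[OF p(2,1) d]
  note o = out_ord_prime_power[OF p(2,1)]
  have p2: "p \<ge> 2" using p prime_ge_2_nat by blast
  have tn: "totient n = p - 1" using p by (simp add: totient_prime)
  \<comment> \<open>Orders excluded by maximality of \<open>c\<close>, by Lagrange, or by the
    tie-break.\<close>
  have N0: "N k = 0" if "totient k > totient n \<or> \<not> k dvd n * m \<or> totient k = totient n \<and> k > n" for k
  proof (rule ccontr)
    assume "N k \<noteq> 0"
    then obtain x where x: "x \<in> out" "ord x = k" using N_pos_iff[of k] by auto
    then show False using that maximal[of x] ord_dvd_nm[of x] by auto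
  qed
  have "m \<le> 6" using m_bound[OF d n_gt_1] by simp
  moreover have "m \<noteq> 6"
  proof
    assume "m = 6"
    then have "p * 5 \<le> 24" "p * 5 \<le> 6 * (p - 1)" using pt[of 4] small_totient(5) pb by auto
    then show False using p2 by auto
  qed
  ultimately consider "m = 2" | "m = 3" | "m = 4" | "m = 5" using m by linarith
  then show ?thesis
  proof cases
    case m2: 1
    have K: "ord x \<in> {2}" if xo: "x \<in> out" for x
    proof -
      obtain i f where "i \<le> 0" "ord x = p ^ i * f" "2 \<le> f" "f \<le> m" by (rule o[OF xo])
      then show ?thesis using nat_between_cases(1)[of f] m2 by auto
    qed
    \<comment> \<open>With 2 as the only outside order, the equations read \<open>N 2 = 6\<close>
      and \<open>N 2 = p\<close>.\<close>
    have "p = 6" using sum_N[of "{2}"] K d m2 p by (simp add: eight)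
    then show ?thesis using p by simp
  next
    case m3: 2
    have K: "ord x \<in> {2, 3}" if xo: "x \<in> out" for x
    proof -
      obtain i f where "i \<le> 0" "ord x = p ^ i * f" "2 \<le> f" "f \<le> m" by (rule o[OF xo])
      then show ?thesis using nat_between_cases(2)[of f] m3 by auto
    qed
    have 1: "N 2 + N 3 = 6" and 2: "N 2 + 2 * N 3 = p * 2"
      using sum_N[of "{2, 3}"] K d m3 p by (simp_all add: totient_values eight)
    then have "p \<le> 6" "p \<ge> 3" by auto
    then consider "p = 3" | "p = 5" using prime_le_5[OF p(1)] by auto
    then have False
      using 1 2 N0[of 2] p m3 by cases auto
    then show ?thesis ..
  next
    case m4: 3
    have K: "ord x \<in> {2, 3, 4}" if xo: "x \<in> out" for x
    proof -
      obtain i f where "i \<le> 0" "ord x = p ^ i * f" "2 \<le> f" "f \<le> m" by (rule o[OF xo])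
      then show ?thesis using nat_between_cases(3)[of f] m4 by auto
    qed
    have 1: "N 2 + N 3 + N 4 = 6" and 2: "N 2 + 2 * N 3 + 2 * N 4 = p * 3"
      using sum_N[of "{2, 3, 4}"] K d m4 p by (simp_all add: totient_values eight)
    then have "p \<le> 4" by auto
    then consider "p = 2" | "p = 3" using prime_le_5[OF p(1)] by auto
    then show ?thesis
    proof cases
      case pp: 1
      then have "N 3 = 0" "N 4 = 0" using 1 2 by auto
      then have "ord x \<noteq> 3" "ord x \<noteq> 4" if "x \<in> out" for x
        using that N_pos_iff[of 3] N_pos_iff[of 4] by auto
      then show ?thesis using K pp p m4 by auto
    next
      case pp: 2
      \<comment> \<open>Orders 3 and 4 have equally many generators, so an element of order 4 would
        have been preferred to \<open>c\<close>.\<close>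
      then have N4: "N 4 = 0" using N0[of 4] p m4 by (simp add: totient_values)
      then have "ord x \<noteq> 4" if "x \<in> out" for x
        using that N_pos_iff[of 4] by auto
      then have "ord ` out \<subseteq> {2, 3}" using K by auto
      then show ?thesis using pp p m4 1 2 N4 by auto
    qed
  next
    case m5: 4
    have K: "ord x \<in> {2, 3, 4, 5}" if xo: "x \<in> out" for x
    proof -
      obtain i f where "i \<le> 0" "ord x = p ^ i * f" "2 \<le> f" "f \<le> m" by (rule o[OF xo])
      then show ?thesis using nat_between_cases(4)[of f] m5 by auto
    qed
    have 1: "N 2 + N 3 + N 4 + N 5 = 6" and 2: "N 2 + 2 * N 3 + 2 * N 4 + 4 * N 5 = p * 4"
      using sum_N[of "{2, 3, 4, 5}"] K d m5 p by (simp_all add: totient_values eight)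
    then have "p \<le> 6" by auto
    then consider "p = 2" | "p = 3" | "p = 5" using prime_le_5[OF p(1)] by auto
    then show ?thesis
    proof cases
      case pp: 1
      have "N 3 = 0" "N 4 = 0" "N 5 = 0" using N0[of 3] N0[of 4] N0[of 5] pp p m5 by (simp_all add: totient_values)
      then show ?thesis using 1 2 pp by auto
    next
      case 2
      then show ?thesis using p m5 by simp
    next
      case pp: 3
      have "N 2 = 0" "N 3 = 0" "N 4 = 0" using N0[of 2] N0[of 3] N0[of 4] pp p m5 by simp_all
      then show ?thesis using 1 2 pp by auto
    qed
  qed
qed

lemma card_divisors_5_cases:
  assumes d: "card {d. d dvd n} = 5"
  shows "n = 16 \<and> m = 2 \<and> N 16 = 1 \<and> N 2 = 0 \<or> n = 81 \<and> m = 3 \<and> ord ` out \<subseteq> {81}"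
proof -
  obtain p where p: "prime p" "n = p ^ Suc 3"
    by (rule n_prime_power[OF d, of 3]) simp_all
  note pb = prime_index_bound_totient[OF p(2,1) d] and pt = prime_index_bound[OF p(2,1) d]
  note o = out_ord_prime_power[OF p(2,1)]
  have p2: "p \<ge> 2" using p prime_ge_2_nat by blast
  have "m \<le> 3" using m_bound[OF d n_gt_1] by simp
  then consider "m = 2" | "m = 3" using m by linarith
  then show ?thesis
  proof cases
    case m2: 1
    have "p \<le> 3" using pt[of 1] small_totient(1) m2 by auto
    then consider "p = 2" | "p = 3" using prime_le_5[OF p(1)] by auto
    then show ?thesis
    proof cases
      case pp: 1
      have K: "ord x \<in> {2, 4, 8, 16}" if xo: "x \<in> out" for x
      proof -
        obtain i f where "i \<le> 3" "ord x = p ^ i * f" "2 \<le> f" "f \<le> m" by (rule o[OF xo])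
        then show ?thesis using le_3_cases[of i] nat_between_cases(1)[of f] m2 pp by auto
      qed
      have 1: "N 2 + N 4 + N 8 + N 16 = 3" and 2: "N 2 + 2 * N 4 + 4 * N 8 + 8 * N 16 = 16"
        using sum_N[of "{2, 4, 8, 16}"] K d pp m2 p by (simp_all add: totient_values eight)
      \<comment> \<open>Without order 16 the three groups supply at most 12 of the 16 elements; two
        groups of order 16 supply all of them and leave nothing for the third.\<close>
      then have "N 16 = 1" by linarith
      moreover from this have "N 8 = 2" using 1 2 by linarith
      ultimately show ?thesis using 1 pp p m2 by simp
    next
      case pp: 2
      have K: "ord x \<in> {2, 6, 18, 54}" if xo: "x \<in> out" for x
      proof -
        obtain i f where "i \<le> 3" "ord x = p ^ i * f" "2 \<le> f" "f \<le> m" by (rule o[OF xo])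
        then show ?thesis using le_3_cases[of i] nat_between_cases(1)[of f] m2 pp by auto
      qed
      have 1: "N 2 + N 6 + N 18 + N 54 = 3" and 2: "N 2 + 2 * N 6 + 6 * N 18 + 18 * N 54 = 81"
        using sum_N[of "{2, 6, 18, 54}"] K d pp m2 p by (simp_all add: totient_values eight)
      then show ?thesis by linarith
    qed
  next
    case m3: 2
    have "p \<le> 3" using pt[of 2] small_totient(2) m3 by auto
    moreover have "p \<noteq> 2" using pb m3 by auto
    ultimately have pp: "p = 3" using p2 by auto
    have K: "ord x \<in> {3, 9, 27, 81}" if xo: "x \<in> out" for x
    proof -
      obtain i f where "i \<le> 3" "ord x = p ^ i * f" "2 \<le> f" "f \<le> m" by (rule o[OF xo])
      then show ?thesis using le_3_cases[of i] ord_dvd_nm[OF xo] p nat_between_cases(2)[of f] m3 pp by auto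
    qed
    have 1: "N 3 + N 9 + N 27 + N 81 = 3" and 2: "2 * N 3 + 6 * N 9 + 18 * N 27 + 54 * N 81 = 162"
      using sum_N[of "{3, 9, 27, 81}"] K d pp m3 p by (simp_all add: totient_values eight)
    then have "N 81 = 3" by linarith
    then have "N 3 = 0" "N 9 = 0" "N 27 = 0" using 1 by auto
    then have "ord x \<noteq> 3" "ord x \<noteq> 9" "ord x \<noteq> 27" if "x \<in> out" for x
      using that N_pos_iff[of 3] N_pos_iff[of 9] N_pos_iff[of 27] by auto
    then show ?thesis using K pp p m3 by auto
  qed
qed

text \<open>Only two subgroups lie outside \<open>cyc c\<close>, so \<open>m = 2\<close> and
  together they must supply \<open>n\<close> generators. This is too many when \<open>n\<close> has
  two prime factors.\<close>

lemma card_divisors_6_cases: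
  assumes d: "card {d. d dvd n} = 6"
  shows "n = 32 \<and> m = 2 \<and> ord ` out \<subseteq> {32}"
proof -
  have m2: "m = 2" using m_bound[OF d n_gt_1] m by simp
  have le: "n \<le> 2 * totient n" using le_totient_n d m2 by simp
  from card_divisors_eq_6[OF n_pos d] consider p where "prime p" "n = p ^ 5"
    | p q where "prime p" "prime q" "p \<noteq> q" "n = p ^ 2 * q" .
  then show ?thesis
  proof cases
    case (1 p)
    then have p: "prime p" "n = p ^ Suc 4" by auto
    note pt = prime_index_bound[OF p(2,1) d]
    note o = out_ord_prime_power[OF p(2,1)]
    have "p \<le> 2" using pt[of 1] small_totient(1) m2 by auto
    then have pp: "p = 2" using prime_ge_2_nat[OF p(1)] by simp
    have K: "ord x \<in> {2, 4, 8, 16, 32}" if xo: "x \<in> out" for x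
    proof -
      obtain i f where "i \<le> 4" "ord x = p ^ i * f" "2 \<le> f" "f \<le> m" by (rule o[OF xo])
      then show ?thesis using le_4_cases[of i] nat_between_cases(1)[of f] m2 pp by auto
    qed
    have 1: "N 2 + N 4 + N 8 + N 16 + N 32 = 2" and 2: "N 2 + 2 * N 4 + 4 * N 8 + 8 * N 16 + 16 * N 32 = 32"
      using sum_N[of "{2, 4, 8, 16, 32}"] K d pp m2 p by (simp_all add: totient_values eight)
    then have "N 32 = 2" by linarith
    then have "N 2 = 0" "N 4 = 0" "N 8 = 0" "N 16 = 0" using 1 by auto
    then have "ord x \<noteq> 2" "ord x \<noteq> 4" "ord x \<noteq> 8" "ord x \<noteq> 16" if "x \<in> out" for x
      using that N_pos_iff[of 2] N_pos_iff[of 4] N_pos_iff[of 8] N_pos_iff[of 16] by auto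
    then show ?thesis using K pp p m2 by auto
  next
    case (2 p q)
    have p0: "p \<ge> 2" "q \<ge> 2" using 2 prime_ge_2_nat by auto
    have tn: "totient n = p * (p - 1) * (q - 1)"
      using 2 primes_coprime[of p q] totient_mult_coprime[of "p ^ 2" q] totient_power[of 2 p]
      by (simp add: totient_prime)
    \<comment> \<open>For even \<open>n\<close> the value \<open>2 * totient n\<close> falls short
      of \<open>n\<close>: by 4 if \<open>p = 2\<close>, by \<open>2 * p\<close> if
      \<open>q = 2\<close>.\<close>
    have "odd n"
    proof
      assume "even n"
      then have "even p \<or> even q" using 2 by auto
      then have "p = 2 \<or> q = 2" using 2(1,2) by (metis prime_nat_iff two_is_prime_nat primes_dvd_imp_eq)
      then have "2 * totient n = n - 4 \<or> 2 * totient n = n - 2 * p"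
        using 2 tn by (auto simp: power2_eq_square algebra_simps diff_mult_distrib2)
      then show False using le n_pos p0 by (elim disjE) linarith+
    qed
    \<comment> \<open>As \<open>m = 2\<close>, the order is \<open>2 * e\<close> with at most
      \<open>e\<close> generators, and a proper divisor \<open>e\<close> of an odd number is at most
      a third of it.\<close>
    have "totient (ord x) \<le> n div 3" if xo: "x \<in> out" for x
    proof -
      from out_ord[OF xo] obtain e f where e: "ord x = e * f" "e dvd n" "e < n" "2 \<le> f" "f \<le> m" by metis
      then have f: "f = 2" using m2 by simp
      obtain k where k: "n = e * k" using e by blast
      have "k \<noteq> 0" "k \<noteq> 1" "k \<noteq> 2" using k e \<open>odd n\<close> by auto
      then have "3 * e \<le> n" using k by simp
      moreover have "totient (ord x) \<le> e" using totient_mult_le[of 2 e] e f by simp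
      ultimately show ?thesis by linarith
    qed
    note bound = card_out_le[OF this]
    have "\<not> n \<le> 2 * (n div 3)" using n_pos by linarith
    with bound have False using d m2 eight by simp
    then show ?thesis ..
  qed
qed

lemma card_divisors_4_prime_cube_cases:
  assumes d: "card {d. d dvd n} = 4" and p: "prime p" "n = p ^ Suc 2"
  shows "n = 8 \<and> m = 2 \<and> ord ` out \<subseteq> {2, 4, 8} \<and> (N 8 = 1 \<and> N 2 = 2 \<or> N 8 = 0 \<and> N 2 = 0)
    \<or> n = 8 \<and> m = 3 \<and> N 3 = 0"
proof -
  note pb = prime_index_bound_totient[OF p(2,1) d] and pt = prime_index_bound[OF p(2,1) d]
  note o = out_ord_prime_power[OF p(2,1)]
  have p2: "p \<ge> 2" using p prime_ge_2_nat by blast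
  have "m \<le> 4" using m_bound[OF d n_gt_1] by simp
  moreover have "m \<noteq> 4"
  proof
    assume "m = 4"
    then have "p * 3 \<le> 8" "p * 3 \<le> 4 * (p - 1)" using pt[of 2] small_totient(3) pb by auto
    then show False using p2 by auto
  qed
  ultimately consider "m = 2" | "m = 3" using m by linarith
  then show ?thesis
  proof cases
    case m2: 1
    have "p \<le> 4" using pt[of 1] small_totient(1) m2 by auto
    then consider "p = 2" | "p = 3" using prime_le_5[OF p(1)] by auto
    then show ?thesis
    proof cases
      case pp: 1
      have K: "ord x \<in> {2, 4, 8}" if xo: "x \<in> out" for x
      proof -
        obtain i f where "i \<le> 2" "ord x = p ^ i * f" "2 \<le> f" "f \<le> m" by (rule o[OF xo])
        then show ?thesis using le_2_cases[of i] nat_between_cases(1)[of f] m2 pp by auto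
      qed
      have 1: "N 2 + N 4 + N 8 = 4" and 2: "N 2 + 2 * N 4 + 4 * N 8 = 8"
        using sum_N[of "{2, 4, 8}"] K d pp m2 p by (simp_all add: totient_values eight)
      have "N 8 = 0 \<or> N 8 = 1" using 1 2 by linarith
      then have "N 8 = 1 \<and> N 2 = 2 \<or> N 8 = 0 \<and> N 2 = 0" using 1 2 by (elim disjE) auto
      then show ?thesis using K pp p m2 by auto
    next
      case pp: 2
      have K: "ord x \<in> {2, 6, 18}" if xo: "x \<in> out" for x
      proof -
        obtain i f where "i \<le> 2" "ord x = p ^ i * f" "2 \<le> f" "f \<le> m" by (rule o[OF xo])
        then show ?thesis using le_2_cases[of i] nat_between_cases(1)[of f] m2 pp by auto
      qed
      have 1: "N 2 + N 6 + N 18 = 4" and 2: "N 2 + 2 * N 6 + 6 * N 18 = 27"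
        using sum_N[of "{2, 6, 18}"] K d pp m2 p by (simp_all add: totient_values eight)
      then show ?thesis by linarith
    qed
  next
    case m3: 2
    have "p \<le> 4" using pt[of 2] small_totient(2) m3 by auto
    then consider "p = 2" | "p = 3" using prime_le_5[OF p(1)] by auto
    then show ?thesis
    proof cases
      case pp: 1
      have K: "ord x \<in> {2, 3, 4, 6, 8}" if xo: "x \<in> out" for x
      proof -
        obtain i f where "i \<le> 2" "ord x = p ^ i * f" "2 \<le> f" "f \<le> m" by (rule o[OF xo])
        \<comment> \<open>The combination \<open>i = 2\<close>, \<open>f = 3\<close> gives order 12,
          which has as many generators as order 8 but is larger.\<close>
        then show ?thesis using le_2_cases[of i] ord_out_neq[of 12 x] p totient_values nat_between_cases(2)[of f] m3 pp xo by auto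
      qed
      have 1: "N 2 + N 3 + N 4 + N 6 + N 8 = 4" and 2: "N 2 + 2 * N 3 + 2 * N 4 + 2 * N 6 + 4 * N 8 = 16"
        using sum_N[of "{2, 3, 4, 6, 8}"] K d pp m3 p by (simp_all add: totient_values eight)
      then have "N 3 = 0" by linarith
      then show ?thesis using pp p m3 by simp
    next
      case pp: 2
      have K: "ord x \<in> {3, 9, 27}" if xo: "x \<in> out" for x
      proof -
        obtain i f where "i \<le> 2" "ord x = p ^ i * f" "2 \<le> f" "f \<le> m" by (rule o[OF xo])
        then show ?thesis using le_2_cases[of i] ord_dvd_nm[OF xo] p nat_between_cases(2)[of f] m3 pp by auto
      qed
      have 1: "N 3 + N 9 + N 27 = 4" and 2: "2 * N 3 + 6 * N 9 + 18 * N 27 = 54"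
        using sum_N[of "{3, 9, 27}"] K d pp m3 p by (simp_all add: totient_values eight)
      \<comment> \<open>Subtracting twice the first equation leaves a multiple of 4 equal to
        46.\<close>
      then have "4 * N 9 + 16 * N 27 = 46" by linarith
      moreover have "4 dvd 4 * N 9 + 16 * N 27" by simp
      ultimately show ?thesis by simp
    qed
  qed
qed

text \<open>The size of the intersection with \<open>cyc c\<close> is 1, \<open>p\<close> or
  \<open>q\<close>, so at most \<open>q\<close>; this plays the part of \<open>p ^ a\<close> in the
  prime power bounds. One family with a free prime \<open>q\<close> survives, namely
  \<open>n = 2 * q\<close> and \<open>m = 2\<close>.\<close>

lemma card_divisors_4_prime_product_cases:
  assumes d: "card {d. d dvd n} = 4" and p: "prime p" "prime q" "p < q" "n = p * q"
  shows "p = 2 \<and> m = 2 \<and> (N (2 * q) > 0 \<or> q = 3 \<and> N 2 > 0 \<and> N 4 > 0)"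
proof -
  have p2: "p \<ge> 2" and q3: "q \<ge> 3" using p prime_ge_2_nat[OF p(1)] by auto
  have oq: "odd q" using prime_odd_nat[OF p(2)] q3 by simp
  have tq: "totient (2 * q) = q - 1" using oq totient_double[of q] p by (simp add: totient_prime)
  have tn: "totient n = (p - 1) * (q - 1)"
    using p primes_coprime[of p q] by (simp add: totient_mult_coprime totient_prime)
  have o: thesis if xo: "x \<in> out" and H: "\<And>e f. e \<in> {1, p, q} \<Longrightarrow> ord x = e * f \<Longrightarrow> 2 \<le> f \<Longrightarrow> f \<le> m \<Longrightarrow>
      card (cyc x \<inter> cyc c) = e \<Longrightarrow> thesis"
    for x thesis
  proof -
    from out_ord[OF xo] obtain e f where e: "ord x = e * f" "e dvd n" "e < n" "2 \<le> f" "f \<le> m"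
      "e = card (cyc x \<inter> cyc c)" by metis
    obtain a b where ab: "e = a * b" "a dvd p" "b dvd q" using e(2) p(4) division_decomp[of e p q] by auto
    then have "a = 1 \<or> a = p" "b = 1 \<or> b = q" using p by (auto simp: prime_nat_iff)
    moreover have "\<not> (a = p \<and> b = q)" using ab(1) e(3) p(4) by auto
    ultimately have "e \<in> {1, p, q}" using ab(1) by auto
    then show thesis by (rule H[OF _ e(1,4,5) e(6)[symmetric]])
  qed
  have bound: "p * (m - 1) \<le> 4 * t" if f: "\<And>f. 2 \<le> f \<Longrightarrow> f \<le> m \<Longrightarrow> totient f \<le> t" for t
  proof -
    have "totient (ord x) \<le> q * t" if xo: "x \<in> out" for x
    proof -
      obtain e f' where e: "e \<in> {1, p, q}" "ord x = e * f'" "2 \<le> f'" "f' \<le> m" by (rule o[OF xo])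
      have "totient (ord x) \<le> e * totient f'" using e by (simp add: totient_mult_le)
      also have "\<dots> \<le> q * t" using e f[of f'] p q3 by (intro mult_le_mono) auto
      finally show ?thesis .
    qed
    from card_out_le[OF this] have "n * (m - 1) \<le> 4 * (q * t)" using d eight by simp
    then have "q * (p * (m - 1)) \<le> q * (4 * t)" using p by (simp add: mult_ac)
    then show ?thesis using q3 by simp
  qed
  have "m \<le> 4" using m_bound[OF d n_gt_1] by simp
  then consider "m = 2" | "m = 3" | "m = 4" using m by linarith
  then show ?thesis
  proof cases
    case m2: 1
    have "p \<le> 4" using bound[of 1] small_totient(1) m2 by auto
    then consider "p = 2" | "p = 3" using prime_le_5[OF p(1)] by auto
    then show ?thesis
    proof cases
      case pp: 1
      have K: "ord x \<in> {2, 4, 2 * q}" if xo: "x \<in> out" for x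
      proof -
        obtain e f where "e \<in> {1, p, q}" "ord x = e * f" "2 \<le> f" "f \<le> m" by (rule o[OF xo])
        then show ?thesis using m2 pp nat_between_cases(1)[of f] by auto
      qed
      have q: "q \<noteq> 1" "q \<noteq> 2" "2 \<noteq> 2 * q" "4 \<noteq> 2 * q" using q3 by auto
      have 1: "N 2 + N 4 + N (2 * q) = 4" and 2: "N 2 + 2 * N 4 + (q - 1) * N (2 * q) = 2 * q"
        using sum_N[of "{2, 4, 2 * q}"] K q d pp m2 p by (simp_all add: totient_values eight tq)
      show ?thesis
      proof (cases "N (2 * q) = 0")
        case True
        then have "2 * q \<le> 8" using 1 2 by simp
        moreover have "q \<noteq> 4" using oq by auto
        ultimately have "q = 3" using q3 by simp
        then show ?thesis using True 1 2 pp m2 by simp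
      qed (use pp m2 in simp)
    next
      case pp: 2
      have q5: "q \<ge> 5" using p pp oq by (cases "q = 4") auto
      have K: "ord x \<in> {2, 6, 2 * q}" if xo: "x \<in> out" for x
      proof -
        obtain e f where "e \<in> {1, p, q}" "ord x = e * f" "2 \<le> f" "f \<le> m" by (rule o[OF xo])
        then show ?thesis using m2 pp nat_between_cases(1)[of f] by auto
      qed
      have q: "q \<noteq> 1" "q \<noteq> 3" "2 \<noteq> 2 * q" "6 \<noteq> 2 * q" using q5 by auto
      \<comment> \<open>Removes the truncated subtraction; once \<open>N (2 * q)\<close> is fixed,
        the equations are linear in the remaining unknowns and \<open>r\<close>.\<close>
      define r where "r = q - 5"
      have r: "q - 1 = r + 4" "3 * q = 3 * r + 15" using q5 by (simp_all add: r_def)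
      have 1: "N 2 + N 6 + N (2 * q) = 4" and "N 2 + 2 * N 6 + (q - 1) * N (2 * q) = 3 * q"
        using sum_N[of "{2, 6, 2 * q}"] K q d pp m2 p by (simp_all add: totient_values eight tq)
      then have 2: "N 2 + 2 * N 6 + (r + 4) * N (2 * q) = 3 * r + 15" by (simp only: r)
      from 1 have "N (2 * q) \<le> 4" by simp
      then consider "N (2 * q) = 0" | "N (2 * q) = 1" | "N (2 * q) = 2" | "N (2 * q) = 3" | "N (2 * q) = 4"
        by linarith
      then have False using 1 2 by cases simp_all
      then show ?thesis ..
    qed
  next
    case m3: 2
    have "p \<le> 4" using bound[of 2] small_totient(2) m3 by auto
    moreover have "p \<noteq> 2"
    proof
      assume "p = 2"
      then have "4 * q \<le> 4 * (q - 1)" using le_totient_n d m3 p tn by simp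
      then show False using q3 by simp
    qed
    ultimately have pp: "p = 3" using prime_le_5[OF p(1)] by auto
    have q5: "q \<ge> 5" using p pp oq by (cases "q = 4") auto
    have "odd (n * m)" using p pp oq m3 by simp
    then have ordx: "odd (ord x)" if "x \<in> out" for x
      using ord_dvd_nm[OF that] by (meson dvd_trans)
    have K: "ord x \<in> {3, 9, 3 * q} \<and> (ord x = 3 * q \<longrightarrow> card (cyc x \<inter> cyc c) = q)" if xo: "x \<in> out" for x
    proof -
      obtain e f where e: "e \<in> {1, p, q}" "ord x = e * f" "2 \<le> f" "f \<le> m" "card (cyc x \<inter> cyc c) = e"
        by (rule o[OF xo])
      then have "f = 3" using ordx[OF xo] nat_between_cases(2)[of f] m3 by auto
      then show ?thesis using e pp q5 by auto
    qed
    have q: "q \<noteq> 1" "q \<noteq> 3" "3 \<noteq> 3 * q" "9 \<noteq> 3 * q" using q5 by auto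
    have t3q: "totient (3 * q) = 2 * (q - 1)"
      using primes_coprime[of 3 q] p pp q by (simp add: totient_mult_coprime totient_prime)
    define r where "r = q - 5"
    have r: "q - 1 = r + 4" "6 * q = 6 * r + 30" using q5 by (simp_all add: r_def)
    have 1: "N 3 + N 9 + N (3 * q) = 4" and "2 * N 3 + 6 * N 9 + 2 * (q - 1) * N (3 * q) = 6 * q"
      using sum_N[of "{3, 9, 3 * q}"] K q d pp m3 p by (simp_all add: totient_values eight t3q)
    then have 2: "2 * N 3 + 6 * N 9 + 2 * (r + 4) * N (3 * q) = 6 * r + 30" by (simp only: r)
    \<comment> \<open>The equations still allow \<open>N (3 * q) = 3\<close>,
      \<open>N 9 = 1\<close>, \<open>N 3 = 0\<close>. An element of order \<open>3 * q\<close> meets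
      \<open>cyc c\<close> in \<open>q\<close> elements, so its \<open>q\<close>-th power, of order
      3, stays outside.\<close>
    have 3: "N 3 > 0" if "N (3 * q) > 0"
    proof -
      obtain x where x: "x \<in> out" "ord x = 3 * q" using \<open>N (3 * q) > 0\<close> N_pos_iff by blast
      then have xc: "x \<in> carrier G" by simp
      have o3: "ord (x [^] q) = 3" using ord_pow[OF xc, of q] x q5 by simp
      have "x [^] q \<notin> cyc c"
      proof
        assume "x [^] q \<in> cyc c"
        moreover have "x [^] q \<in> cyc x" using cyc_powers[OF xc] by blast
        ultimately have "cyc (x [^] q) \<subseteq> cyc x \<inter> cyc c"
          using xc c by (simp add: cyc_mono)
        moreover have "subgroup (cyc x \<inter> cyc c) G"
          using xc by (intro subgroups_Inter_pair subgroup_cyc) auto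
        ultimately have "card (cyc (x [^] q)) dvd card (cyc x \<inter> cyc c)"
          using xc by (intro card_subgroup_dvd subgroup_cyc) auto
        then have "3 dvd q" using K[OF x(1)] x(2) card_cyc[of "x [^] q"] xc o3 by simp
        then show False using p q by (metis primes_dvd_imp_eq pp)
      qed
      then have "x [^] q \<in> out" using xc by (simp add: out_def)
      then show ?thesis using o3 N_pos_iff by blast
    qed
    have "N (3 * q) \<le> 4" using 1 by simp
    then consider "N (3 * q) = 0" | "N (3 * q) = 1" | "N (3 * q) = 2" | "N (3 * q) = 3" | "N (3 * q) = 4"
      by linarith
    then have False using 1 2 3 by cases simp_all
    then show ?thesis ..
  next
    case m4: 3
    have "p * 3 \<le> 8" using bound[of 2] small_totient(3) m4 by auto
    then have "p = 2" using p2 by simp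
    then have "2 * q * 3 \<le> 4 * (q - 1)" using le_totient_n d m4 p tn by simp
    then have False using q3 by simp
    then show ?thesis ..
  qed
qed

end

section \<open>Metacyclic groups and presentations\<close>

text \<open>The pair \<open>(i, j)\<close> stands for \<open>a\<^sup>i b\<^sup>j\<close> in
  \<open>\<langle>a, b | a\<^sup>n = 1, b\<^sup>k = a\<^sup>s, b a = a\<^sup>r b\<rangle>\<close>.\<close>

definition metacyclic :: "nat \<Rightarrow> nat \<Rightarrow> nat \<Rightarrow> nat \<Rightarrow> (nat \<times> nat) monoid" where
  "metacyclic n k r s =
     \<lparr>carrier = {..<n} \<times> {..<k},
      mult = (\<lambda>(i, j) (i', j'). ((i + r ^ j * i' + s * ((j + j') div k)) mod n, (j + j') mod k)),
      one = (0, 0)\<rparr>"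

lemma carrier_metacyclic: "carrier (metacyclic n k r s) = {..<n} \<times> {..<k}"
  and mult_metacyclic: "(i, j) \<otimes>\<^bsub>metacyclic n k r s\<^esub> (i', j') =
    ((i + r ^ j * i' + s * ((j + j') div k)) mod n, (j + j') mod k)"
  and one_metacyclic: "\<one>\<^bsub>metacyclic n k r s\<^esub> = (0, 0)"
  by (simp_all add: metacyclic_def)

lemma cong_power_mod_exponent:
  fixes r :: nat
  assumes "[r ^ k = 1] (mod n)"
  shows "[r ^ (j mod k) = r ^ j] (mod n)"
proof -
  have "r ^ j = (r ^ k) ^ (j div k) * r ^ (j mod k)"
    by (simp flip: power_mult power_add)
  moreover have "[(r ^ k) ^ (j div k) * r ^ (j mod k) = 1 ^ (j div k) * r ^ (j mod k)] (mod n)"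
    by (intro cong_mult cong_pow assms cong_refl)
  ultimately show ?thesis by (simp add: cong_sym)
qed

lemma cong_power_mult_fixed:
  fixes r s :: nat
  assumes "[r * s = s] (mod n)"
  shows "[r ^ j * s = s] (mod n)"
proof (induction j)
  case (Suc j)
  have "[r * (r ^ j * s) = r * s] (mod n)" by (rule cong_mult[OF cong_refl Suc])
  then show ?case using cong_trans[OF _ assms] by (simp add: mult.assoc)
qed simp

text \<open>Associativity rests on three facts: the carry \<open>(j + j') div k\<close> satisfies
  the 2-cocycle identity, \<open>r ^ k = 1\<close> lets the action depend on \<open>j\<close> modulo
  \<open>k\<close>, and \<open>r * s = s\<close> says that conjugation by the second generator fixes
  its own \<open>k\<close>-th power.\<close>

lemma group_metacyclic:
  assumes n: "n > 0" and k: "k > 0" and rk: "[r ^ k = 1] (mod n)" and rs: "[r * s = s] (mod n)"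
  shows "group (metacyclic n k r s)" (is "group ?M")
proof (rule groupI)
  fix x y z assume "x \<in> carrier ?M" "y \<in> carrier ?M" "z \<in> carrier ?M"
  then obtain i j i' j' i'' j'' where x: "x = (i, j)" "y = (i', j')" "z = (i'', j'')"
    by (metis surj_pair)
  let ?e = "\<lambda>a b. (a + b) div k"
  have carry: "?e j j' + ?e ((j + j') mod k) j'' = ?e j' j'' + ?e j ((j' + j'') mod k)"
  proof -
    have "?e j j' + ?e ((j + j') mod k) j'' = (j + j' + j'') div k" for j j' j'' :: nat
    proof -
      have "j + j' + j'' = k * ((j + j') div k) + ((j + j') mod k + j'')" by simp
      then have "(j + j' + j'') div k = (k * ((j + j') div k) + ((j + j') mod k + j'')) div k" by (simp only:)
      also have "\<dots> = (j + j') div k + ((j + j') mod k + j'') div k"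
        using k by (intro div_mult_self4) simp
      finally show ?thesis ..
    qed
    from this[of j j' j''] this[of j' j'' j] show ?thesis by (simp add: ac_simps)
  qed
  have A: "[(i + r ^ j * i' + s * ?e j j') mod n + r ^ ((j + j') mod k) * i'' + s * ?e ((j + j') mod k) j''
      = (i + r ^ j * i' + s * ?e j j') + r ^ (j + j') * i'' + s * ?e ((j + j') mod k) j''] (mod n)"
    by (intro cong_add cong_mult cong_refl cong_power_mod_exponent rk) (simp add: cong_def)
  have B: "[i + r ^ j * ((i' + r ^ j' * i'' + s * ?e j' j'') mod n) + s * ?e j ((j' + j'') mod k)
      = i + r ^ j * (i' + r ^ j' * i'' + s * ?e j' j'') + s * ?e j ((j' + j'') mod k)] (mod n)"
    by (intro cong_add cong_mult cong_refl) (simp add: cong_def)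
  have "[i + r ^ j * (i' + r ^ j' * i'' + s * ?e j' j'') + s * ?e j ((j' + j'') mod k)
      = i + r ^ j * (i' + r ^ j' * i'') + s * ?e j' j'' + s * ?e j ((j' + j'') mod k)] (mod n)"
  proof -
    have "[r ^ j * s * ?e j' j'' = s * ?e j' j''] (mod n)"
      by (intro cong_mult cong_power_mult_fixed rs cong_refl)
    then have "[i + r ^ j * (i' + r ^ j' * i'') + r ^ j * s * ?e j' j'' + s * ?e j ((j' + j'') mod k)
      = i + r ^ j * (i' + r ^ j' * i'') + s * ?e j' j'' + s * ?e j ((j' + j'') mod k)] (mod n)"
      by (intro cong_add cong_refl)
    then show ?thesis by (simp add: algebra_simps)
  qed
  also have "i + r ^ j * (i' + r ^ j' * i'') + s * ?e j' j'' + s * ?e j ((j' + j'') mod k)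
    = i + r ^ j * (i' + r ^ j' * i'') + s * (?e j' j'' + ?e j ((j' + j'') mod k))"
    by (simp add: algebra_simps)
  also have "\<dots> = i + r ^ j * (i' + r ^ j' * i'') + s * (?e j j' + ?e ((j + j') mod k) j'')"
    by (simp only: carry)
  also have "\<dots> = (i + r ^ j * i' + s * ?e j j') + r ^ (j + j') * i'' + s * ?e ((j + j') mod k) j''"
    by (simp add: algebra_simps power_add)
  finally have "[i + r ^ j * (i' + r ^ j' * i'' + s * ?e j' j'') + s * ?e j ((j' + j'') mod k)
    = (i + r ^ j * i' + s * ?e j j') + r ^ (j + j') * i'' + s * ?e ((j + j') mod k) j''] (mod n)" .
  from cong_trans[OF A cong_sym[OF cong_trans[OF B this]]]
  show "x \<otimes>\<^bsub>?M\<^esub> y \<otimes>\<^bsub>?M\<^esub> z = x \<otimes>\<^bsub>?M\<^esub> (y \<otimes>\<^bsub>?M\<^esub> z)"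
    unfolding x mult_metacyclic by (simp add: cong_def mod_add_left_eq mod_add_right_eq ac_simps)
next
  fix x assume "x \<in> carrier ?M"
  then obtain i j where x: "x = (i, j)" "i < n" "j < k" by (auto simp: carrier_metacyclic)
  define j' where "j' = (k - j) mod k"
  define t where "t = r ^ j' * i + s * ((j' + j) div k)"
  define i' where "i' = (n - t mod n) mod n"
  have "(j' + j) mod k = 0" using x by (simp add: j'_def mod_add_left_eq)
  moreover have "(i' + t) mod n = 0"
  proof -
    have "(i' + t) mod n = ((n - t mod n) + t mod n) mod n"
      unfolding cong_def[symmetric] by (rule cong_add) (simp_all add: i'_def cong_def)
    then show ?thesis using n by (simp add: less_imp_le)
  qed
  ultimately have "(i', j') \<otimes>\<^bsub>?M\<^esub> x = \<one>\<^bsub>?M\<^esub>"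
    unfolding x mult_metacyclic one_metacyclic by (simp add: t_def add.assoc)
  moreover have "(i', j') \<in> carrier ?M" using n k by (simp add: carrier_metacyclic i'_def j'_def)
  ultimately show "\<exists>y\<in>carrier ?M. y \<otimes>\<^bsub>?M\<^esub> x = \<one>\<^bsub>?M\<^esub>" by blast
qed (use n k in \<open>auto simp: carrier_metacyclic mult_metacyclic one_metacyclic\<close>)

section \<open>Recognising metacyclic groups from generators and relations\<close>

context group
begin

lemma power_conj:
  assumes c: "c \<in> carrier G" "y \<in> carrier G" and rel: "y \<otimes> c = c [^] (r::nat) \<otimes> y"
  shows "y \<otimes> c [^] (i::nat) = c [^] (r * i) \<otimes> y"
proof (induction i)
  case (Suc i)
  have "y \<otimes> c [^] Suc i = y \<otimes> c [^] i \<otimes> c" using c by (simp add: m_assoc)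
  also have "\<dots> = c [^] (r * i) \<otimes> (y \<otimes> c)" using c Suc by (simp add: m_assoc)
  also have "\<dots> = c [^] (r * i) \<otimes> c [^] r \<otimes> y" using c by (simp add: rel m_assoc)
  also have "\<dots> = c [^] (r * Suc i) \<otimes> y" using c by (simp add: nat_pow_mult add.commute)
  finally show ?case .
qed (use c in simp)

lemma power_conj_power:
  assumes c: "c \<in> carrier G" "y \<in> carrier G" and rel: "y \<otimes> c = c [^] (r::nat) \<otimes> y"
  shows "y [^] (j::nat) \<otimes> c [^] (i::nat) = c [^] (r ^ j * i) \<otimes> y [^] j"
proof (induction j arbitrary: i)
  case (Suc j)
  have "y [^] Suc j \<otimes> c [^] i = y [^] j \<otimes> (y \<otimes> c [^] i)" using c by (simp add: m_assoc)
  also have "\<dots> = y [^] j \<otimes> c [^] (r * i) \<otimes> y" using c by (simp add: power_conj[OF c rel] m_assoc)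
  also have "\<dots> = c [^] (r ^ j * (r * i)) \<otimes> (y [^] j \<otimes> y)" using c by (simp add: Suc m_assoc)
  finally show ?case by (simp add: ac_simps)
qed (use c in simp)

lemma pow_mod:
  assumes "c \<in> carrier G" "c [^] n = \<one>"
  shows "c [^] (i mod n) = c [^] (i::nat)"
proof -
  have "c [^] i = c [^] (n * (i div n)) \<otimes> c [^] (i mod n)" using assms(1) by (simp add: nat_pow_mult)
  also have "c [^] (n * (i div n)) = \<one>" using assms by (simp flip: nat_pow_pow)
  finally show ?thesis using assms by simp
qed

text \<open>Collecting powers in \<open>G\<close> reproduces the multiplication of pairs: moving
  \<open>y [^] j\<close> past \<open>c [^] i'\<close> multiplies the exponent by
  \<open>r ^ j\<close>, and each carry turns \<open>y [^] k\<close> into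
  \<open>c [^] s\<close>.\<close>

lemma metacyclic_hom:
  assumes c: "c \<in> carrier G" "y \<in> carrier G" and rel: "y \<otimes> c = c [^] (r::nat) \<otimes> y"
    and cn: "c [^] n = \<one>" and yk: "y [^] k = c [^] (s::nat)"
  shows "(\<lambda>(i, j). c [^] i \<otimes> y [^] j) \<in> hom (metacyclic n k r s) G"
proof (rule homI)
  fix u v assume "u \<in> carrier (metacyclic n k r s)" "v \<in> carrier (metacyclic n k r s)"
  obtain i j i' j' where u: "u = (i, j)" "v = (i', j')" by (metis surj_pair)
  have y: "y [^] (j + j') = c [^] (s * ((j + j') div k)) \<otimes> y [^] ((j + j') mod k)"
  proof -
    have "y [^] (j + j') = y [^] (k * ((j + j') div k)) \<otimes> y [^] ((j + j') mod k)"
      using c by (simp add: nat_pow_mult)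
    also have "y [^] (k * ((j + j') div k)) = c [^] (s * ((j + j') div k))"
      using c by (simp add: yk flip: nat_pow_pow)
    finally show ?thesis .
  qed
  have "c [^] i \<otimes> y [^] j \<otimes> (c [^] i' \<otimes> y [^] j') = c [^] i \<otimes> (y [^] j \<otimes> c [^] i') \<otimes> y [^] j'"
    using c by (simp add: m_assoc)
  also have "\<dots> = c [^] i \<otimes> c [^] (r ^ j * i') \<otimes> y [^] (j + j')"
    using c by (simp add: power_conj_power[OF c rel] m_assoc flip: nat_pow_mult)
  also have "\<dots> = c [^] i \<otimes> c [^] (r ^ j * i') \<otimes> c [^] (s * ((j + j') div k)) \<otimes> y [^] ((j + j') mod k)"
    using c by (simp add: y m_assoc)
  also have "\<dots> = c [^] (i + r ^ j * i' + s * ((j + j') div k)) \<otimes> y [^] ((j + j') mod k)"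
    using c by (simp add: nat_pow_mult)
  also have "\<dots> = c [^] ((i + r ^ j * i' + s * ((j + j') div k)) mod n) \<otimes> y [^] ((j + j') mod k)"
    by (simp only: pow_mod[OF c(1) cn])
  finally show "(\<lambda>(i, j). c [^] i \<otimes> y [^] j) (u \<otimes>\<^bsub>metacyclic n k r s\<^esub> v) =
      (\<lambda>(i, j). c [^] i \<otimes> y [^] j) u \<otimes> (\<lambda>(i, j). c [^] i \<otimes> y [^] j) v"
    by (simp add: u mult_metacyclic)
qed (use c in auto)

lemma metacyclic_iso:
  assumes c: "c \<in> carrier G" "y \<in> carrier G" and rel: "y \<otimes> c = c [^] (r::nat) \<otimes> y"
    and cn: "c [^] n = \<one>" and yk: "y [^] k = c [^] (s::nat)"
    and surj: "\<And>g. g \<in> carrier G \<Longrightarrow> \<exists>i<n. \<exists>j<k. g = c [^] (i::nat) \<otimes> y [^] (j::nat)"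
    and card: "card (carrier G) = n * k"
  shows "metacyclic n k r s \<cong> G"
proof -
  let ?f = "\<lambda>(i, j). c [^] i \<otimes> y [^] j"
  have img: "?f ` carrier (metacyclic n k r s) = carrier G"
  proof (intro subset_antisym subsetI)
    fix g assume "g \<in> carrier G"
    then obtain i j where "i < n" "j < k" "g = c [^] i \<otimes> y [^] j" using surj by blast
    then show "g \<in> ?f ` carrier (metacyclic n k r s)"
      by (intro image_eqI[of _ _ "(i, j)"]) (auto simp: carrier_metacyclic)
  qed (use c in auto)
  moreover have "inj_on ?f (carrier (metacyclic n k r s))"
  proof (rule eq_card_imp_inj_on)
    show "card (?f ` carrier (metacyclic n k r s)) = card (carrier (metacyclic n k r s))"
      unfolding img by (simp add: card carrier_metacyclic card_cartesian_product)
  qed (simp add: carrier_metacyclic)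
  ultimately have "?f \<in> iso (metacyclic n k r s) G"
    using metacyclic_hom[OF c rel cn yk] by (simp add: iso_def bij_betw_def)
  then show ?thesis by (rule is_isoI)
qed

end

lemma metacyclic_normal_form:
  assumes "1 < n" "1 < k" "i < n" "j < k"
  shows "(1, 0) [^]\<^bsub>metacyclic n k r s\<^esub> i \<otimes>\<^bsub>metacyclic n k r s\<^esub>
    (0, 1) [^]\<^bsub>metacyclic n k r s\<^esub> j = (i, j)"
proof -
  have "(1, 0) [^]\<^bsub>metacyclic n k r s\<^esub> i = (i, 0)"
    using assms(3)
  proof (induction i)
    case (Suc i)
    then show ?case using assms by (simp add: nat_pow_Suc mult_metacyclic)
  qed (simp add: one_metacyclic)
  moreover have "(0, 1) [^]\<^bsub>metacyclic n k r s\<^esub> j = (0, j)"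
    using assms(4)
  proof (induction j)
    case (Suc j)
    then show ?case using assms by (simp add: nat_pow_Suc mult_metacyclic)
  qed (simp add: one_metacyclic)
  ultimately show ?thesis using assms by (simp add: mult_metacyclic)
qed

section \<open>Free groups, normal closures and presented groups\<close>

lemma free_eq_append_left: "free_eq u v \<Longrightarrow> free_eq (w @ u) (w @ v)"
proof (induction rule: free_eq.induct)
  case (cancel u g b v)
  then show ?case using free_eq.cancel[of "w @ u" g b v] by simp
qed (auto intro: free_eq.intros)

lemma free_eq_append_right: "free_eq u v \<Longrightarrow> free_eq (u @ w) (v @ w)"
proof (induction rule: free_eq.induct)
  case (cancel u g b v)
  then show ?case using free_eq.cancel[of u g b "v @ w"] by simp
qed (auto intro: free_eq.intros)

lemma free_eq_append: "free_eq u u' \<Longrightarrow> free_eq v v' \<Longrightarrow> free_eq (u @ v) (u' @ v')"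
  using free_eq_append_left free_eq_append_right free_eq.trans by metis

lemma free_class_eq_iff: "free_class u = free_class v \<longleftrightarrow> free_eq u v"
proof
  assume "free_class u = free_class v"
  then have "v \<in> free_class u" by (simp add: free_class_def free_eq.refl)
  then show "free_eq u v" by (simp add: free_class_def)
next
  assume "free_eq u v"
  then show "free_class u = free_class v"
    unfolding free_class_def by (auto intro: free_eq.trans free_eq.sym)
qed

lemma carrier_free_group: "carrier free_group = range free_class"
  and one_free_group: "\<one>\<^bsub>free_group\<^esub> = free_class []"
  by (simp_all add: free_group_def)

lemma mult_free_group: "free_class u \<otimes>\<^bsub>free_group\<^esub> free_class v = free_class (u @ v)"
proof -
  have "free_class (u' @ v') = free_class (u @ v)" if "u' \<in> free_class u" "v' \<in> free_class v" for u' v'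
  proof -
    have "free_eq u u'" "free_eq v v'" using that by (simp_all add: free_class_def)
    then show ?thesis unfolding free_class_eq_iff by (intro free_eq.sym[OF free_eq_append])
  qed
  then have "(\<Union>u'\<in>free_class u. \<Union>v'\<in>free_class v. free_class (u' @ v')) =
      (\<Union>u'\<in>free_class u. \<Union>v'\<in>free_class v. free_class (u @ v))"
    by (intro SUP_cong) simp_all
  also have "\<dots> = free_class (u @ v)"
  proof -
    have "u \<in> free_class u" "v \<in> free_class v" by (simp_all add: free_class_def free_eq.refl)
    then have "free_class u \<noteq> {}" "free_class v \<noteq> {}" by auto
    then show ?thesis by simp
  qed
  finally show ?thesis by (simp add: free_group_def)
qed

lemma free_eq_inverse: "free_eq (rev (map (\<lambda>(g, b). (g, \<not> b)) w) @ w) []"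
proof (induction w)
  case (Cons a w)
  obtain g b where a: "a = (g, b)" by fastforce
  have "free_eq (rev (map (\<lambda>(g, b). (g, \<not> b)) w) @ (g, \<not> b) # (g, \<not> \<not> b) # w)
      (rev (map (\<lambda>(g, b). (g, \<not> b)) w) @ w)"
    by (rule free_eq.cancel)
  then show ?case using free_eq.trans[OF _ Cons] by (simp add: a)
qed (simp add: free_eq.refl)

lemma group_free_group: "group free_group"
proof (rule groupI)
  fix x :: "'g word set" assume "x \<in> carrier free_group"
  then obtain w where w: "x = free_class w" by (auto simp: carrier_free_group)
  then show "\<one>\<^bsub>free_group\<^esub> \<otimes>\<^bsub>free_group\<^esub> x = x"
    by (simp add: one_free_group mult_free_group)
  have "free_class (rev (map (\<lambda>(g, b). (g, \<not> b)) w)) \<otimes>\<^bsub>free_group\<^esub> x = \<one>\<^bsub>free_group\<^esub>"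
    by (simp add: w one_free_group mult_free_group free_class_eq_iff free_eq_inverse)
  then show "\<exists>y\<in>carrier free_group. y \<otimes>\<^bsub>free_group\<^esub> x = \<one>\<^bsub>free_group\<^esub>"
    by (auto simp: carrier_free_group)
qed (auto simp: carrier_free_group one_free_group mult_free_group)

lemma free_gen_closed [simp]: "free_gen g \<in> carrier free_group"
  by (simp add: free_gen_def carrier_free_group)

lemma inv_free_gen: "inv\<^bsub>free_group\<^esub> (free_gen g) = free_class [(g, False)]"
proof -
  interpret F: group free_group by (rule group_free_group)
  have "free_eq ([] @ (g, False) # (g, \<not> False) # []) ([] @ [])" by (rule free_eq.cancel)
  then have "free_class [(g, False)] \<otimes>\<^bsub>free_group\<^esub> free_gen g = \<one>\<^bsub>free_group\<^esub>"
    by (simp add: free_gen_def mult_free_group one_free_group free_class_eq_iff)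
  then show ?thesis by (rule F.inv_equality) (simp_all add: carrier_free_group free_gen_def)
qed

lemma free_group_induct [consumes 1, case_names one gen inv_gen]:
  assumes "x \<in> carrier free_group"
    and "P \<one>\<^bsub>free_group\<^esub>"
    and "\<And>g x. x \<in> carrier free_group \<Longrightarrow> P x \<Longrightarrow> P (free_gen g \<otimes>\<^bsub>free_group\<^esub> x)"
    and "\<And>g x. x \<in> carrier free_group \<Longrightarrow> P x \<Longrightarrow> P (inv\<^bsub>free_group\<^esub> (free_gen g) \<otimes>\<^bsub>free_group\<^esub> x)"
  shows "P x"
proof -
  have "P (free_class w)" for w
  proof (induction w)
    case (Cons a w)
    obtain g b where a: "a = (g, b)" by fastforce
    show ?case
    proof (cases b)
      case True
      then show ?thesis using assms(3)[of "free_class w" g] Cons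
        by (simp add: a free_gen_def mult_free_group carrier_free_group)
    next
      case False
      then show ?thesis using assms(4)[of "free_class w" g] Cons
        by (simp add: a inv_free_gen mult_free_group carrier_free_group)
    qed
  qed (use assms(2) in \<open>simp add: one_free_group\<close>)
  then show ?thesis using assms(1) by (auto simp: carrier_free_group)
qed

context group
begin

fun word_eval :: "('g \<Rightarrow> 'a) \<Rightarrow> 'g word \<Rightarrow> 'a" where
  "word_eval f [] = \<one>"
| "word_eval f ((g, b) # w) = (if b then f g else inv (f g)) \<otimes> word_eval f w"

lemma word_eval_closed [simp]: "range f \<subseteq> carrier G \<Longrightarrow> word_eval f w \<in> carrier G"
proof (induction w)
  case (Cons a w)
  then show ?case by (cases a) (auto simp: image_subset_iff)
qed simp

lemma word_eval_append:
  "range f \<subseteq> carrier G \<Longrightarrow> word_eval f (u @ v) = word_eval f u \<otimes> word_eval f v"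
proof (induction u)
  case (Cons a u)
  then show ?case by (cases a) (auto simp: image_subset_iff m_assoc)
qed simp

lemma word_eval_free_eq:
  assumes f: "range f \<subseteq> carrier G"
  shows "free_eq u v \<Longrightarrow> word_eval f u = word_eval f v"
proof (induction rule: free_eq.induct)
  case (cancel u g b v)
  have "f g \<in> carrier G" using f by auto
  then have "word_eval f ((g, b) # (g, \<not> b) # v) = word_eval f v"
    using f by (cases b) (simp_all flip: m_assoc)
  then show ?case using f by (simp only: word_eval_append)
qed simp_all

text \<open>The universal property: a class is evaluated on a chosen word, and
  \<open>word_eval_free_eq\<close> makes the choice irrelevant.\<close>

lemma free_group_hom:
  fixes f :: "'g \<Rightarrow> 'a"
  assumes f: "range f \<subseteq> carrier G"
  obtains h where "h \<in> hom free_group G" "\<And>g. h (free_gen g) = f g"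
proof -
  define h where "h = (\<lambda>A. word_eval f (SOME w. w \<in> A))"
  have h: "h (free_class w) = word_eval f w" for w
  proof -
    have "(SOME w'. w' \<in> free_class w) \<in> free_class w"
      by (rule someI[of _ w]) (simp add: free_class_def free_eq.refl)
    then have "free_eq w (SOME w'. w' \<in> free_class w)" by (simp add: free_class_def)
    from word_eval_free_eq[OF f this] show ?thesis by (simp add: h_def)
  qed
  show ?thesis
  proof (rule that[of h])
    show "h \<in> hom free_group G"
      by (rule homI) (auto simp: carrier_free_group h f mult_free_group word_eval_append)
    fix g
    have "f g \<in> carrier G" using f by auto
    then show "h (free_gen g) = f g" by (simp add: free_gen_def h)
  qed
qed

lemma normal_normal_closure:
  assumes "S \<subseteq> carrier G"
  shows "normal_closure G S \<lhd> G"
proof (rule normal_invI)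
  \<comment> \<open>The intersection must run over a nonempty family, since the empty one would give
    the whole type.\<close>
  have "carrier G \<lhd> G" by (rule normal_invI[OF subgroup_self]) simp
  then have "{N. N \<lhd> G \<and> S \<subseteq> N} \<noteq> {}" using assms by blast
  then show "subgroup (normal_closure G S) G"
    unfolding normal_closure_def by (intro subgroups_Inter) (simp_all add: normal_imp_subgroup)
  fix x h assume x: "x \<in> carrier G" "h \<in> normal_closure G S"
  have "x \<otimes> h \<otimes> inv x \<in> N" if N: "N \<lhd> G" "S \<subseteq> N" for N
    using normal_invE(2)[OF N(1) x(1)] x(2) N unfolding normal_closure_def by blast
  then show "x \<otimes> h \<otimes> inv x \<in> normal_closure G S" unfolding normal_closure_def by blast
qed

end

lemma subset_normal_closure: "S \<subseteq> normal_closure G S"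
  unfolding normal_closure_def by blast

lemma normal_closure_subset: "N \<lhd> G \<Longrightarrow> S \<subseteq> N \<Longrightarrow> normal_closure G S \<subseteq> N"
  unfolding normal_closure_def by blast

text \<open>\<open>rel\<close> bounds the presented group from above: the relators imply the
  metacyclic relations, so the model maps onto it. \<open>model\<close> bounds it from below: the
  relators hold in the model, so the quotient maps back, and the composite fixes every normal form.
  The generators \<open>a\<close> and \<open>b\<close> are parameters because either one may
  generate the normal cyclic subgroup.\<close>

lemma metacyclic_iso_presented:
  fixes R :: "generator word set set" and a b :: generator
  assumes pos: "1 < n" "1 < k" and rk: "[r ^ k = 1] (mod n)" and rs: "[r * s = s] (mod n)"
    and R: "R \<subseteq> carrier free_group" and ab: "a \<noteq> b" "UNIV = {a, b}"
    and rel: "\<And>(H :: generator word set set monoid) \<pi>. group_hom free_group H \<pi> \<Longrightarrow>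
        (\<And>x. x \<in> R \<Longrightarrow> \<pi> x = \<one>\<^bsub>H\<^esub>) \<Longrightarrow>
        \<pi> (free_gen a) [^]\<^bsub>H\<^esub> n = \<one>\<^bsub>H\<^esub> \<and>
        \<pi> (free_gen b) [^]\<^bsub>H\<^esub> k = \<pi> (free_gen a) [^]\<^bsub>H\<^esub> s \<and>
        \<pi> (free_gen b) \<otimes>\<^bsub>H\<^esub> \<pi> (free_gen a) = \<pi> (free_gen a) [^]\<^bsub>H\<^esub> r \<otimes>\<^bsub>H\<^esub> \<pi> (free_gen b)"
    and model: "\<And>h x. group_hom free_group (metacyclic n k r s) h \<Longrightarrow> h (free_gen a) = (1, 0) \<Longrightarrow>
        h (free_gen b) = (0, 1) \<Longrightarrow> x \<in> R \<Longrightarrow> h x = (0, 0)"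
  shows "metacyclic n k r s \<cong> presented_group R"
proof -
  let ?F = "free_group :: generator word set monoid" and ?M = "metacyclic n k r s"
  define N where "N = normal_closure ?F R"
  define P where "P = ?F Mod N"
  interpret F: group ?F by (rule group_free_group)
  interpret M: group ?M using pos by (intro group_metacyclic rk rs) simp_all
  have N: "N \<lhd> ?F" unfolding N_def by (rule F.normal_normal_closure[OF R])
  interpret N: normal N ?F by (rule N)
  interpret P: group P unfolding P_def by (rule N.factorgroup_is_group)
  define \<pi> where "\<pi> = (\<lambda>x. N #>\<^bsub>?F\<^esub> x)"
  have \<pi>: "\<pi> \<in> hom ?F P" unfolding \<pi>_def P_def by (rule N.r_coset_hom_Mod)
  interpret \<pi>: group_hom ?F P \<pi> by unfold_locales (rule \<pi>)
  have \<pi>_R: "\<pi> x = \<one>\<^bsub>P\<^esub>" if "x \<in> R" for x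
  proof -
    have "x \<in> N" using that subset_normal_closure[of R ?F] unfolding N_def by blast
    then show ?thesis using N.rcos_const[OF F.is_group] by (simp add: \<pi>_def P_def)
  qed
  define c where "c = \<pi> (free_gen a)"
  define y where "y = \<pi> (free_gen b)"
  have cy: "c \<in> carrier P" "y \<in> carrier P" unfolding c_def y_def by simp_all
  have rels: "c [^]\<^bsub>P\<^esub> n = \<one>\<^bsub>P\<^esub>" "y [^]\<^bsub>P\<^esub> k = c [^]\<^bsub>P\<^esub> s" "y \<otimes>\<^bsub>P\<^esub> c = c [^]\<^bsub>P\<^esub> r \<otimes>\<^bsub>P\<^esub> y"
    using rel[OF \<pi>.group_hom_axioms \<pi>_R] unfolding c_def y_def by auto
  define f where "f = (\<lambda>(i, j). c [^]\<^bsub>P\<^esub> (i::nat) \<otimes>\<^bsub>P\<^esub> y [^]\<^bsub>P\<^esub> (j::nat))"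
  have f: "f \<in> hom ?M P" unfolding f_def
    by (rule P.metacyclic_hom[OF cy rels(3,1,2)])
  interpret f: group_hom ?M P f by unfold_locales (rule f)
  have gens: "(1, 0) \<in> carrier ?M" "(0, 1) \<in> carrier ?M"
    using pos by (simp_all add: carrier_metacyclic)
  have f_gens: "f (1, 0) = c" "f (0, 1) = y" using cy by (simp_all add: f_def)
  have img: "subgroup (f ` carrier ?M) P" by (rule f.img_is_subgroup)
  interpret img: subgroup "f ` carrier ?M" P by (rule img)
  have gen_img: "\<pi> (free_gen g) \<in> f ` carrier ?M" for g
  proof -
    have "g = a \<or> g = b" using ab by auto
    then show ?thesis using f_gens gens unfolding c_def y_def by (metis imageI)
  qed
  have \<pi>_img: "\<pi> x \<in> f ` carrier ?M" if "x \<in> carrier ?F" for x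
    using that
  proof (induction x rule: free_group_induct)
    case one
    then show ?case using img.one_closed by simp
  next
    case (gen g x)
    then show ?case using img.m_closed[OF gen_img[of g]] by simp
  next
    case (inv_gen g x)
    then show ?case using img.m_closed[OF img.m_inv_closed[OF gen_img[of g]]] by simp
  qed
  have surj: "f ` carrier ?M = carrier P"
  proof (intro subset_antisym subsetI)
    fix u assume "u \<in> carrier P"
    then obtain x where "x \<in> carrier ?F" "u = \<pi> x"
      unfolding P_def \<pi>_def by (auto simp: carrier_FactGroup)
    then show "u \<in> f ` carrier ?M" using \<pi>_img by simp
  qed (use f.hom_closed in auto)
  have "range (\<lambda>g. if g = a then (1, 0) else (0, 1)) \<subseteq> carrier ?M" using gens by auto
  from M.free_group_hom[OF this] obtain h where h: "h \<in> hom ?F ?M"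
    "\<And>g. h (free_gen g) = (if g = a then (1, 0) else (0, 1))" by metis
  interpret h: group_hom ?F ?M h by unfold_locales (rule h)
  have h_gens: "h (free_gen a) = (1, 0)" "h (free_gen b) = (0, 1)" using h(2) ab by auto
  have "R \<subseteq> kernel ?F ?M h"
    using model[OF h.group_hom_axioms h_gens] R by (auto simp: kernel_def one_metacyclic)
  then have N_ker: "N \<subseteq> kernel ?F ?M h"
    unfolding N_def by (intro normal_closure_subset h.normal_kernel)
  obtain g where g: "g \<in> hom P ?M" "\<And>x. x \<in> carrier ?F \<Longrightarrow> g (\<pi> x) = h x"
    using h.FactGroup_universal_kernel[OF N N_ker] unfolding P_def \<pi>_def by blast
  interpret g: group_hom P ?M g by unfold_locales (rule g)
  have g_gens: "g c = (1, 0)" "g y = (0, 1)" unfolding c_def y_def using g(2) h_gens by simp_all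
  have gf: "g (f (i, j)) = (i, j)" if "i < n" "j < k" for i j
  proof -
    have "g (f (i, j)) = (1, 0) [^]\<^bsub>?M\<^esub> i \<otimes>\<^bsub>?M\<^esub> (0, 1) [^]\<^bsub>?M\<^esub> j"
      using cy by (simp add: f_def g.hom_nat_pow g_gens)
    then show ?thesis using metacyclic_normal_form[OF pos that] by simp
  qed
  have "inj_on f (carrier ?M)"
    by (rule inj_on_inverseI[of _ g]) (auto simp: carrier_metacyclic gf)
  then have "f \<in> iso ?M P" using f surj by (simp add: iso_def bij_betw_def)
  then show ?thesis unfolding presented_group_def P_def N_def by (rule is_isoI)
qed

section \<open>The three presentations as metacyclic groups\<close>

context group
begin

lemma commutator_mult_eq_one_iff:
  assumes "x \<in> carrier G" "y \<in> carrier G" "z \<in> carrier G"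
  shows "commutator G x y \<otimes> z = \<one> \<longleftrightarrow> x \<otimes> y \<otimes> z = y \<otimes> x"
proof -
  have "commutator G x y \<otimes> z = inv (y \<otimes> x) \<otimes> (x \<otimes> y \<otimes> z)"
    using assms by (simp add: commutator_def inv_mult_group m_assoc)
  then show ?thesis using assms inv_solve_left'[of \<one> "y \<otimes> x" "x \<otimes> y \<otimes> z"] by simp
qed

lemma mult_inv_eq_one_iff:
  "x \<in> carrier G \<Longrightarrow> y \<in> carrier G \<Longrightarrow> x \<otimes> inv y = \<one> \<longleftrightarrow> x = y"
  using inv_solve_right'[of \<one> x y] by simp

lemma pow_intertwine:
  assumes c: "c \<in> carrier G" "d \<in> carrier G" "y \<in> carrier G" and rel: "y \<otimes> c = d \<otimes> y"
  shows "y \<otimes> c [^] (i::nat) = d [^] i \<otimes> y"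
proof (induction i)
  case (Suc i)
  have "y \<otimes> c [^] Suc i = y \<otimes> c [^] i \<otimes> c" using c by (simp add: m_assoc)
  also have "\<dots> = d [^] i \<otimes> (y \<otimes> c)" using c Suc by (simp add: m_assoc)
  also have "\<dots> = d [^] Suc i \<otimes> y" using c by (simp add: rel m_assoc)
  finally show ?case .
qed (use c in simp)

lemma pow_eq_cancel:
  assumes "y \<in> carrier G" "y [^] (a + b) = y [^] (b::nat)"
  shows "y [^] (a::nat) = \<one>"
  using assms by (simp flip: nat_pow_mult)

text \<open>The relators do not state the order of \<open>y\<close>. Conjugation by
  \<open>inv x\<close> sends \<open>y\<close> to its fifth power. Done twice it fixes
  \<open>y\<close>, because x^2 = y^8 commutes with \<open>y\<close>; hence y^24 = 1. Done once it
  fixes x^2 = y^8; hence y^32 = 1. The two exponents differ by 8.\<close>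

lemma relations_G11:
  assumes x: "x \<in> carrier G" and y: "y \<in> carrier G" and 1: "x [^] (2::nat) = y [^] (8::nat)"
    and 2: "x \<otimes> y \<otimes> y [^] (4::nat) = y \<otimes> x"
  shows "y [^] (8::nat) = \<one>" and "x [^] (2::nat) = \<one>" and "x \<otimes> y = y [^] (5::nat) \<otimes> x"
proof -
  have "y \<otimes> y [^] (4::nat) = y [^] (5::nat)"
    using nat_pow_Suc2[OF y, of 4] by (simp add: numeral_eq_Suc)
  then have yx: "x \<otimes> y [^] (5::nat) = y \<otimes> x" using 2 x y by (simp add: m_assoc)
  have "inv x \<otimes> (y \<otimes> x) \<otimes> inv x = inv x \<otimes> (x \<otimes> y [^] (5::nat)) \<otimes> inv x" by (simp add: yx)
  then have rel: "inv x \<otimes> y = y [^] (5::nat) \<otimes> inv x" using x y by (simp add: m_assoc flip: m_assoc[of "inv x" x])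
  note conj = power_conj_power[OF y inv_closed[OF x] rel]
  have x2: "inv x [^] (2::nat) = inv (y [^] (8::nat))" using 1 x by (simp add: nat_pow_inv)
  have "inv (y [^] (8::nat)) \<otimes> y = y \<otimes> inv (y [^] (8::nat))"
  proof -
    have "y [^] (8::nat) \<otimes> y = y \<otimes> y [^] (8::nat)" using y nat_pow_comm[of y 8 1] by simp
    then show ?thesis using y by (metis inv_closed inv_mult_group inv_solve_left inv_solve_right m_assoc nat_pow_closed m_closed)
  qed
  then have "y \<otimes> inv (y [^] (8::nat)) = y [^] (25::nat) \<otimes> inv (y [^] (8::nat))"
    using conj[of 2 1] y by (simp add: x2)
  then have "y = y [^] (25::nat)" using y by simp
  then have 24: "y [^] (24::nat) = \<one>" using pow_eq_cancel[of y 24 1] y by simp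
  have "inv x \<otimes> x [^] (2::nat) = x [^] (2::nat) \<otimes> inv x"
    using x by (simp add: numeral_2_eq_2 m_assoc flip: m_assoc[of "inv x" x])
  then have "y [^] (8::nat) \<otimes> inv x = y [^] (40::nat) \<otimes> inv x"
    using conj[of 1 8] x y by (simp add: 1)
  then have "y [^] (40::nat) = y [^] (8::nat)" using x y by simp
  then have 32: "y [^] (32::nat) = \<one>" using pow_eq_cancel[of y 32 8] y by simp
  have "ord y dvd 32 - 24" using 24 32 y by (intro dvd_diff_nat) (simp_all add: pow_eq_id)
  then show y8: "y [^] (8::nat) = \<one>" using y by (simp add: pow_eq_id)
  then show x2: "x [^] (2::nat) = \<one>" using 1 by simp
  then have "inv x = x" using x by (intro inv_equality) (simp_all add: numeral_2_eq_2)
  then show "x \<otimes> y = y [^] (5::nat) \<otimes> x" using rel by simp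
qed

text \<open>The second relation amounts to x y x = y, so \<open>y\<close> inverts \<open>x\<close>.
  As \<open>y\<close> commutes with y^2 = x^4, the element x^4 is its own inverse, and inversion
  becomes the exponent 7.\<close>

lemma relations_G14:
  assumes x: "x \<in> carrier G" and y: "y \<in> carrier G" and 1: "x [^] (4::nat) = y [^] (2::nat)"
    and 2: "x \<otimes> y \<otimes> x [^] (2::nat) = y \<otimes> x"
  shows "x [^] (8::nat) = \<one>" and "y \<otimes> x = x [^] (7::nat) \<otimes> y"
proof -
  have "x \<otimes> y \<otimes> x \<otimes> x = y \<otimes> x" using 2 x y by (simp add: numeral_2_eq_2 m_assoc)
  then have "x \<otimes> (y \<otimes> x) = y" using x y by (simp add: m_assoc[symmetric])
  then have rel: "y \<otimes> x = inv x \<otimes> y" using x y inv_solve_left[of "y \<otimes> x" x y] by simp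
  have "y \<otimes> x [^] (4::nat) = inv x [^] (4::nat) \<otimes> y"
    using x y by (intro pow_intertwine rel) simp_all
  moreover have "y \<otimes> y [^] (2::nat) = y [^] (2::nat) \<otimes> y"
    using y by (simp add: numeral_2_eq_2 m_assoc)
  ultimately have "x [^] (4::nat) = inv x [^] (4::nat)" using x y by (simp add: 1)
  then have "x [^] (4::nat) = inv (x [^] (4::nat))" using x by (simp add: nat_pow_inv)
  then have "x [^] (4::nat) \<otimes> x [^] (4::nat) = \<one>" using x by (metis nat_pow_closed r_inv)
  then show x8: "x [^] (8::nat) = \<one>" using x by (simp add: nat_pow_mult)
  have "x [^] (7::nat) \<otimes> x = \<one>" using x8 by (simp add: numeral_eq_Suc)
  then have "inv x = x [^] (7::nat)" using x by (intro inv_equality) simp_all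
  then show "y \<otimes> x = x [^] (7::nat) \<otimes> y" using rel by simp
qed

lemma int_pow_numeral: "x [^] (numeral k :: int) = x [^] (numeral k :: nat)"
  using int_pow_int[of G x "numeral k"] by simp

lemma int_pow_neg_numeral: "x \<in> carrier G \<Longrightarrow> x [^] (- numeral k :: int) = inv (x [^] (numeral k :: nat))"
  by (simp add: int_pow_neg int_pow_numeral)

end

lemma (in group_hom) hom_commutator:
  "x \<in> carrier G \<Longrightarrow> y \<in> carrier G \<Longrightarrow> h (commutator G x y) = commutator H (h x) (h y)"
  by (simp add: commutator_def)

lemma commutator_closed [simp]:
  "group G \<Longrightarrow> x \<in> carrier G \<Longrightarrow> y \<in> carrier G \<Longrightarrow> commutator G x y \<in> carrier G"
  by (simp add: commutator_def group.is_monoid monoid.m_closed)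

lemma UNIV_generator: "UNIV = {Gen1, Gen2}"
  by (auto intro: generator.exhaust)

text \<open>Unrolls a numeral power factor by factor, which makes it computable in the pair
  model.\<close>

lemma metacyclic_power:
  "x [^]\<^bsub>metacyclic n k r s\<^esub> (numeral v :: nat) =
    x [^]\<^bsub>metacyclic n k r s\<^esub> (pred_numeral v) \<otimes>\<^bsub>metacyclic n k r s\<^esub> x"
  by (simp add: numeral_eq_Suc)

lemma metacyclic_iso_G11: "metacyclic 8 2 5 0 \<cong> G11"
  unfolding G11_def Let_def
proof (rule metacyclic_iso_presented[of 8 2 5 0 _ Gen2 Gen1])
  interpret F: group "free_group :: generator word set monoid" by (rule group_free_group)
  let ?x = "free_gen Gen1" and ?y = "free_gen Gen2"
  let ?R = "{?x [^]\<^bsub>free_group\<^esub> (2::int) \<otimes>\<^bsub>free_group\<^esub> ?y [^]\<^bsub>free_group\<^esub> (-8::int),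
     commutator free_group ?x ?y \<otimes>\<^bsub>free_group\<^esub> ?y [^]\<^bsub>free_group\<^esub> (4::int)}"
  show "?R \<subseteq> carrier free_group" by (simp add: group_free_group)
  show "UNIV = {Gen2, Gen1}" using UNIV_generator by auto
  \<comment> \<open>One equivalence serves both directions: it extracts relations in the quotient
    and verifies the relators in the model.\<close>
  have rel: "(\<forall>u\<in>?R. h u = \<one>\<^bsub>H\<^esub>) \<longleftrightarrow> h ?x [^]\<^bsub>H\<^esub> (2::nat) = h ?y [^]\<^bsub>H\<^esub> (8::nat) \<and>
      h ?x \<otimes>\<^bsub>H\<^esub> h ?y \<otimes>\<^bsub>H\<^esub> h ?y [^]\<^bsub>H\<^esub> (4::nat) = h ?y \<otimes>\<^bsub>H\<^esub> h ?x"
    if "group_hom free_group H h" for H :: "'z monoid" and h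
  proof -
    interpret h: group_hom free_group H h by (rule that)
    show ?thesis
      by (simp add: h.hom_commutator group_free_group F.int_pow_numeral F.int_pow_neg_numeral h.hom_nat_pow
          h.mult_inv_eq_one_iff h.commutator_mult_eq_one_iff)
  qed
  show "h (free_gen Gen2) [^]\<^bsub>H\<^esub> (8::nat) = \<one>\<^bsub>H\<^esub> \<and>
    h (free_gen Gen1) [^]\<^bsub>H\<^esub> (2::nat) = h (free_gen Gen2) [^]\<^bsub>H\<^esub> (0::nat) \<and>
    h (free_gen Gen1) \<otimes>\<^bsub>H\<^esub> h (free_gen Gen2) = h (free_gen Gen2) [^]\<^bsub>H\<^esub> (5::nat) \<otimes>\<^bsub>H\<^esub> h (free_gen Gen1)"
    if hom: "group_hom free_group H h" and triv: "\<And>u. u \<in> ?R \<Longrightarrow> h u = \<one>\<^bsub>H\<^esub>"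
    for H :: "generator word set set monoid" and h
  proof -
    interpret h: group_hom free_group H h by (rule hom)
    have "\<forall>u\<in>?R. h u = \<one>\<^bsub>H\<^esub>" using triv by blast
    with h.H.relations_G11[of "h ?x" "h ?y"] rel[OF hom] show ?thesis by simp
  qed
  show "h u = (0, 0)"
    if hom: "group_hom free_group (metacyclic 8 2 5 0) h"
      and gens: "h (free_gen Gen2) = (1, 0)" "h (free_gen Gen1) = (0, 1)" and u: "u \<in> ?R" for h u
  proof -
    have "\<forall>u\<in>?R. h u = \<one>\<^bsub>metacyclic 8 2 5 0\<^esub>"
      unfolding rel[OF hom] gens by (simp add: metacyclic_power mult_metacyclic one_metacyclic)
    from bspec[OF this u] show ?thesis by (simp only: one_metacyclic)
  qed
qed (simp_all add: cong_def)

lemma metacyclic_iso_G14: "metacyclic 8 2 7 4 \<cong> G14"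
  unfolding G14_def Let_def
proof (rule metacyclic_iso_presented[of 8 2 7 4 _ Gen1 Gen2])
  interpret F: group "free_group :: generator word set monoid" by (rule group_free_group)
  let ?x = "free_gen Gen1" and ?y = "free_gen Gen2"
  let ?R = "{?x [^]\<^bsub>free_group\<^esub> (4::int) \<otimes>\<^bsub>free_group\<^esub> ?y [^]\<^bsub>free_group\<^esub> (-2::int),
     commutator free_group ?x ?y \<otimes>\<^bsub>free_group\<^esub> ?x [^]\<^bsub>free_group\<^esub> (2::int)}"
  show "?R \<subseteq> carrier free_group" by (simp add: group_free_group)
  show "UNIV = {Gen1, Gen2}" using UNIV_generator by auto
  have rel: "(\<forall>u\<in>?R. h u = \<one>\<^bsub>H\<^esub>) \<longleftrightarrow> h ?x [^]\<^bsub>H\<^esub> (4::nat) = h ?y [^]\<^bsub>H\<^esub> (2::nat) \<and>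
      h ?x \<otimes>\<^bsub>H\<^esub> h ?y \<otimes>\<^bsub>H\<^esub> h ?x [^]\<^bsub>H\<^esub> (2::nat) = h ?y \<otimes>\<^bsub>H\<^esub> h ?x"
    if "group_hom free_group H h" for H :: "'z monoid" and h
  proof -
    interpret h: group_hom free_group H h by (rule that)
    show ?thesis
      by (simp add: h.hom_commutator group_free_group F.int_pow_numeral F.int_pow_neg_numeral h.hom_nat_pow
          h.mult_inv_eq_one_iff h.commutator_mult_eq_one_iff)
  qed
  show "h (free_gen Gen1) [^]\<^bsub>H\<^esub> (8::nat) = \<one>\<^bsub>H\<^esub> \<and>
    h (free_gen Gen2) [^]\<^bsub>H\<^esub> (2::nat) = h (free_gen Gen1) [^]\<^bsub>H\<^esub> (4::nat) \<and>
    h (free_gen Gen2) \<otimes>\<^bsub>H\<^esub> h (free_gen Gen1) = h (free_gen Gen1) [^]\<^bsub>H\<^esub> (7::nat) \<otimes>\<^bsub>H\<^esub> h (free_gen Gen2)"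
    if hom: "group_hom free_group H h" and triv: "\<And>u. u \<in> ?R \<Longrightarrow> h u = \<one>\<^bsub>H\<^esub>"
    for H :: "generator word set set monoid" and h
  proof -
    interpret h: group_hom free_group H h by (rule hom)
    have "\<forall>u\<in>?R. h u = \<one>\<^bsub>H\<^esub>" using triv by blast
    with h.H.relations_G14[of "h ?x" "h ?y"] rel[OF hom] show ?thesis by simp
  qed
  show "h u = (0, 0)"
    if hom: "group_hom free_group (metacyclic 8 2 7 4) h"
      and gens: "h (free_gen Gen1) = (1, 0)" "h (free_gen Gen2) = (0, 1)" and u: "u \<in> ?R" for h u
  proof -
    have "\<forall>u\<in>?R. h u = \<one>\<^bsub>metacyclic 8 2 7 4\<^esub>"
      unfolding rel[OF hom] gens by (simp add: metacyclic_power mult_metacyclic one_metacyclic)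
    from bspec[OF this u] show ?thesis by (simp only: one_metacyclic)
  qed
qed (simp_all add: cong_def)

lemma metacyclic_iso_G27: "metacyclic 9 3 4 0 \<cong> G27"
  unfolding G27_def Let_def
proof (rule metacyclic_iso_presented[of 9 3 4 0 _ Gen1 Gen2])
  interpret F: group "free_group :: generator word set monoid" by (rule group_free_group)
  let ?x = "free_gen Gen1" and ?y = "free_gen Gen2"
  let ?R = "{?x [^]\<^bsub>free_group\<^esub> ((3::nat) ^ 2), ?y [^]\<^bsub>free_group\<^esub> (3::nat),
     (?y \<otimes>\<^bsub>free_group\<^esub> ?x) \<otimes>\<^bsub>free_group\<^esub> inv\<^bsub>free_group\<^esub> (?x [^]\<^bsub>free_group\<^esub> (4::nat) \<otimes>\<^bsub>free_group\<^esub> ?y)}"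
  show "?R \<subseteq> carrier free_group" by (simp add: group_free_group)
  show "UNIV = {Gen1, Gen2}" using UNIV_generator by auto
  have rel: "(\<forall>u\<in>?R. h u = \<one>\<^bsub>H\<^esub>) \<longleftrightarrow> h ?x [^]\<^bsub>H\<^esub> (9::nat) = \<one>\<^bsub>H\<^esub> \<and> h ?y [^]\<^bsub>H\<^esub> (3::nat) = \<one>\<^bsub>H\<^esub> \<and>
      h ?y \<otimes>\<^bsub>H\<^esub> h ?x = h ?x [^]\<^bsub>H\<^esub> (4::nat) \<otimes>\<^bsub>H\<^esub> h ?y"
    if "group_hom free_group H h" for H :: "'z monoid" and h
  proof -
    interpret h: group_hom free_group H h by (rule that)
    show ?thesis
      by (simp add: h.hom_commutator group_free_group F.int_pow_numeral F.int_pow_neg_numeral h.hom_nat_pow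
          h.mult_inv_eq_one_iff h.commutator_mult_eq_one_iff)
  qed
  show "h (free_gen Gen1) [^]\<^bsub>H\<^esub> (9::nat) = \<one>\<^bsub>H\<^esub> \<and>
    h (free_gen Gen2) [^]\<^bsub>H\<^esub> (3::nat) = h (free_gen Gen1) [^]\<^bsub>H\<^esub> (0::nat) \<and>
    h (free_gen Gen2) \<otimes>\<^bsub>H\<^esub> h (free_gen Gen1) = h (free_gen Gen1) [^]\<^bsub>H\<^esub> (4::nat) \<otimes>\<^bsub>H\<^esub> h (free_gen Gen2)"
    if hom: "group_hom free_group H h" and triv: "\<And>u. u \<in> ?R \<Longrightarrow> h u = \<one>\<^bsub>H\<^esub>"
    for H :: "generator word set set monoid" and h
  proof -
    interpret h: group_hom free_group H h by (rule hom)
    have "\<forall>u\<in>?R. h u = \<one>\<^bsub>H\<^esub>" using triv by blast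
    with rel[OF hom] show ?thesis by simp
  qed
  show "h u = (0, 0)"
    if hom: "group_hom free_group (metacyclic 9 3 4 0) h"
      and gens: "h (free_gen Gen1) = (1, 0)" "h (free_gen Gen2) = (0, 1)" and u: "u \<in> ?R" for h u
  proof -
    have "\<forall>u\<in>?R. h u = \<one>\<^bsub>metacyclic 9 3 4 0\<^esub>"
      unfolding rel[OF hom] gens by (simp add: metacyclic_power mult_metacyclic one_metacyclic)
    from bspec[OF this u] show ?thesis by (simp only: one_metacyclic)
  qed
qed (simp_all add: cong_def)

text \<open>With trivial action \<open>r = 1\<close> and trivial extension \<open>s = 0\<close>,
  pairs multiply componentwise; only the passage from naturals to integers remains.\<close>

lemma metacyclic_iso_DirProd:
  assumes "n > 0" "k > 0"
  shows "metacyclic n k 1 0 \<cong> integer_mod_group n \<times>\<times> integer_mod_group k"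
proof (rule is_isoI, rule isoI)
  let ?f = "\<lambda>(i, j). (int i, int j)"
  show "?f \<in> hom (metacyclic n k 1 0) (integer_mod_group n \<times>\<times> integer_mod_group k)"
    using assms by (intro homI) (auto simp: carrier_metacyclic mult_metacyclic carrier_integer_mod_group zmod_int)
  show "bij_betw ?f (carrier (metacyclic n k 1 0)) (carrier (integer_mod_group n \<times>\<times> integer_mod_group k))"
    by (rule bij_betw_byWitness[where f' = "\<lambda>(i, j). (nat i, nat j)"])
      (use assms in \<open>auto simp: carrier_metacyclic carrier_integer_mod_group\<close>)
qed

context group
begin

lemma inv_mult_cancel: "x \<in> carrier G \<Longrightarrow> z \<in> carrier G \<Longrightarrow> inv x \<otimes> (x \<otimes> z) = z"
  and mult_inv_cancel: "x \<in> carrier G \<Longrightarrow> z \<in> carrier G \<Longrightarrow> x \<otimes> (inv x \<otimes> z) = z"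
  by (simp_all flip: m_assoc)

end

context finite_group
begin

lemma pow_eq_iff_cong:
  assumes "x \<in> carrier G"
  shows "x [^] (a::nat) = x [^] (b::nat) \<longleftrightarrow> [a = b] (mod ord x)"
proof -
  have *: "x [^] (a::nat) = x [^] (b::nat) \<longleftrightarrow> [a = b] (mod ord x)" if "b \<le> a" for a b
  proof -
    have "x [^] a = x [^] (a - b) \<otimes> x [^] b" using assms that by (simp add: nat_pow_mult)
    then have "x [^] a = x [^] b \<longleftrightarrow> x [^] (a - b) = \<one>" using assms by simp
    then show ?thesis using assms that by (simp add: pow_eq_id cong_altdef_nat)
  qed
  show ?thesis using *[of b a] *[of a b] by (cases "b \<le> a") (auto simp: cong_sym_eq)
qed

lemma mem_cycE:
  assumes "x \<in> cyc c" "c \<in> carrier G"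
  obtains i where "i < ord c" "x = c [^] (i::nat)"
proof -
  obtain i :: nat where i: "x = c [^] i" using assms cyc_powers by auto
  have "c [^] (i mod ord c) = c [^] i" using assms by (intro pow_mod) simp_all
  then show ?thesis using that[of "i mod ord c"] i ord_pos[OF assms(2)] by simp
qed

lemma cyc_m_closed: "c \<in> carrier G \<Longrightarrow> a \<in> cyc c \<Longrightarrow> b \<in> cyc c \<Longrightarrow> a \<otimes> b \<in> cyc c"
  and cyc_inv_closed: "c \<in> carrier G \<Longrightarrow> a \<in> cyc c \<Longrightarrow> inv a \<in> cyc c"
  using subgroup.m_closed[OF subgroup_cyc] subgroup.m_inv_closed[OF subgroup_cyc] by simp_all

lemma pow_mem_cyc: "c \<in> carrier G \<Longrightarrow> c [^] (i::nat) \<in> cyc c"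
  using cyc_powers by auto

text \<open>The geometric sum is the norm of the action by \<open>r\<close>. It tells which
  \<open>i\<close> makes a power of \<open>c [^] i \<otimes> y\<close> trivial when \<open>y\<close>
  itself is not good enough.\<close>

lemma power_mult_pow:
  assumes c: "c \<in> carrier G" "y \<in> carrier G" and rel: "y \<otimes> c = c [^] (r::nat) \<otimes> y"
  shows "(c [^] i \<otimes> y) [^] (j::nat) = c [^] (i * (\<Sum>t<j. r ^ t)) \<otimes> y [^] j"
proof (induction j)
  case (Suc j)
  have "(c [^] i \<otimes> y) [^] Suc j = c [^] (i * (\<Sum>t<j. r ^ t)) \<otimes> (y [^] j \<otimes> c [^] i) \<otimes> y"
    using c Suc by (simp add: m_assoc)
  also have "\<dots> = c [^] (i * (\<Sum>t<j. r ^ t)) \<otimes> (c [^] (r ^ j * i) \<otimes> y [^] j) \<otimes> y"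
    by (simp only: power_conj_power[OF c rel])
  also have "\<dots> = c [^] (i * (\<Sum>t<j. r ^ t)) \<otimes> c [^] (r ^ j * i) \<otimes> y [^] Suc j"
    using c by (simp add: m_assoc)
  also have "\<dots> = c [^] (i * (\<Sum>t<Suc j. r ^ t)) \<otimes> y [^] Suc j"
    using c by (simp add: nat_pow_mult algebra_simps)
  finally show ?case .
qed simp

end

section \<open>Normality of the maximal cyclic subgroup and normal forms\<close>

context max_cyclic
begin

lemma inv_out: "y \<in> out \<Longrightarrow> inv y \<in> out"
  using subgroup.m_inv_closed[OF subgroup_cyc[OF c], of "inv y"] by (auto simp: out_def)

lemma mult_out: "y \<in> out \<Longrightarrow> c [^] (i::nat) \<otimes> y \<in> out"
proof (rule outI)
  assume y: "y \<in> out"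
  show "c [^] i \<otimes> y \<in> carrier G" using y by simp
  show "c [^] i \<otimes> y \<notin> cyc c"
  proof
    assume "c [^] i \<otimes> y \<in> cyc c"
    then have "inv (c [^] i) \<otimes> (c [^] i \<otimes> y) \<in> cyc c"
      by (intro cyc_m_closed[OF c cyc_inv_closed[OF c pow_mem_cyc[OF c]]])
    then have "y \<in> cyc c" using y by (simp add: inv_mult_cancel)
    then show False using y by (simp add: out_def)
  qed
qed

text \<open>An element \<open>y\<close> outside \<open>\<langle>c\<rangle>\<close> lies outside the product of \<open>\<langle>c\<rangle>\<close> with its conjugate by \<open>y\<close>,
  so the two subgroups intersect in more than \<open>n / m\<close> elements.\<close>

lemma conj_mem_cyc:
  assumes m_le: "\<And>d. d dvd n \<Longrightarrow> 1 < d \<Longrightarrow> m \<le> d" and y: "y \<in> out"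
  shows "inv y \<otimes> c \<otimes> y \<in> cyc c"
proof -
  have yc: "y \<in> carrier G" using y by simp
  let ?c = "inv y \<otimes> c \<otimes> y"
  have c': "?c \<in> carrier G" using yc by simp
  have rel: "y \<otimes> ?c = c \<otimes> y" using yc by (simp add: m_assoc mult_inv_cancel)
  have pow': "y \<otimes> ?c [^] (i::nat) = c [^] i \<otimes> y" for i
    by (rule pow_intertwine[OF c' c yc rel])
  have pow: "?c [^] (i::nat) = inv y \<otimes> c [^] i \<otimes> y" for i
    using pow'[of i] inv_mult_cancel[OF yc nat_pow_closed[OF c', of i]] yc by (simp add: m_assoc)
  have "?c [^] k = \<one> \<longleftrightarrow> c [^] k = \<one>" for k :: nat
  proof
    assume "?c [^] k = \<one>"
    then show "c [^] k = \<one>" using pow'[of k] yc by simp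
  next
    assume "c [^] k = \<one>"
    then show "?c [^] k = \<one>" using pow[of k] yc by simp
  qed
  then have ord': "ord ?c = n" using c' by (simp add: ord_unique pow_eq_id)
  let ?D = "cyc c \<inter> cyc ?c"
  have sub: "subgroup ?D G" using c' by (intro subgroups_Inter_pair subgroup_cyc c)
  have "y \<notin> cyc c <#> cyc ?c"
  proof
    assume "y \<in> cyc c <#> cyc ?c"
    then obtain a b where ab: "a \<in> cyc c" "b \<in> cyc ?c" "y = a \<otimes> b" by (auto simp: set_mult_def)
    obtain i :: nat where i: "a = c [^] i" using ab(1) cyc_powers[OF c] by auto
    obtain j :: nat where j: "b = ?c [^] j" using ab(2) cyc_powers[OF c'] by auto
    have "y = c [^] i \<otimes> (inv y \<otimes> c [^] j \<otimes> y)" by (rule ab(3)[unfolded i j pow])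
    also have "\<dots> = c [^] i \<otimes> (inv y \<otimes> c [^] j) \<otimes> y" using yc by (simp add: m_assoc)
    finally have "c [^] i \<otimes> (inv y \<otimes> c [^] j) \<otimes> y = y" ..
    then have "c [^] i \<otimes> (inv y \<otimes> c [^] j) = \<one>" using yc by simp
    then have "inv (c [^] i) \<otimes> (c [^] i \<otimes> (inv y \<otimes> c [^] j)) = inv (c [^] i)" by simp
    then have "inv y \<otimes> c [^] j = inv (c [^] i)" using yc by (simp add: inv_mult_cancel)
    then have "inv y = inv (c [^] i) \<otimes> inv (c [^] j)" using yc by (simp add: inv_solve_right)
    then have "inv y \<in> cyc c"
      using cyc_m_closed[OF c] cyc_inv_closed[OF c] pow_mem_cyc[OF c] by simp
    then show False using inv_out[OF y] by (simp add: out_def)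
  qed
  moreover have "cyc c <#> cyc ?c \<subseteq> carrier G"
    using c' by (intro set_mult_closed cyc_subset c)
  ultimately have "cyc c <#> cyc ?c \<subset> carrier G" using yc by blast
  then have "card (cyc c <#> cyc ?c) < n * m" using psubset_card_mono[OF finite_carrier] card_G by simp
  moreover have D0: "0 < card ?D"
    using subgroup.one_closed[OF sub] finite_cyc[OF c] by (auto simp: card_gt_0_iff)
  ultimately have "card (cyc c <#> cyc ?c) * card ?D < n * m * card ?D" by simp
  from le_less_trans[OF card_mult_le_card_Int[OF subgroup_cyc[OF c] subgroup_cyc[OF c']] this]
  have "n * n < n * (m * card ?D)" by (simp only: card_cyc[OF c] card_cyc[OF c'] ord' mult.assoc)
  then have lt: "n < m * card ?D" by simp
  \<comment> \<open>The index \<open>d\<close> of the intersection in \<open>cyc c\<close> divides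
    \<open>n\<close> and is below \<open>m\<close>, so \<open>m_le\<close> leaves only
    \<open>d = 1\<close>.\<close>
  have "card ?D dvd n" using card_subgroup_dvd[OF sub subgroup_cyc[OF c]] card_cyc[OF c] by simp
  then obtain d where d: "n = card ?D * d" by blast
  then have "d < m" using lt by (simp add: mult.commute)
  moreover have "d dvd n" "d \<noteq> 0" using d n_pos by (metis dvd_triv_right, intro notI) simp
  ultimately have "d = 1" using m_le[of d] by linarith
  then have "card ?D = card (cyc c)" using d card_cyc[OF c] by simp
  then have "?D = cyc c" by (intro card_subset_eq finite_cyc c) auto
  moreover have "card (cyc ?c) = card (cyc c)" using card_cyc[OF c] card_cyc[OF c'] ord' by simp
  ultimately have "cyc c = cyc ?c" using card_subset_eq[OF finite_cyc[OF c'], of "cyc c"] by (metis Int_lower2)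
  then show ?thesis using cyc_self by simp
qed

lemma ex_conj_exponent:
  assumes m_le: "\<And>d. d dvd n \<Longrightarrow> 1 < d \<Longrightarrow> m \<le> d" and y: "y \<in> out"
  obtains r where "r < n" "y \<otimes> c = c [^] r \<otimes> y"
proof -
  have yc: "y \<in> carrier G" using y by simp
  have "inv (inv y) \<otimes> c \<otimes> inv y \<in> cyc c" by (rule conj_mem_cyc[OF m_le inv_out[OF y]])
  then have "y \<otimes> c \<otimes> inv y \<in> cyc c" using yc by simp
  then obtain r where r: "r < n" "y \<otimes> c \<otimes> inv y = c [^] r" by (rule mem_cycE[OF _ c])
  have "y \<otimes> c = c [^] r \<otimes> y"
    using r(2)[symmetric] yc by (subst (asm) inv_solve_right) simp_all
  with r(1) show ?thesis by (rule that)
qed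

text \<open>The hypothesis makes \<open>cyc c\<close> normal, so the quotient has order
  \<open>m\<close> and kills \<open>m\<close>-th powers.\<close>

lemma pow_m_mem_cyc:
  assumes m_le: "\<And>d. d dvd n \<Longrightarrow> 1 < d \<Longrightarrow> m \<le> d" and y: "y \<in> out"
  shows "y [^] m \<in> cyc c"
proof -
  have normal: "cyc c \<lhd> G"
  proof (rule normal_invI[OF subgroup_cyc[OF c]])
    fix x h assume x: "x \<in> carrier G" and h: "h \<in> cyc c"
    show "x \<otimes> h \<otimes> inv x \<in> cyc c"
    proof (cases "x \<in> cyc c")
      case True
      then show ?thesis using h subgroup_cyc[OF c] by (simp add: cyc_m_closed cyc_inv_closed True)
    next
      case False
      obtain r where r: "x \<otimes> c = c [^] (r::nat) \<otimes> x"
        by (rule ex_conj_exponent[OF m_le outI[OF x False]])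
      obtain i where i: "h = c [^] (i::nat)" by (rule mem_cycE[OF h c])
      have "x \<otimes> h \<otimes> inv x = c [^] (r * i) \<otimes> x \<otimes> inv x"
        unfolding i using power_conj[OF c x r] by simp
      then show ?thesis using x pow_mem_cyc[OF c] by (simp add: m_assoc)
    qed
  qed
  interpret C: normal "cyc c" G by (rule normal)
  interpret Q: group "G Mod cyc c" by (rule C.factorgroup_is_group)
  have "order (G Mod cyc c) * n = n * m"
    using lagrange[OF subgroup_cyc[OF c]] card_cyc[OF c] card_G by (simp add: order_def FactGroup_def)
  then have "order (G Mod cyc c) = m" by simp
  then have "(cyc c #> y) [^]\<^bsub>G Mod cyc c\<^esub> m = \<one>\<^bsub>G Mod cyc c\<^esub>"
    using Q.pow_order_eq_1[of "cyc c #> y"] y by (auto simp: carrier_FactGroup)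
  then have "cyc c #> (y [^] m) = cyc c" using C.FactGroup_pow[of y m] y by simp
  then show ?thesis using y by (intro coset_join1[OF _ _ subgroup_cyc[OF c]]) simp_all
qed

text \<open>By Bezout \<open>d * u = m * v + 1\<close>, so \<open>y\<close> would be a product of
  elements of \<open>cyc c\<close>.\<close>

lemma pow_not_mem_cyc:
  assumes "y \<in> out" "y [^] m \<in> cyc c" "prime m" "0 < d" "d < m"
  shows "y [^] d \<notin> cyc c"
proof
  assume d: "y [^] d \<in> cyc c"
  have yc: "y \<in> carrier G" using assms by simp
  have "coprime d m" using assms by (metis coprime_commute nat_dvd_not_less prime_imp_coprime)
  then obtain u v where uv: "d * u = m * v + 1"
    using bezout_nat[of d m] assms by (metis coprime_iff_gcd_eq_1 less_numeral_extra(3))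
  have "(y [^] d) [^] u = (y [^] m) [^] v \<otimes> y"
    using yc by (simp add: nat_pow_pow uv)
  then have "inv ((y [^] m) [^] v) \<otimes> (y [^] d) [^] u = y" using yc by (simp flip: m_assoc)
  moreover have "z [^] (i::nat) \<in> cyc c" if "z \<in> cyc c" for z i
    using that subgroup_cyc[OF c] cyc_subset[OF c] by (metis cyc_minimal pow_mem_cyc subsetD)
  ultimately have "y \<in> cyc c"
    using d assms(2) cyc_m_closed[OF c] cyc_inv_closed[OF c] by metis
  then show False using assms by (simp add: out_def)
qed

text \<open>The products with \<open>i < n\<close> and \<open>j < m\<close> are pairwise distinct,
  and there are as many of them as elements of \<open>G\<close>.\<close>

lemma normal_form:
  assumes y: "y \<in> out" "y [^] m \<in> cyc c" "prime m" and g: "g \<in> carrier G"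
  shows "\<exists>i<n. \<exists>j<m. g = c [^] i \<otimes> y [^] j"
proof -
  have yc: "y \<in> carrier G" using y by simp
  let ?f = "\<lambda>(i, j). c [^] (i::nat) \<otimes> y [^] (j::nat)"
  have eq: "j = j'" if "j < m" "j' \<le> j" "c [^] (i::nat) \<otimes> y [^] j = c [^] (i'::nat) \<otimes> y [^] j'" for i j i' j'
  proof (rule ccontr)
    assume "j \<noteq> j'"
    then have d: "0 < j - j'" "j - j' < m" using that by auto
    have "y [^] j = y [^] (j - j') \<otimes> y [^] j'" using that yc by (simp add: nat_pow_mult)
    then have "c [^] i \<otimes> y [^] (j - j') = c [^] i'"
      using that(3) yc by (simp add: m_assoc[symmetric])
    then have "y [^] (j - j') = inv (c [^] i) \<otimes> c [^] i'"
      using yc by (metis c inv_solve_left nat_pow_closed)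
    then have "y [^] (j - j') \<in> cyc c"
      using cyc_m_closed[OF c] cyc_inv_closed[OF c] pow_mem_cyc[OF c] by simp
    then show False using pow_not_mem_cyc[OF y d] by simp
  qed
  have "inj_on ?f ({..<n} \<times> {..<m})"
  proof (rule inj_onI, clarsimp)
    fix i j i' j' assume b: "i < n" "j < m" "i' < n" "j' < m" and e: "c [^] i \<otimes> y [^] j = c [^] i' \<otimes> y [^] j'"
    have "j = j'"
    proof (cases "j' \<le> j")
      case True
      then show ?thesis using eq[of j j' i i'] b e by simp
    next
      case False
      then show ?thesis using eq[of j' j i' i] b e by simp
    qed
    moreover from this have "c [^] i = c [^] i'" using e yc by simp
    then have "[i = i'] (mod n)" using pow_eq_iff_cong by simp
    ultimately show "i = i' \<and> j = j'" using b by (simp add: cong_def)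
  qed
  moreover have "?f ` ({..<n} \<times> {..<m}) \<subseteq> carrier G" using yc by auto
  moreover have "card ({..<n} \<times> {..<m}) = card (carrier G)" using card_G by (simp add: card_cartesian_product)
  ultimately have "?f ` ({..<n} \<times> {..<m}) = carrier G"
    by (metis card_image card_subset_eq finite_carrier)
  then have "g \<in> ?f ` ({..<n} \<times> {..<m})" using g by simp
  then show ?thesis by auto
qed

end

lemma exponent_cong_one:
  fixes r :: nat
  assumes "[r * m = m] (mod k * m)" "m > 0" "k > 1"
  shows "r = 1 + k * (r div k)"
proof -
  have "(r mod k) * m = (r * m) mod (k * m)" by (simp only: mod_mult_mult2)
  also have "\<dots> = (1 * m) mod (k * m)" using assms(1) by (simp add: cong_def)
  also have "\<dots> = (1 mod k) * m" by (simp only: mod_mult_mult2)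
  finally have "r mod k = 1" using assms by simp
  then show ?thesis using mult_div_mod_eq[of k r] by simp
qed

context max_cyclic
begin

text \<open>In the cyclic group \<open>cyc c\<close> the elements \<open>y [^] m\<close> and
  \<open>c [^] m\<close> generate the same subgroup, so \<open>y\<close> centralises
  \<open>c [^] m\<close> and \<open>r * m\<close> is congruent to \<open>m\<close> modulo
  \<open>n\<close>. Hypothesis \<open>num\<close> then supplies an \<open>i\<close> for which
  \<open>c [^] i \<otimes> y\<close> has trivial \<open>m\<close>-th power.\<close>

lemma ex_ord_m_out:
  assumes m_le: "\<And>d. d dvd n \<Longrightarrow> 1 < d \<Longrightarrow> m \<le> d" and mp: "prime m" and mn: "m dvd n"
    and y: "y \<in> out" "ord y = n"
    and num: "\<And>r u. [r * m = m] (mod n) \<Longrightarrow> \<exists>i. n dvd i * (\<Sum>t<m. r ^ t) + m * u"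
  shows "\<exists>x\<in>out. ord x = m"
proof -
  have yc: "y \<in> carrier G" using y by simp
  have m0: "m \<noteq> 0" using m by simp
  obtain r where r: "y \<otimes> c = c [^] (r::nat) \<otimes> y" by (rule ex_conj_exponent[OF m_le y(1)])
  have ym: "y [^] m \<in> cyc c" by (rule pow_m_mem_cyc[OF m_le y(1)])
  have "ord (y [^] m) = ord (c [^] m)"
    using ord_pow[OF yc _ m0] ord_pow[OF c _ m0] y mn by simp
  then have eq: "cyc (y [^] m) = cyc (c [^] m)"
    by (rule unique_subgroup_of_cyc[OF c ym pow_mem_cyc[OF c]])
  have "y [^] m \<in> cyc (c [^] m)" using cyc_self[of "y [^] m"] by (simp only: eq)
  then obtain u where u: "y [^] m = (c [^] m) [^] (u::nat)" by (rule mem_cycE) simp_all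
  have "c [^] m \<in> cyc (y [^] m)" using cyc_self[of "c [^] m"] by (simp only: eq)
  then obtain v where v: "c [^] m = (y [^] m) [^] (v::nat)" by (rule mem_cycE) (use yc in simp_all)
  then have v': "c [^] m = y [^] (m * v)" using yc by (simp add: nat_pow_pow)
  have "y \<otimes> y [^] k = y [^] k \<otimes> y" for k :: nat
    using nat_pow_comm[OF yc, of 1 k] yc by simp
  then have "y \<otimes> c [^] m = c [^] m \<otimes> y" by (simp only: v')
  then have "c [^] (r * m) = c [^] m" using power_conj[OF c yc r, of m] yc by simp
  then have "[r * m = m] (mod n)" by (simp add: pow_eq_iff_cong)
  from num[OF this] obtain i where i: "n dvd i * (\<Sum>t<m. r ^ t) + m * u" by blast
  let ?x = "c [^] i \<otimes> y"
  have xo: "?x \<in> out" by (rule mult_out[OF y(1)])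
  have "?x [^] m = c [^] (i * (\<Sum>t<m. r ^ t)) \<otimes> c [^] (m * u)"
    using power_mult_pow[OF c yc r, of i m] by (simp add: u nat_pow_pow)
  also have "\<dots> = c [^] (i * (\<Sum>t<m. r ^ t) + m * u)" by (simp add: nat_pow_mult)
  also have "\<dots> = \<one>" using i by (simp add: pow_eq_id)
  finally have "ord ?x dvd m" using xo by (simp add: pow_eq_id)
  moreover have "ord ?x \<noteq> 1"
    using xo subgroup.one_closed[OF subgroup_cyc[OF c]] ord_eq_1[of ?x] by (auto simp: out_def)
  ultimately have "ord ?x = m" using mp by (auto simp: prime_nat_iff)
  then show ?thesis using xo by blast
qed

lemma comm_group_of_commute:
  assumes y: "y \<in> out" "y [^] m \<in> cyc c" "prime m" and yc: "y \<otimes> c = c \<otimes> y"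
  shows "comm_group G"
proof (rule group.group_comm_groupI[OF is_group])
  fix a b assume a: "a \<in> carrier G" and b: "b \<in> carrier G"
  have y': "y \<in> carrier G" using y by simp
  have rel: "y \<otimes> c = c [^] (1::nat) \<otimes> y" using yc by simp
  have pc: "y [^] (j::nat) \<otimes> c [^] (i::nat) = c [^] i \<otimes> y [^] j" for i j
    using power_conj_power[OF c y' rel, of j i] by simp
  obtain i j where ij: "a = c [^] (i::nat) \<otimes> y [^] (j::nat)" using normal_form[OF y a] by blast
  obtain i' j' where ij': "b = c [^] (i'::nat) \<otimes> y [^] (j'::nat)" using normal_form[OF y b] by blast
  have mul: "(c [^] (i::nat) \<otimes> y [^] (j::nat)) \<otimes> (c [^] (i'::nat) \<otimes> y [^] (j'::nat)) = c [^] (i + i') \<otimes> y [^] (j + j')"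
    for i j i' j'
  proof -
    have "(c [^] i \<otimes> y [^] j) \<otimes> (c [^] i' \<otimes> y [^] j') = c [^] i \<otimes> (y [^] j \<otimes> c [^] i') \<otimes> y [^] j'"
      using y' by (simp add: m_assoc)
    also have "\<dots> = (c [^] i \<otimes> c [^] i') \<otimes> (y [^] j \<otimes> y [^] j')" using y' by (simp add: pc m_assoc)
    finally show ?thesis using y' by (simp add: nat_pow_mult)
  qed
  show "a \<otimes> b = b \<otimes> a" unfolding ij ij' mul by (simp add: add.commute)
qed

end

section \<open>Excluding candidate pairs and identifying the surviving groups\<close>

context eight_cyclic
begin

lemma not_order_16_index_2:
  assumes "n = 16" "m = 2" "N 16 = 1" "N 2 = 0"
  shows False
proof -
  obtain y where y: "y \<in> out" "ord y = 16" using N_pos_iff[of 16] assms by auto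
  have "\<exists>x\<in>out. ord x = m"
  proof (rule ex_ord_m_out[OF _ _ _ y(1)])
    fix r u assume "[r * m = m] (mod n)"
    then have "r = 1 + 8 * (r div 8)" using exponent_cong_one[of r 2 8] assms by simp
    then obtain w where w: "r = 1 + 8 * w" by blast
    \<comment> \<open>The sum is \<open>2 * (1 + 4 * w)\<close>, so \<open>i * (1 + 4 * w)\<close>
      must be \<open>- u\<close> modulo 8. There 7 is -1, and \<open>1 + 4 * w\<close> is its own
      inverse.\<close>
    have "7 * u * (1 + 4 * w) * (\<Sum>t<m. r ^ t) + m * u = 16 * (u + 7 * u * w + 14 * u * w * w)"
      using assms w by (simp add: numeral_2_eq_2 algebra_simps)
    then show "\<exists>i. n dvd i * (\<Sum>t<m. r ^ t) + m * u" using assms by (metis dvd_triv_left)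
  qed (use y assms in auto)
  then show False using N_pos_iff[of 2] assms by auto
qed

lemma not_order_32_index_2:
  assumes "n = 32" "m = 2" "ord ` out \<subseteq> {32}"
  shows False
proof -
  obtain y where y: "y \<in> out" "ord y = 32" using out_nonempty assms by auto
  have "\<exists>x\<in>out. ord x = m"
  proof (rule ex_ord_m_out[OF _ _ _ y(1)])
    fix r u assume "[r * m = m] (mod n)"
    then have "r = 1 + 16 * (r div 16)" using exponent_cong_one[of r 2 16] assms by simp
    then obtain w where w: "r = 1 + 16 * w" by blast
    \<comment> \<open>As for order 16, now modulo 16: 15 is -1 and \<open>1 + 8 * w\<close> is its
      own inverse.\<close>
    have "15 * u * (1 + 8 * w) * (\<Sum>t<m. r ^ t) + m * u = 32 * (u + 15 * u * w + 60 * u * w * w)"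
      using assms w by (simp add: numeral_2_eq_2 algebra_simps)
    then show "\<exists>i. n dvd i * (\<Sum>t<m. r ^ t) + m * u" using assms by (metis dvd_triv_left)
  qed (use y assms in auto)
  then show False using assms by auto
qed

lemma not_order_81_index_3:
  assumes "n = 81" "m = 3" "ord ` out \<subseteq> {81}"
  shows False
proof -
  obtain y where y: "y \<in> out" "ord y = 81" using out_nonempty assms by auto
  have "\<exists>x\<in>out. ord x = m"
  proof (rule ex_ord_m_out[OF _ _ _ y(1)])
    fix d assume "d dvd n" "1 < d"
    moreover from this have "d \<noteq> 2" using assms by auto
    ultimately show "m \<le> d" using assms by simp
  next
    fix r u assume "[r * m = m] (mod n)"
    then have "r = 1 + 27 * (r div 27)" using exponent_cong_one[of r 3 27] assms by simp
    then obtain w where w: "r = 1 + 27 * w" by blast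
    \<comment> \<open>The sum is 3 modulo 81, so \<open>i\<close> must be \<open>- u\<close> modulo
      27.\<close>
    have "26 * u * (\<Sum>t<m. r ^ t) + m * u = 81 * (u + 26 * u * w + 234 * u * w * w)"
      using assms w by (simp add: numeral_3_eq_3 algebra_simps)
    then show "\<exists>i. n dvd i * (\<Sum>t<m. r ^ t) + m * u" using assms by (metis dvd_triv_left)
  qed (use y assms in auto)
  then show False using assms by auto
qed

lemma not_order_25_index_5:
  assumes "n = 25" "m = 5" "ord ` out \<subseteq> {25}"
  shows False
proof -
  obtain y where y: "y \<in> out" "ord y = 25" using out_nonempty assms by auto
  have "\<exists>x\<in>out. ord x = m"
  proof (rule ex_ord_m_out[OF _ _ _ y(1)])
    fix d assume d: "d dvd n" "1 < d"
    then have "d dvd 5 ^ 2" using assms by simp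
    then obtain i where "d = 5 ^ i" using divides_primepow_nat[of 5 d 2] by auto
    then show "m \<le> d" using d assms by (cases i) auto
  next
    fix r u assume "[r * m = m] (mod n)"
    then have "r = 1 + 5 * (r div 5)" using exponent_cong_one[of r 5 5] assms by simp
    then obtain w where w: "r = 1 + 5 * w" by blast
    \<comment> \<open>The sum turns out to be 5 modulo 25, so \<open>i\<close> must be
      \<open>- u\<close> modulo 5, which \<open>4 * u\<close> is.\<close>
    have "(\<Sum>t<m. r ^ t) = 1 + r + r * r + r * r * r + r * r * r * r"
      using assms by (simp add: eval_nat_numeral lessThan_Suc)
    also have "\<dots> = 5 + 25 * (2 * w + 10 * w * w + 25 * w * w * w + 25 * w * w * w * w)"
      unfolding w by (simp add: algebra_simps)
    finally have "4 * u * (\<Sum>t<m. r ^ t) + m * u =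
        25 * (u + 4 * u * (2 * w + 10 * w * w + 25 * w * w * w + 25 * w * w * w * w))"
      using assms by (simp add: algebra_simps)
    then show "\<exists>i. n dvd i * (\<Sum>t<m. r ^ t) + m * u" using assms by (metis dvd_triv_left)
  qed (use y assms in auto)
  then show False using assms by auto
qed

lemma not_order_8_index_3:
  assumes "n = 8" "m = 3" "N 3 = 0"
  shows False
proof -
  obtain x where x: "x \<in> carrier G" "ord x = 3"
    by (rule cauchy[of 3]) (use card_G assms in simp_all)
  have "x \<notin> cyc c" using ord_dvd_of_mem_cyc[OF c, of x] x assms by auto
  then have "x \<in> out" using x by (simp add: out_def)
  then show False using N_pos_iff[of 3] x assms by auto
qed

lemma not_order_3_index_5:
  assumes "n = 3" "m = 5"
  shows False
proof -
  obtain x where x: "x \<in> carrier G" "ord x = 5"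
    by (rule cauchy[of 5]) (use card_G assms in simp_all)
  then show False using maximal[of x] assms by (simp add: totient_values)
qed

text \<open>Two cyclic subgroups of order 4 in a group of order 12 cannot meet trivially, so
  \<open>cyc c\<close> and its conjugate by an element \<open>z\<close> of order 3 share their
  involution. Hence \<open>z\<close> commutes with the square of \<open>c\<close>, and their product
  has order 6: as many generators as order 4, but larger.\<close>

lemma not_order_4_index_3:
  assumes nm: "n = 4" "m = 3"
  shows False
proof -
  obtain z where z: "z \<in> carrier G" "ord z = 3"
    by (rule cauchy[of 3]) (use card_G assms in simp_all)
  let ?c = "inv z \<otimes> c \<otimes> z"
  have c': "?c \<in> carrier G" using z by simp
  have rel: "z \<otimes> ?c = c \<otimes> z" using z by (simp add: m_assoc mult_inv_cancel)
  have pow': "z \<otimes> ?c [^] (i::nat) = c [^] i \<otimes> z" for i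
    by (rule pow_intertwine[OF c' c z(1) rel])
  have ord': "ord ?c = 4"
  proof -
    have "?c [^] k = \<one> \<longleftrightarrow> c [^] k = \<one>" for k :: nat
    proof
      assume "?c [^] k = \<one>"
      then show "c [^] k = \<one>" using pow'[of k] z by simp
    next
      assume "c [^] k = \<one>"
      then have "z \<otimes> ?c [^] k = z" using pow'[of k] z by simp
      then show "?c [^] k = \<one>" using c' z l_cancel_one[of z "?c [^] k"] by simp
    qed
    then show ?thesis using nm c' by (simp add: ord_unique pow_eq_id)
  qed
  let ?D = "cyc c \<inter> cyc ?c"
  have sub: "subgroup ?D G" using c' by (intro subgroups_Inter_pair subgroup_cyc c)
  have "card (cyc c) * card (cyc ?c) \<le> card (carrier G) * card ?D"
    by (rule card_le_card_Int[OF subgroup_cyc[OF c] subgroup_cyc[OF c']])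
  then have "16 \<le> 12 * card ?D" using card_cyc[OF c] card_cyc[OF c'] ord' card_G nm by simp
  then have "card ?D > card {\<one>}" by simp
  then have "\<not> ?D \<subseteq> {\<one>}" using card_mono[of "{\<one>}" ?D] by auto
  then obtain w where w: "w \<in> cyc c" "w \<in> cyc ?c" "w \<noteq> \<one>" by blast
  have sq: "w = g [^] (2::nat) \<or> w [^] (2::nat) = g [^] (2::nat)" if g: "g \<in> carrier G" "ord g = 4" "w \<in> cyc g" for g
  proof -
    obtain i where i: "i < 4" "w = g [^] (i::nat)" using mem_cycE[OF g(3,1)] g(2) by auto
    have "i \<noteq> 0" using i w(3) by (intro notI) simp
    then consider "i = 1" | "i = 2" | "i = 3" using i by linarith
    then show ?thesis
    proof cases
      case 3
      have "[3 * 2 = 2] (mod ord g)" using g by (simp add: cong_def)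
      then have "g [^] (3 * 2 :: nat) = g [^] (2::nat)" using pow_eq_iff_cong[OF g(1)] by blast
      then show ?thesis using i 3 g by (simp add: nat_pow_pow)
    qed (use i g in simp_all)
  qed
  have w2: "w [^] (2::nat) = \<one> \<longleftrightarrow> w = g [^] (2::nat)" if g: "g \<in> carrier G" "ord g = 4" "w \<in> cyc g" for g
  proof
    assume "w = g [^] (2::nat)"
    then have "w [^] (2::nat) = g [^] (4::nat)" using g by (simp add: nat_pow_pow)
    then show "w [^] (2::nat) = \<one>" using g by (simp add: pow_eq_id)
  next
    assume w1: "w [^] (2::nat) = \<one>"
    have "g [^] (2::nat) \<noteq> \<one>" using g by (simp add: pow_eq_id)
    then show "w = g [^] (2::nat)" using sq[OF g] w1 by auto
  qed
  \<comment> \<open>If \<open>w\<close> is an involution, both squares equal \<open>w\<close>;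
    otherwise both equal its square.\<close>
  have "?c [^] (2::nat) = c [^] (2::nat)"
    using sq[OF c' ord' w(2)] sq[OF c _ w(1)] w2[OF c' ord' w(2)] w2[OF c _ w(1)] nm by auto
  then have com: "z \<otimes> c [^] (2::nat) = c [^] (2::nat) \<otimes> z" using pow'[of 2] by simp
  let ?x = "c [^] (2::nat) \<otimes> z"
  have xc: "?x \<in> carrier G" using z by simp
  have rel2: "z \<otimes> c [^] (2::nat) = (c [^] (2::nat)) [^] (1::nat) \<otimes> z" using com by simp
  have xp: "?x [^] (k::nat) = c [^] (2 * k) \<otimes> z [^] k" for k
    using power_mult_pow[OF _ z(1) rel2, of 1 k] z by (simp add: nat_pow_pow)
  have "c [^] (4::nat) = \<one>" "c [^] (6::nat) = c [^] (2::nat)" "c [^] (12::nat) = \<one>"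
    "c [^] (2::nat) \<noteq> \<one>"
    using pow_eq_iff_cong[OF c, of 6 2] nm by (simp_all add: pow_eq_id cong_def)
  moreover have "z [^] (3::nat) = \<one>" "z [^] (6::nat) = \<one>" "z [^] (2::nat) \<noteq> \<one>"
    using z by (simp_all add: pow_eq_id)
  ultimately have "?x [^] (6::nat) = \<one>" "?x [^] (3::nat) \<noteq> \<one>" "?x [^] (2::nat) \<noteq> \<one>"
    using z by (simp_all add: xp)
  then have "ord ?x dvd 6" "\<not> ord ?x dvd 3" "\<not> ord ?x dvd 2" using xc by (simp_all add: pow_eq_id)
  moreover have "d = 6" if "d dvd 6" "\<not> d dvd 3" "\<not> d dvd 2" for d :: nat
  proof -
    have "d \<le> 6" using that by (auto intro: dvd_imp_le)
    then consider "d = 0" | "d = 1" | "d = 2" | "d = 3" | "d = 4" | "d = 5" | "d = 6" by linarith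
    then show ?thesis using that by cases auto
  qed
  ultimately have "ord ?x = 6" by blast
  then show False using maximal[OF xc] nm by (simp add: totient_values)
qed

text \<open>In the first pattern an outside involution \<open>t\<close> splits the extension, and an
  outside element of order 8 centralises the square of \<open>c\<close>, which leaves
  \<open>r\<close> equal to 1 or 5. In the second every outside element squares to c^4; comparing
  \<open>y\<close> with \<open>c \<otimes> y\<close> makes \<open>y\<close> invert \<open>c\<close>,
  the generalized quaternion group.\<close>

lemma metacyclic_if_order_8_index_2:
  assumes nm: "n = 8" "m = 2" and o: "ord ` out \<subseteq> {2, 4, 8}"
    and N: "N 8 = 1 \<and> N 2 = 2 \<or> N 8 = 0 \<and> N 2 = 0"
  shows "metacyclic 8 2 1 0 \<cong> G \<or> metacyclic 8 2 5 0 \<cong> G \<or> metacyclic 8 2 7 4 \<cong> G"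
proof -
  have m_le: "\<And>d. d dvd n \<Longrightarrow> 1 < d \<Longrightarrow> m \<le> d" using nm by auto
  have mp: "prime m" using nm by simp
  have c8: "c [^] (8::nat) = \<one>" using nm by (simp add: pow_eq_id)
  have card: "card (carrier G) = 8 * 2" using card_G nm by simp
  have nf: "\<exists>i<n. \<exists>j<m. g = c [^] (i::nat) \<otimes> y [^] (j::nat)" if "y \<in> out" "g \<in> carrier G" for y g
    by (rule normal_form[OF that(1) pow_m_mem_cyc[OF m_le that(1)] mp that(2)])
  from N show ?thesis
  proof
    assume N: "N 8 = 1 \<and> N 2 = 2"
    obtain z where z: "z \<in> out" "ord z = 8" using N_pos_iff[of 8] N by auto
    obtain t where t: "t \<in> out" "ord t = 2" using N_pos_iff[of 2] N by auto
    have zc: "z \<in> carrier G" and tc: "t \<in> carrier G" using z t by simp_all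
    obtain r where r: "r < n" "t \<otimes> c = c [^] (r::nat) \<otimes> t" by (rule ex_conj_exponent[OF m_le t(1)])
    obtain i j where ij: "j < m" "z = c [^] (i::nat) \<otimes> t [^] (j::nat)" using nf[OF t(1) zc] by blast
    have "j \<noteq> 0" using ij z pow_mem_cyc[OF c, of i] by (intro notI) (simp add: out_def)
    then have z': "z = c [^] i \<otimes> t" using ij nm tc by (cases "j = 1") auto
    have "z \<otimes> c = c [^] i \<otimes> (t \<otimes> c)" using tc by (simp add: z' m_assoc)
    also have "\<dots> = c [^] i \<otimes> c [^] r \<otimes> t" using tc by (simp add: r(2) m_assoc)
    also have "\<dots> = c [^] r \<otimes> c [^] i \<otimes> t" using tc by (simp add: nat_pow_mult add.commute)
    also have "\<dots> = c [^] r \<otimes> z" using tc by (simp add: z' m_assoc)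
    finally have zr: "z \<otimes> c = c [^] r \<otimes> z" .
    have "z [^] m \<in> cyc c" by (rule pow_m_mem_cyc[OF m_le z(1)])
    then have z2: "z [^] (2::nat) \<in> cyc c" using nm by simp
    have "ord (z [^] (2::nat)) = ord (c [^] (2::nat))"
      using ord_pow[OF zc, of 2] ord_pow[OF c, of 2] z nm by simp
    then have "cyc (z [^] (2::nat)) = cyc (c [^] (2::nat))"
      by (rule unique_subgroup_of_cyc[OF c z2 pow_mem_cyc[OF c]])
    then have "c [^] (2::nat) \<in> cyc (z [^] (2::nat))" using cyc_self[of "c [^] (2::nat)"] by simp
    then obtain v where "c [^] (2::nat) = (z [^] (2::nat)) [^] (v::nat)" by (rule mem_cycE) (use zc in simp_all)
    then have v: "c [^] (2::nat) = z [^] (2 * v)" using zc by (simp add: nat_pow_pow)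
    have "z \<otimes> z [^] k = z [^] k \<otimes> z" for k :: nat using nat_pow_comm[OF zc, of 1 k] zc by simp
    then have "z \<otimes> c [^] (2::nat) = c [^] (2::nat) \<otimes> z" by (simp only: v)
    then have "c [^] (r * 2) = c [^] (2::nat)" using power_conj[OF c zc zr, of 2] zc by simp
    then have "[r * 2 = 2] (mod 4 * 2)" using pow_eq_iff_cong[OF c] nm by simp
    then have "r = 1 + 4 * (r div 4)" by (rule exponent_cong_one) simp_all
    then have "r = 1 \<or> r = 5" using r(1) nm by presburger
    moreover have "metacyclic 8 2 r 0 \<cong> G"
    proof (rule metacyclic_iso[OF c tc r(2) c8])
      show "t [^] (2::nat) = c [^] (0::nat)" using t by (simp add: pow_eq_id)
      show "\<exists>i<8. \<exists>j<2. g = c [^] (i::nat) \<otimes> t [^] (j::nat)" if "g \<in> carrier G" for g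
        using nf[OF t(1) that] nm by simp
    qed (rule card)
    ultimately show ?thesis by auto
  next
    assume N: "N 8 = 0 \<and> N 2 = 0"
    have o4: "ord x = 4" if "x \<in> out" for x
    proof -
      have "ord x \<noteq> 2" "ord x \<noteq> 8" using N_pos_iff[of 2] N_pos_iff[of 8] N that by auto
      then show ?thesis using o that by auto
    qed
    \<comment> \<open>The square lies in \<open>cyc c\<close> and has order 2, and c^4 is the only
      involution there.\<close>
    have sq: "x [^] (2::nat) = c [^] (4::nat)" if x: "x \<in> out" for x
    proof -
      have xc: "x \<in> carrier G" using x by simp
      have "x [^] m \<in> cyc c" by (rule pow_m_mem_cyc[OF m_le x])
      then obtain i where i: "i < n" "x [^] m = c [^] (i::nat)" by (rule mem_cycE[OF _ c])
      then have i: "i < 8" "x [^] (2::nat) = c [^] i" using nm by simp_all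
      have "c [^] (i * 2) = (x [^] (2::nat)) [^] (2::nat)" using nat_pow_pow[OF c, of i 2] i(2) by simp
      also have "\<dots> = x [^] (4::nat)" using nat_pow_pow[OF xc, of 2 2] by simp
      finally have "c [^] (i * 2) = x [^] (4::nat)" .
      then have "c [^] (i * 2) = \<one>" using o4[OF x] xc by (simp add: pow_eq_id)
      then have "8 dvd i * 2" using nm by (simp add: pow_eq_id)
      then have "i = 0 \<or> i = 4" using i(1) by presburger
      moreover have "x [^] (2::nat) \<noteq> \<one>" using o4[OF x] xc by (simp add: pow_eq_id)
      ultimately show ?thesis using i(2) by auto
    qed
    obtain y where y: "y \<in> out" using out_nonempty by blast
    then have yc: "y \<in> carrier G" by simp
    obtain r where r: "r < n" "y \<otimes> c = c [^] (r::nat) \<otimes> y" by (rule ex_conj_exponent[OF m_le y])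
    have "(c [^] (1::nat) \<otimes> y) [^] (2::nat) = c [^] (1 * (\<Sum>t<2. r ^ t)) \<otimes> y [^] (2::nat)"
      by (rule power_mult_pow[OF c yc r(2)])
    then have "c [^] (4::nat) = c [^] (1 + r) \<otimes> c [^] (4::nat)"
      using sq[OF mult_out[OF y, of 1]] sq[OF y] by (simp add: numeral_2_eq_2)
    then have "c [^] (1 + r) = \<one>" by simp
    then have "8 dvd 1 + r" using nm by (simp only: pow_eq_id c)
    then have r7: "r = 7" using r(1) nm by presburger
    have "metacyclic 8 2 7 4 \<cong> G"
    proof (rule metacyclic_iso[OF c yc r(2)[unfolded r7] c8 sq[OF y]])
      show "\<exists>i<8. \<exists>j<2. g = c [^] (i::nat) \<otimes> y [^] (j::nat)" if "g \<in> carrier G" for g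
        using nf[OF y that] nm by simp
    qed (rule card)
    then show ?thesis by simp
  qed
qed

text \<open>An outside element of order 3 splits the extension, and its action has
  \<open>r ^ 3 = 1\<close> modulo 9, so \<open>r\<close> is 1, 4 or 7. Replacing \<open>y\<close> by
  its square turns 7 into 49, which is 4 modulo 9.\<close>

lemma metacyclic_if_order_9_index_3:
  assumes nm: "n = 9" "m = 3" and N: "N 3 = 3"
  shows "metacyclic 9 3 1 0 \<cong> G \<or> metacyclic 9 3 4 0 \<cong> G"
proof -
  have m_le: "\<And>d. d dvd n \<Longrightarrow> 1 < d \<Longrightarrow> m \<le> d"
  proof -
    fix d assume "d dvd n" "1 < d"
    moreover from this have "d \<noteq> 2" using nm by auto
    ultimately show "m \<le> d" using nm by simp
  qed
  have mp: "prime m" using nm by simp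
  have c9: "c [^] (9::nat) = \<one>" using nm by (simp add: pow_eq_id)
  have card: "card (carrier G) = 9 * 3" using card_G nm by simp
  obtain y where y: "y \<in> out" "ord y = 3" using N_pos_iff[of 3] N by auto
  have yc: "y \<in> carrier G" using y by simp
  obtain r where r: "r < n" "y \<otimes> c = c [^] (r::nat) \<otimes> y" by (rule ex_conj_exponent[OF m_le y(1)])
  have y3: "y [^] (3::nat) = \<one>" using y yc by (simp add: pow_eq_id)
  have "c = c [^] (r ^ 3)" using power_conj_power[OF c yc r(2), of 3 1] by (simp add: y3)
  then have "[r ^ 3 = 1] (mod 9)" using pow_eq_iff_cong[OF c, of "r ^ 3" 1] nm by simp
  moreover have "r < 9" using r nm by simp
  then have "r = 0 \<or> r = 1 \<or> r = 2 \<or> r = 3 \<or> r = 4 \<or> r = 5 \<or> r = 6 \<or> r = 7 \<or> r = 8" by linarith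
  ultimately have r': "r = 1 \<or> r = 4 \<or> r = 7" by (auto simp: cong_def)
  have iso: "metacyclic 9 3 s 0 \<cong> G" if x: "x \<in> out" "x [^] (3::nat) = \<one>" "x \<otimes> c = c [^] (s::nat) \<otimes> x" for x s
  proof (rule metacyclic_iso[OF c _ x(3) c9])
    show "x \<in> carrier G" using x by simp
    show "x [^] (3::nat) = c [^] (0::nat)" using x by simp
    show "\<exists>i<9. \<exists>j<3. g = c [^] (i::nat) \<otimes> x [^] (j::nat)" if "g \<in> carrier G" for g
      using normal_form[OF x(1) pow_m_mem_cyc[OF m_le x(1)] mp that] nm by simp
  qed (rule card)
  show ?thesis
  proof (cases "r = 7")
    case True
    let ?x = "y [^] (2::nat)"
    have xc: "?x \<in> carrier G" using yc by simp
    have "?x \<notin> cyc c" using pow_not_mem_cyc[OF y(1) pow_m_mem_cyc[OF m_le y(1)] mp, of 2] nm by simp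
    then have "?x \<in> out" using xc by (simp add: out_def)
    moreover have "?x [^] (3::nat) = \<one>" using y yc by (simp add: nat_pow_pow pow_eq_id)
    moreover have "?x \<otimes> c = c [^] (4::nat) \<otimes> ?x"
    proof -
      have "?x \<otimes> c = c [^] (49::nat) \<otimes> ?x" using power_conj_power[OF c yc r(2), of 2 1] True by simp
      moreover have "c [^] (49::nat) = c [^] (4::nat)" using pow_eq_iff_cong[OF c, of 49 4] nm by (simp add: cong_def)
      ultimately show ?thesis by simp
    qed
    ultimately have "metacyclic 9 3 4 0 \<cong> G" by (rule iso)
    then show ?thesis ..
  next
    case False
    then show ?thesis using r' iso[OF y(1) y3 r(2)] by auto
  qed
qed

text \<open>The involution \<open>t\<close> acts by \<open>r = 1\<close> or \<open>r = 8\<close>. In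
  the first case \<open>c \<otimes> t\<close> has nontrivial sixth power, against the list of
  orders; in the second it is a further involution, against \<open>N 2 = 1\<close>.\<close>

lemma not_order_9_index_2:
  assumes nm: "n = 9" "m = 2" and N: "N 2 = 1" and o: "ord ` out \<subseteq> {2, 6}"
  shows False
proof -
  have m_le: "\<And>d. d dvd n \<Longrightarrow> 1 < d \<Longrightarrow> m \<le> d" using nm by auto
  obtain t where t: "t \<in> out" "ord t = 2" using N_pos_iff[of 2] N by auto
  have tc: "t \<in> carrier G" using t by simp
  have t2: "t [^] (2::nat) = \<one>" using t by (simp add: pow_eq_id)
  obtain r where r: "r < n" "t \<otimes> c = c [^] (r::nat) \<otimes> t" by (rule ex_conj_exponent[OF m_le t(1)])
  have "c = c [^] (r ^ 2)" using power_conj_power[OF c tc r(2), of 2 1] by (simp add: t2)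
  then have "[r ^ 2 = 1] (mod 9)" using pow_eq_iff_cong[OF c, of "r ^ 2" 1] nm by simp
  moreover have "r < 9" using r nm by simp
  then have "r = 0 \<or> r = 1 \<or> r = 2 \<or> r = 3 \<or> r = 4 \<or> r = 5 \<or> r = 6 \<or> r = 7 \<or> r = 8" by linarith
  ultimately have r': "r = 1 \<or> r = 8" by (auto simp: cong_def)
  define x where "x = c [^] (1::nat) \<otimes> t"
  have x: "x \<in> out" unfolding x_def by (rule mult_out[OF t(1)])
  then have xc: "x \<in> carrier G" by simp
  have "x [^] (2::nat) = c [^] (1 * (\<Sum>j<2. r ^ j)) \<otimes> t [^] (2::nat)"
    unfolding x_def by (rule power_mult_pow[OF c tc r(2)])
  also have "(\<Sum>j<2. r ^ j) = 1 + r" by (simp add: numeral_2_eq_2)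
  finally have x2: "x [^] (2::nat) = c [^] (1 + r)" by (simp only: t2 mult_1 r_one nat_pow_closed c)
  from r' show False
  proof
    assume "r = 1"
    then have xc2: "x [^] (2::nat) = c [^] (2::nat)" using x2 by (simp only: one_add_one)
    have "x [^] (6::nat) = (x [^] (2::nat)) [^] (3::nat)" using nat_pow_pow[OF xc, of 2 3] by simp
    also have "\<dots> = (c [^] (2::nat)) [^] (3::nat)" by (simp only: xc2)
    finally have "x [^] (6::nat) = (c [^] (2::nat)) [^] (3::nat)" .
    then have "x [^] (6::nat) \<noteq> \<one>" using nm by (simp add: nat_pow_pow pow_eq_id)
    then show False using o x xc by (auto simp: pow_eq_id)
  next
    assume "r = 8"
    then have "x [^] (2::nat) = \<one>" using x2 nm by (simp add: pow_eq_id)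
    then have "ord x dvd 2" using xc by (simp add: pow_eq_id)
    then have "ord x = 2" using o x by auto
    have "cyc x \<noteq> cyc t"
    proof
      assume "cyc x = cyc t"
      then have "x \<in> cyc t" using cyc_self[of x] by simp
      then obtain i where i: "i < ord t" "x = t [^] (i::nat)" by (rule mem_cycE[OF _ tc])
      then have "i = 0 \<or> i = 1" using t by auto
      then show False
      proof
        assume "i = 0"
        then have "x = \<one>" using i by simp
        then show False using \<open>ord x = 2\<close> by simp
      next
        assume "i = 1"
        then have "c \<otimes> t = t" using i tc by (simp add: x_def)
        then have "c = \<one>" using tc by simp
        then show False using nm by simp
      qed
    qed
    moreover have "cyc x \<in> {D \<in> cyc ` out. card D = 2}" "cyc t \<in> {D \<in> cyc ` out. card D = 2}"
      using x t \<open>ord x = 2\<close> card_cyc[OF xc] card_cyc[OF tc] by auto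
    moreover have "card {D \<in> cyc ` out. card D = 2} = 1" using N by (simp add: N_def)
    then obtain D where "{D \<in> cyc ` out. card D = 2} = {D}" by (rule card_1_singletonE)
    ultimately show False by (simp only: singleton_iff)
  qed
qed

text \<open>An outside element of order \<open>2 * q\<close> centralises the square of
  \<open>c\<close>, so \<open>r\<close> is 1 modulo \<open>q\<close>; it is also odd, as conjugation
  cannot kill \<open>c [^] q\<close>. In the alternative for \<open>q = 3\<close>, the action
  \<open>r = 5\<close> would be dihedral, where every element outside is an involution, against the
  element of order 4.\<close>

lemma comm_group_if_order_2q_index_2:
  assumes nm: "n = 2 * q" "m = 2" and q: "prime q" "2 < q"
    and N: "N (2 * q) > 0 \<or> q = 3 \<and> N 2 > 0 \<and> N 4 > 0"
  shows "comm_group G"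
proof -
  have m_le: "\<And>d. d dvd n \<Longrightarrow> 1 < d \<Longrightarrow> m \<le> d" using nm by auto
  have mp: "prime m" using nm by simp
  have comm: "comm_group G" if "y \<in> out" "y \<otimes> c = c \<otimes> y" for y
    by (rule comm_group_of_commute[OF that(1) pow_m_mem_cyc[OF m_le that(1)] mp that(2)])
  from N show ?thesis
  proof
    assume "N (2 * q) > 0"
    then obtain z where z: "z \<in> out" "ord z = n" using N_pos_iff nm by auto
    then have zc: "z \<in> carrier G" by simp
    obtain r where r: "r < n" "z \<otimes> c = c [^] (r::nat) \<otimes> z" by (rule ex_conj_exponent[OF m_le z(1)])
    have "z [^] m \<in> cyc c" by (rule pow_m_mem_cyc[OF m_le z(1)])
    then have z2: "z [^] (2::nat) \<in> cyc c" using nm by simp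
    have "ord (z [^] (2::nat)) = ord (c [^] (2::nat))"
      using ord_pow[OF zc, of 2] ord_pow[OF c, of 2] z nm by simp
    then have "cyc (z [^] (2::nat)) = cyc (c [^] (2::nat))"
      by (rule unique_subgroup_of_cyc[OF c z2 pow_mem_cyc[OF c]])
    then have "c [^] (2::nat) \<in> cyc (z [^] (2::nat))" using cyc_self[of "c [^] (2::nat)"] by simp
    then obtain v where "c [^] (2::nat) = (z [^] (2::nat)) [^] (v::nat)" by (rule mem_cycE) (use zc in simp_all)
    then have v: "c [^] (2::nat) = z [^] (2 * v)" using zc by (simp add: nat_pow_pow)
    have "z \<otimes> z [^] k = z [^] k \<otimes> z" for k :: nat using nat_pow_comm[OF zc, of 1 k] zc by simp
    then have "z \<otimes> c [^] (2::nat) = c [^] (2::nat) \<otimes> z" by (simp only: v)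
    then have "c [^] (r * 2) = c [^] (2::nat)" using power_conj[OF c zc r(2), of 2] zc by simp
    then have "[r * 2 = 2] (mod q * 2)" using pow_eq_iff_cong[OF c] nm by (simp add: mult.commute)
    then have rq: "r = 1 + q * (r div q)" by (rule exponent_cong_one) (use q in simp_all)
    moreover have "odd r"
    proof
      assume "even r"
      then obtain k where "r = 2 * k" by blast
      then have "r * q = n * k" using nm by simp
      then have "c [^] (r * q) = \<one>" by (simp add: pow_eq_id)
      then have "z \<otimes> c [^] q = z" using power_conj[OF c zc r(2), of q] zc by simp
      then have "c [^] q = \<one>" using zc by simp
      then have "n dvd q" by (simp add: pow_eq_id)
      then show False using nm q dvd_imp_le[of n q] by simp
    qed
    moreover have "r div q < 2" using r(1) nm by (simp add: less_mult_imp_div_less)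
    moreover have "odd q" using prime_odd_nat[OF q] by simp
    ultimately have "r div q = 0" by (cases "r div q = 1") auto
    then have "r = 1" using rq by simp
    then show ?thesis using comm[OF z(1)] r(2) by simp
  next
    assume N: "q = 3 \<and> N 2 > 0 \<and> N 4 > 0"
    then have n6: "n = 6" using nm by simp
    obtain t where t: "t \<in> out" "ord t = 2" using N_pos_iff[of 2] N by auto
    obtain z where z: "z \<in> out" "ord z = 4" using N_pos_iff[of 4] N by auto
    have tc: "t \<in> carrier G" and zc: "z \<in> carrier G" using t z by simp_all
    have t2: "t [^] (2::nat) = \<one>" using t by (simp add: pow_eq_id)
    obtain r where r: "r < n" "t \<otimes> c = c [^] (r::nat) \<otimes> t" by (rule ex_conj_exponent[OF m_le t(1)])
    have "c = c [^] (r ^ 2)" using power_conj_power[OF c tc r(2), of 2 1] by (simp add: t2)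
    then have "[r ^ 2 = 1] (mod 6)" using pow_eq_iff_cong[OF c, of "r ^ 2" 1] n6 by simp
    moreover have "r < 6" using r n6 by simp
    then have "r = 0 \<or> r = 1 \<or> r = 2 \<or> r = 3 \<or> r = 4 \<or> r = 5" by linarith
    ultimately have r': "r = 1 \<or> r = 5" by (auto simp: cong_def)
    have "r \<noteq> 5"
    proof
      assume r5: "r = 5"
      obtain i j where ij: "j < m" "z = c [^] (i::nat) \<otimes> t [^] (j::nat)"
        using normal_form[OF t(1) pow_m_mem_cyc[OF m_le t(1)] mp zc] by blast
      have "j \<noteq> 0" using ij z pow_mem_cyc[OF c, of i] by (intro notI) (simp add: out_def)
      then have z': "z = c [^] i \<otimes> t" using ij nm tc by (cases "j = 1") auto
      have "z [^] (2::nat) = c [^] (i * (\<Sum>j<2. r ^ j)) \<otimes> t [^] (2::nat)"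
        unfolding z' by (rule power_mult_pow[OF c tc r(2)])
      also have "(\<Sum>j<2. r ^ j) = 6" by (simp add: numeral_2_eq_2 r5)
      finally have "z [^] (2::nat) = c [^] (i * 6)" by (simp only: t2 r_one nat_pow_closed c)
      then have "z [^] (2::nat) = \<one>" using n6 by (simp add: pow_eq_id)
      then show False using z by (simp add: pow_eq_id)
    qed
    then have "r = 1" using r' by simp
    then show ?thesis using comm[OF t(1)] r(2) by simp
  qed
qed

end

section \<open>Recognising the elementary abelian group of order 8 and A_4\<close>

context finite_group
begin

lemma elementary_abelian_8:
  assumes card: "card (carrier G) = 8" and sq: "\<And>x. x \<in> carrier G \<Longrightarrow> x \<otimes> x = \<one>"
  shows "integer_mod_group 2 \<times>\<times> integer_mod_group 2 \<times>\<times> integer_mod_group 2 \<cong> G" (is "?Z \<cong> G")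
proof -
  have inv_self: "inv x = x" if "x \<in> carrier G" for x using that sq by (intro inv_equality) simp_all
  have comm: "x \<otimes> y = y \<otimes> x" if "x \<in> carrier G" "y \<in> carrier G" for x y
    using inv_mult_group[OF that] that by (simp add: inv_self)
  interpret comm_group G by (rule group_comm_groupI[OF comm])
  have ex: "\<exists>x\<in>carrier G. x \<notin> set xs" if "length xs < 8" for xs
  proof (rule ccontr)
    assume "\<not> (\<exists>x\<in>carrier G. x \<notin> set xs)"
    then have "card (carrier G) \<le> card (set xs)" by (intro card_mono) auto
    then show False using that card card_length[of xs] by simp
  qed
  obtain a where a: "a \<in> carrier G" "a \<noteq> \<one>" using ex[of "[\<one>]"] by auto
  obtain b where b: "b \<in> carrier G" "b \<noteq> \<one>" "b \<noteq> a" using ex[of "[\<one>, a]"] by auto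
  obtain d where d: "d \<in> carrier G" "d \<notin> {\<one>, a, b, a \<otimes> b}"
    using ex[of "[\<one>, a, b, a \<otimes> b]"] by auto
  have pow_mod: "x [^] (i mod 2) = x [^] (i::int)" if x: "x \<in> carrier G" for x i
  proof -
    have "x [^] (2::nat) = \<one>" using x sq by (simp add: numeral_2_eq_2)
    then have "ord x dvd 2" using x by (simp add: pow_eq_id)
    then have "int (ord x) dvd int 2" by (simp only: of_nat_dvd_iff)
    moreover have "2 dvd i - i mod 2" by simp
    ultimately show ?thesis using int_pow_eq[OF x] by (auto intro: dvd_trans)
  qed
  let ?f = "\<lambda>(i, j, k). a [^] (i::int) \<otimes> (b [^] (j::int) \<otimes> d [^] (k::int))"
  have hom: "?f \<in> hom ?Z G"
  proof (rule homI)
    fix u v assume "u \<in> carrier ?Z" "v \<in> carrier ?Z"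
    obtain i j k i' j' k' where uv: "u = (i, j, k)" "v = (i', j', k')" by (metis surj_pair)
    show "?f (u \<otimes>\<^bsub>?Z\<^esub> v) = ?f u \<otimes> ?f v"
      using a b d by (simp add: uv pow_mod int_pow_mult m_ac)
  qed (use a b d in auto)
  interpret f: group_hom ?Z G ?f
    by (intro group_hom.intro DirProd_group group_integer_mod_group is_group group_hom_axioms.intro hom)
  have sub: "subgroup (?f ` carrier ?Z) G" by (rule f.img_is_subgroup)
  have mem: "?f (i, j, k) \<in> ?f ` carrier ?Z" if "i \<in> {0, 1}" "j \<in> {0, 1}" "k \<in> {0, 1}" for i j k
    by (rule imageI) (use that in \<open>auto simp: carrier_integer_mod_group\<close>)
  \<comment> \<open>Five distinct elements suffice: the image is a subgroup, and no proper divisor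
    of 8 reaches 5.\<close>
  have "{\<one>, a, b, a \<otimes> b, d} \<subseteq> ?f ` carrier ?Z"
    using mem[of 0 0 0] mem[of 1 0 0] mem[of 0 1 0] mem[of 1 1 0] mem[of 0 0 1] a b d by simp
  then have "card {\<one>, a, b, a \<otimes> b, d} \<le> card (?f ` carrier ?Z)"
    by (intro card_mono finite_imageI) (auto simp: carrier_integer_mod_group)
  moreover have "a \<otimes> b \<noteq> \<one>" using a b inv_self[of b] inv_equality[of a b] by auto
  then have "card {\<one>, a, b, a \<otimes> b, d} = 5" using a b d by (auto simp: card_insert_if)
  ultimately have "5 \<le> card (?f ` carrier ?Z)" by simp
  moreover have "card (?f ` carrier ?Z) dvd 8"
    using card_subgroup_dvd[OF sub subgroup_self subgroup.subset[OF sub]] card by simp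
  ultimately have 8: "card (?f ` carrier ?Z) = 8"
  proof -
    assume ge: "5 \<le> card (?f ` carrier ?Z)" and dv: "card (?f ` carrier ?Z) dvd 8"
    have "card (?f ` carrier ?Z) \<le> 8" using dv by (rule dvd_imp_le) simp
    then consider "card (?f ` carrier ?Z) = 5" | "card (?f ` carrier ?Z) = 6" | "card (?f ` carrier ?Z) = 7"
      | "card (?f ` carrier ?Z) = 8" using ge by linarith
    then show ?thesis using dv by cases simp_all
  qed
  then have "?f ` carrier ?Z = carrier G"
    using subgroup.subset[OF sub] card by (intro card_subset_eq) simp_all
  moreover have "inj_on ?f (carrier ?Z)"
  proof (rule eq_card_imp_inj_on)
    show "card (?f ` carrier ?Z) = card (carrier ?Z)"
      unfolding 8 by (simp add: carrier_integer_mod_group card_cartesian_product)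
  qed (simp add: carrier_integer_mod_group)
  ultimately have "?f \<in> iso ?Z G" using hom by (simp add: iso_def bij_betw_def)
  then show ?thesis by (rule is_isoI)
qed

text \<open>Faithfulness and evenness of the action both come from the census: 8 of the 12 elements
  have order 3, and the other 4 have trivial square.\<close>

lemma iso_alt_group_4:
  assumes card: "card (carrier G) = 12" and ords: "\<And>x. x \<in> carrier G \<Longrightarrow> ord x \<in> {1, 2, 3}"
    and four: "card {D \<in> cyclic_subgroups G. card D = 3} = 4"
  shows "G \<cong> alt_group 4"
proof -
  define P where "P = {D \<in> cyclic_subgroups G. card D = 3}"
  define T where "T = {x \<in> carrier G. ord x = 3}"
  have finP: "finite P" by (simp add: P_def)
  have cardT: "card T = 8" using card_ord_eq[of 3] four by (simp add: T_def totient_values)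
  have T_ne: "y [^] (2::nat) \<noteq> \<one>" "y [^] (3::nat) = \<one>" "y \<noteq> \<one>" "y \<in> carrier G" if "y \<in> T" for y
  proof -
    have "y \<in> carrier G" "ord y = 3" using that by (auto simp: T_def)
    then show "y [^] (2::nat) \<noteq> \<one>" "y [^] (3::nat) = \<one>" "y \<noteq> \<one>" "y \<in> carrier G"
      by (auto simp: pow_eq_id)
  qed
  have cardS: "card {x \<in> carrier G. x [^] (2::nat) = \<one>} = 4"
  proof -
    have "{x \<in> carrier G. x [^] (2::nat) = \<one>} = carrier G - T"
    proof (intro subset_antisym subsetI)
      fix x assume x: "x \<in> carrier G - T"
      then have "ord x = 1 \<or> ord x = 2" using ords[of x] by (auto simp: T_def)
      then show "x \<in> {x \<in> carrier G. x [^] (2::nat) = \<one>}" using x by (auto simp: pow_eq_id)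
    qed (use T_ne in auto)
    moreover have "card (carrier G - T) = card (carrier G) - card T"
      by (rule card_Diff_subset) (auto simp: T_def)
    ultimately show ?thesis using card cardT by simp
  qed
  define A where "A = (\<lambda>g D. (\<lambda>x. g \<otimes> x \<otimes> inv g) ` D)"
  have A_cyc: "A g (cyc x) = cyc (g \<otimes> x \<otimes> inv g)" if g: "g \<in> carrier G" and x: "x \<in> carrier G" for g x
  proof -
    have gx: "g \<otimes> x \<otimes> inv g \<in> carrier G" using g x by simp
    have "inv g \<otimes> (g \<otimes> x \<otimes> inv g) = x \<otimes> inv g" using g x by (simp add: m_assoc inv_mult_cancel)
    from pow_intertwine[OF gx x inv_closed[OF g] this]
    have *: "inv g \<otimes> (g \<otimes> x \<otimes> inv g) [^] k = x [^] k \<otimes> inv g" for k :: nat .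
    have "(g \<otimes> x \<otimes> inv g) [^] k = g \<otimes> x [^] k \<otimes> inv g" for k :: nat
    proof -
      have "(g \<otimes> x \<otimes> inv g) [^] k = g \<otimes> (inv g \<otimes> (g \<otimes> x \<otimes> inv g) [^] k)"
        by (rule mult_inv_cancel[OF g nat_pow_closed[OF gx], symmetric])
      then show ?thesis unfolding * using g x by (simp add: m_assoc)
    qed
    then show ?thesis unfolding A_def cyc_powers[OF x] cyc_powers[OF gx] by (auto simp: image_image)
  qed
  have ord_conj: "ord (g \<otimes> x \<otimes> inv g) = ord x" if g: "g \<in> carrier G" and x: "x \<in> carrier G" for g x
  proof -
    have "card (A g (cyc x)) = card (cyc x)"
      unfolding A_def
    proof (rule card_image, rule inj_onI)
      fix u v assume uv: "u \<in> cyc x" "v \<in> cyc x" "g \<otimes> u \<otimes> inv g = g \<otimes> v \<otimes> inv g"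
      then have "u \<in> carrier G" "v \<in> carrier G" using cyc_subset[OF x] by auto
      then show "u = v" using uv(3) g Units_l_cancel[of g u v] by simp
    qed
    then show ?thesis using A_cyc[OF g x] card_cyc[OF x] card_cyc[of "g \<otimes> x \<otimes> inv g"] g x by simp
  qed
  have P_E: thesis if D: "D \<in> P" and H: "\<And>x. x \<in> T \<Longrightarrow> D = cyc x \<Longrightarrow> thesis" for D thesis
  proof -
    from D obtain x where x: "x \<in> carrier G" "D = cyc x" "card D = 3"
      unfolding P_def cyclic_subgroups_eq by blast
    then have "x \<in> T" using card_cyc[of x] by (simp add: T_def)
    then show thesis using x(2) by (rule H)
  qed
  have T_P: "cyc x \<in> P" if "x \<in> T" for x
    using that unfolding P_def T_def cyclic_subgroups_eq by (auto simp: card_cyc)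
  have D_sub: "D \<subseteq> carrier G" if "D \<in> P" for D
    by (rule P_E[OF that]) (use cyc_subset in \<open>auto simp: T_def\<close>)
  have A_P: "A g D \<in> P" if g: "g \<in> carrier G" and D: "D \<in> P" for g D
  proof -
    obtain x where x: "x \<in> T" "D = cyc x" by (rule P_E[OF D])
    then have xc: "x \<in> carrier G" by (simp add: T_def)
    have "g \<otimes> x \<otimes> inv g \<in> T" using ord_conj[OF g xc] x g xc by (simp add: T_def)
    then show ?thesis using A_cyc[OF g xc] x T_P by simp
  qed
  have A_mult: "A (g \<otimes> h) D = A g (A h D)" if gh: "g \<in> carrier G" "h \<in> carrier G" and D: "D \<in> P" for g h D
    unfolding A_def image_image
  proof (rule image_cong[OF HOL.refl])
    fix x assume "x \<in> D"
    then have "x \<in> carrier G" using D_sub[OF D] by auto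
    then show "g \<otimes> h \<otimes> x \<otimes> inv (g \<otimes> h) = g \<otimes> (h \<otimes> x \<otimes> inv h) \<otimes> inv g"
      using gh by (simp add: inv_mult_group m_assoc)
  qed
  have A_one: "A \<one> D = D" if D: "D \<in> P" for D
  proof -
    have "A \<one> D = (\<lambda>x. x) ` D"
      unfolding A_def by (rule image_cong) (use D_sub[OF D] in auto)
    then show ?thesis by simp
  qed
  have conj_exp: "\<exists>s\<in>{1, 2}. g \<otimes> y = y [^] (s::nat) \<otimes> g"
    if g: "g \<in> carrier G" and y: "y \<in> T" and fx: "A g (cyc y) = cyc y" for g y
  proof -
    have yc: "y \<in> carrier G" "ord y = 3" using y by (auto simp: T_def)
    have "g \<otimes> y \<otimes> inv g \<in> cyc y" using A_cyc[OF g yc(1)] fx cyc_self[of "g \<otimes> y \<otimes> inv g"] by simp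
    then obtain s where s: "s < ord y" "g \<otimes> y \<otimes> inv g = y [^] (s::nat)" by (rule mem_cycE[OF _ yc(1)])
    have "s \<noteq> 0"
    proof
      assume "s = 0"
      then have "g \<otimes> y \<otimes> inv g = \<one>" using s by simp
      then have "ord y = 1" using ord_conj[OF g yc(1)] by simp
      then show False using yc by simp
    qed
    then have "s = 1 \<or> s = 2" using s yc by auto
    moreover have "g \<otimes> y = y [^] s \<otimes> g"
      using s(2)[symmetric] g yc by (subst (asm) inv_solve_right) simp_all
    ultimately show ?thesis by auto
  qed
  have not_commute: "g \<otimes> y \<noteq> y \<otimes> g" if g: "g \<in> carrier G" "ord g = 2" and y: "y \<in> T" for g y
  proof
    assume "g \<otimes> y = y \<otimes> g"
    then have rel: "g \<otimes> y = y [^] (1::nat) \<otimes> g" using T_ne[OF y] by simp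
    define x where "x = y [^] (1::nat) \<otimes> g"
    have xc: "x \<in> carrier G" unfolding x_def using T_ne[OF y] g by simp
    have pw: "x [^] k = y [^] k \<otimes> g [^] k" for k :: nat
      unfolding x_def using power_mult_pow[OF T_ne(4)[OF y] g(1) rel, of 1 k] by simp
    have "g [^] (2::nat) = \<one>" "g [^] (3::nat) \<noteq> \<one>" using g by (simp_all add: pow_eq_id)
    then have "x [^] (2::nat) \<noteq> \<one>" "x [^] (3::nat) \<noteq> \<one>"
      unfolding pw using T_ne[OF y] g by simp_all
    then have "\<not> ord x dvd 2" "\<not> ord x dvd 3" using pow_eq_id[OF xc] by simp_all
    then show False using ords[OF xc] by auto
  qed
  have kernel: "g = \<one>" if g: "g \<in> carrier G" and fx: "\<And>D. D \<in> P \<Longrightarrow> A g D = D" for g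
  proof -
    have ex: "\<exists>s\<in>{1, 2}. g \<otimes> y = y [^] (s::nat) \<otimes> g" if "y \<in> T" for y
      by (rule conj_exp[OF g that fx[OF T_P[OF that]]])
    consider "ord g = 1" | "ord g = 2" | "ord g = 3" using ords[OF g] by auto
    then show ?thesis
    proof cases
      case 1
      then show ?thesis using ord_eq_1[OF g] by simp
    next
      case 2
      have g2: "g \<otimes> g = \<one>"
      proof -
        have "g [^] (2::nat) = \<one>" using g 2 by (simp add: pow_eq_id)
        then show ?thesis using g by (simp add: numeral_2_eq_2)
      qed
      \<comment> \<open>An involution \<open>g\<close> in the kernel normalises each
        \<open>cyc y\<close> without centralising it, so it inverts all 8 elements \<open>y\<close>
        of order 3. Then the 8 products \<open>y \<otimes> g\<close> have trivial square, but only 4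
        elements do.\<close>
      have "y \<otimes> g \<in> {x \<in> carrier G. x [^] (2::nat) = \<one>}" if y: "y \<in> T" for y
      proof -
        have yc: "y \<in> carrier G" by (rule T_ne(4)[OF y])
        obtain s where s: "s \<in> {1, 2}" "g \<otimes> y = y [^] (s::nat) \<otimes> g" by (rule bexE[OF ex[OF y]])
        then have "s = 2" using not_commute[OF g 2 y] yc by auto
        then have "y \<otimes> (g \<otimes> y) \<otimes> g = y \<otimes> (y [^] (2::nat)) \<otimes> (g \<otimes> g)"
          using s yc g by (simp add: m_assoc)
        also have "\<dots> = y [^] (3::nat)" using yc g2 nat_pow_Suc2[OF yc, of 2] by (simp add: numeral_3_eq_3 numeral_2_eq_2)
        finally have "y \<otimes> (g \<otimes> y) \<otimes> g = \<one>" using T_ne[OF y] by simp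
        then show ?thesis using yc g by (simp add: numeral_2_eq_2 m_assoc)
      qed
      then have "card T \<le> card {x \<in> carrier G. x [^] (2::nat) = \<one>}"
        using g T_ne by (intro card_inj_on_le[of "\<lambda>y. y \<otimes> g"]) (auto simp: inj_on_def)
      then show ?thesis using cardT cardS by simp
    next
      case 3
      have "\<exists>D\<in>P. D \<noteq> cyc g"
      proof (rule ccontr)
        assume "\<not> (\<exists>D\<in>P. D \<noteq> cyc g)"
        then have "P \<subseteq> {cyc g}" by blast
        then have "card P \<le> card {cyc g}" by (intro card_mono) auto
        then show False using four by (simp add: P_def)
      qed
      then obtain D where D: "D \<in> P" "D \<noteq> cyc g" by blast
      obtain y where "y \<in> T" "D = cyc y" by (rule P_E[OF D(1)])
      then have y: "y \<in> T" "cyc y \<noteq> cyc g" using D(2) by simp_all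
      have yc: "y \<in> carrier G" "ord y = 3" using y by (auto simp: T_def)
      obtain s where s: "s \<in> {1, 2}" "g \<otimes> y = y [^] (s::nat) \<otimes> g" by (rule bexE[OF ex[OF y(1)]])
      have g3: "g [^] (3::nat) = \<one>" using g 3 by (simp add: pow_eq_id)
      have "y = y [^] (s ^ 3)" using power_conj_power[OF yc(1) g s(2), of 3 1] yc by (simp add: g3)
      then have "[s ^ 3 = 1] (mod 3)" using pow_eq_iff_cong[OF yc(1), of "s ^ 3" 1] yc by simp
      then have "s = 1" using s(1) by (auto simp: cong_def)
      then have rel: "g \<otimes> y = y [^] (1::nat) \<otimes> g" using s by simp
      \<comment> \<open>An element \<open>g\<close> of order 3 cannot act on another
        \<open>cyc y\<close> by inversion, since 2 ^ 3 is not 1 modulo 3. So they commute and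
        generate a subgroup of order 9, which does not divide 12.\<close>
      let ?M = "metacyclic 3 3 1 0" and ?f = "\<lambda>(i, j). y [^] (i::nat) \<otimes> g [^] (j::nat)"
      have hom: "?f \<in> hom ?M G"
        by (rule metacyclic_hom[OF yc(1) g rel]) (use yc g3 in \<open>simp_all add: pow_eq_id\<close>)
      interpret M: group ?M by (rule group_metacyclic) simp_all
      interpret f: group_hom ?M G ?f by unfold_locales (rule hom)
      have sub: "subgroup (?f ` carrier ?M) G" by (rule f.img_is_subgroup)
      have prod: "cyc y <#> cyc g \<subseteq> ?f ` carrier ?M"
      proof
        fix x assume "x \<in> cyc y <#> cyc g"
        then obtain a b where ab: "a \<in> cyc y" "b \<in> cyc g" "x = a \<otimes> b" by (auto simp: set_mult_def)
        obtain i where i: "i < ord y" "a = y [^] (i::nat)" by (rule mem_cycE[OF ab(1) yc(1)])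
        obtain j where j: "j < ord g" "b = g [^] (j::nat)" by (rule mem_cycE[OF ab(2) g])
        show "x \<in> ?f ` carrier ?M"
          by (rule image_eqI[of _ _ "(i, j)"]) (use i j ab yc 3 in \<open>auto simp: carrier_metacyclic\<close>)
      qed
      have "card (cyc y \<inter> cyc g) = 1"
      proof -
        have sub2: "subgroup (cyc y \<inter> cyc g) G" using yc g by (intro subgroups_Inter_pair subgroup_cyc) auto
        have "card (cyc y \<inter> cyc g) dvd 3"
          using card_subgroup_dvd[OF sub2 subgroup_cyc[OF yc(1)]] card_cyc[OF yc(1)] yc by simp
        moreover have "card (cyc y \<inter> cyc g) \<noteq> 3"
        proof
          assume c3: "card (cyc y \<inter> cyc g) = 3"
          have "cyc y \<inter> cyc g = cyc y" "cyc y \<inter> cyc g = cyc g"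
            using c3 card_cyc[OF yc(1)] card_cyc[OF g] yc 3
            by (intro card_subset_eq finite_cyc yc(1) g; simp)+
          then show False using y by simp
        qed
        moreover have "prime (3::nat)" by simp
        ultimately show ?thesis by (auto simp: prime_nat_iff)
      qed
      then have "9 \<le> card (cyc y <#> cyc g)"
        using card_mult_le_card_Int[OF subgroup_cyc[OF yc(1)] subgroup_cyc[OF g]] card_cyc[OF yc(1)] card_cyc[OF g] yc 3
        by simp
      also have "\<dots> \<le> card (?f ` carrier ?M)"
        using prod by (intro card_mono finite_imageI) (simp_all add: carrier_metacyclic)
      finally have ge: "9 \<le> card (?f ` carrier ?M)" .
      have "card (?f ` carrier ?M) \<le> card (carrier ?M)" by (intro card_image_le) (simp add: carrier_metacyclic)
      then have "card (?f ` carrier ?M) = 9" using ge by (simp add: carrier_metacyclic card_cartesian_product)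
      moreover have "card (?f ` carrier ?M) dvd 12"
        using card_subgroup_dvd[OF sub subgroup_self subgroup.subset[OF sub]] card by simp
      ultimately show ?thesis by simp
    qed
  qed
  define I where "I = {1..4::nat}"
  have "card P = 4" using four by (simp add: P_def)
  then obtain \<beta> where \<beta>: "bij_betw \<beta> I P"
    using ex_bij_betw_nat_finite_1[OF finP] unfolding I_def by auto
  \<comment> \<open>The four subgroups are numbered by \<open>I\<close>, and the action is extended
    by the identity, as required of a permutation of \<open>I\<close> on all naturals.\<close>
  define \<phi> where "\<phi> = (\<lambda>g i. if i \<in> I then inv_into I \<beta> (A g (\<beta> i)) else i)"
  have \<beta>P: "\<beta> i \<in> P" if "i \<in> I" for i using \<beta> that by (auto simp: bij_betw_def)
  have \<phi>_out: "\<phi> g i = i" if "i \<notin> I" for g i using that by (simp add: \<phi>_def)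
  have \<phi>_in: "\<phi> g i \<in> I" "\<beta> (\<phi> g i) = A g (\<beta> i)" if "g \<in> carrier G" "i \<in> I" for g i
  proof -
    have "A g (\<beta> i) \<in> \<beta> ` I" using A_P[OF that(1) \<beta>P[OF that(2)]] \<beta> by (simp add: bij_betw_def)
    then show "\<phi> g i \<in> I" "\<beta> (\<phi> g i) = A g (\<beta> i)"
      unfolding \<phi>_def using that(2) by (simp_all only: if_True inv_into_into f_inv_into_f)
  qed
  have \<beta>_inj: "i = j" if "\<beta> i = \<beta> j" "i \<in> I" "j \<in> I" for i j
    using \<beta> that by (auto simp: bij_betw_def inj_on_def)
  have \<phi>_mult: "\<phi> (g \<otimes> h) = \<phi> g \<circ> \<phi> h" if g: "g \<in> carrier G" and h: "h \<in> carrier G" for g h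
  proof
    fix i
    show "\<phi> (g \<otimes> h) i = (\<phi> g \<circ> \<phi> h) i"
    proof (cases "i \<in> I")
      case True
      have "\<beta> (\<phi> (g \<otimes> h) i) = \<beta> (\<phi> g (\<phi> h i))"
        using g h True \<phi>_in[OF h True] by (simp only: \<phi>_in m_closed A_mult \<beta>P)
      then show ?thesis using \<beta>_inj \<phi>_in g h True by (simp only: o_apply m_closed)
    qed (simp add: \<phi>_out)
  qed
  have \<phi>_one: "\<phi> \<one> = id"
  proof
    fix i show "\<phi> \<one> i = id i"
    proof (cases "i \<in> I")
      case True
      have "\<beta> (\<phi> \<one> i) = \<beta> i" using \<phi>_in(2)[OF one_closed True] A_one[OF \<beta>P[OF True]] by simp
      then show ?thesis using \<beta>_inj[OF _ \<phi>_in(1)[OF one_closed True] True] by simp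
    qed (simp add: \<phi>_out)
  qed
  have permutes: "\<phi> g permutes I" if g: "g \<in> carrier G" for g
  proof (rule bij_imp_permutes)
    have "\<phi> g (\<phi> (inv g) i) = i" "\<phi> (inv g) (\<phi> g i) = i" for i
      using \<phi>_mult[of g "inv g"] \<phi>_mult[of "inv g" g] \<phi>_one g by (simp_all add: fun_eq_iff)
    then show "bij_betw (\<phi> g) I I"
      using \<phi>_in(1) g by (intro bij_betw_byWitness[where f' = "\<phi> (inv g)"]) auto
  qed (rule \<phi>_out)
  have perm: "permutation (\<phi> g)" if g: "g \<in> carrier G" for g
    unfolding permutation_permutes using permutes[OF g] by (intro exI[of _ I]) (simp add: I_def)
  have inj: "inj_on \<phi> (carrier G)"
  proof (rule inj_onI)
    fix g h assume g: "g \<in> carrier G" and h: "h \<in> carrier G" and eq: "\<phi> g = \<phi> h"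
    have "\<phi> (inv h \<otimes> g) = id" using \<phi>_mult[of "inv h" g] \<phi>_mult[of "inv h" h] \<phi>_one g h eq by simp
    then have "A (inv h \<otimes> g) (\<beta> i) = \<beta> i" if "i \<in> I" for i
      using \<phi>_in(2)[of "inv h \<otimes> g" i] that g h by simp
    moreover have "P = \<beta> ` I" using \<beta> by (simp add: bij_betw_def)
    ultimately have "A (inv h \<otimes> g) D = D" if "D \<in> P" for D using that by auto
    then have "inv h \<otimes> g = \<one>" using g h by (intro kernel) simp_all
    then show "g = h" using g h inv_solve_left'[of \<one> h g] by simp
  qed
  \<comment> \<open>An element of order 3 is the square of its square, and squares are even.\<close>
  have evenT: "evenperm (\<phi> y)" if y: "y \<in> T" for y
  proof -
    have yc: "y \<in> carrier G" by (rule T_ne(4)[OF y])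
    have "y [^] (2::nat) \<otimes> y [^] (2::nat) = y [^] (3::nat) \<otimes> y" using yc by (simp add: nat_pow_mult flip: nat_pow_Suc)
    then have "y = y [^] (2::nat) \<otimes> y [^] (2::nat)" using T_ne[OF y] by simp
    then have "\<phi> y = \<phi> (y [^] (2::nat)) \<circ> \<phi> (y [^] (2::nat))" using \<phi>_mult[of "y [^] (2::nat)" "y [^] (2::nat)"] yc by simp
    moreover have "permutation (\<phi> (y [^] (2::nat)))" using yc by (intro perm) simp
    ultimately show ?thesis using evenperm_comp by metis
  qed
  have even: "evenperm (\<phi> g)" if g: "g \<in> carrier G" for g
  proof -
    \<comment> \<open>Right multiplication by \<open>g\<close> is injective and cannot move the 8
      elements of \<open>T\<close> into the 4 remaining ones; so \<open>g\<close> has the parity of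
      a quotient of two elements of \<open>T\<close>.\<close>
    have "\<exists>y\<in>T. y \<otimes> g \<in> T"
    proof (rule ccontr)
      assume no: "\<not> (\<exists>y\<in>T. y \<otimes> g \<in> T)"
      have "card T \<le> card (carrier G - T)"
        using g T_ne no by (intro card_inj_on_le[of "\<lambda>y. y \<otimes> g"]) (auto simp: inj_on_def)
      also have "\<dots> = card (carrier G) - card T" by (rule card_Diff_subset) (auto simp: T_def)
      finally show False using card cardT by simp
    qed
    then obtain y where y: "y \<in> T" "y \<otimes> g \<in> T" by blast
    have yc: "y \<in> carrier G" by (rule T_ne(4)[OF y(1)])
    have "\<phi> (y \<otimes> g) = \<phi> y \<circ> \<phi> g" by (rule \<phi>_mult[OF yc g])
    moreover have "evenperm (\<phi> y \<circ> \<phi> g) = (evenperm (\<phi> y) = evenperm (\<phi> g))"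
      by (rule evenperm_comp[OF perm[OF yc] perm[OF g]])
    ultimately show ?thesis using evenT[OF y(1)] evenT[OF y(2)] by simp
  qed
  have sub: "\<phi> ` carrier G \<subseteq> carrier (alt_group 4)"
    using permutes even by (auto simp: alt_group_carrier I_def)
  have "card (carrier (alt_group 4)) = 12"
    using alt_group_card_carrier[of 4] by (simp add: fact_numeral)
  then have "\<phi> ` carrier G = carrier (alt_group 4)"
    using sub card card_image[OF inj] by (intro card_subset_eq) (auto intro: card_ge_0_finite)
  moreover have "\<phi> \<in> hom G (alt_group 4)"
    using sub \<phi>_mult by (intro homI) (auto simp: alt_group_mult)
  ultimately have "\<phi> \<in> iso G (alt_group 4)" using inj by (simp add: iso_def bij_betw_def)
  then show ?thesis by (rule is_isoI)
qed

section \<open>Cyclic groups, the noncyclic cases, and abelian groups of order 4q\<close>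

lemma cyclic_group_iff: "cyclic_group G \<longleftrightarrow> (\<exists>x\<in>carrier G. cyc x = carrier G)"
proof -
  have "subgroup_generated G {x} = G \<longleftrightarrow> cyc x = carrier G" if "x \<in> carrier G" for x
  proof
    assume "subgroup_generated G {x} = G"
    from arg_cong[OF this, of carrier] show "cyc x = carrier G"
      using that by (simp add: carrier_subgroup_generated cyc_def)
  qed (use that in \<open>simp add: subgroup_generated_def cyc_def\<close>)
  then show ?thesis by (auto simp: cyclic_group_def)
qed

lemma card_cyclic_subgroups_cyclic:
  assumes "cyclic_group G"
  shows "card (cyclic_subgroups G) = card {d. d dvd order G}"
proof -
  obtain x where x: "x \<in> carrier G" "cyc x = carrier G" using assms cyclic_group_iff by blast
  then show ?thesis
    using card_cyclic_subgroups_cyc[OF x(1)] card_cyc[OF x(1)] by (simp add: cyclic_subgroups_eq order_def)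
qed

lemma cyclic_iso_integer_mod_group:
  assumes "cyclic_group G"
  shows "integer_mod_group (order G) \<cong> G"
proof -
  obtain x where x: "x \<in> carrier G" "cyc x = carrier G" using assms cyclic_group_iff by blast
  have n: "ord x = order G" using card_cyc[OF x(1)] x(2) by (simp add: order_def)
  then have n0: "order G > 0" using ord_pos[OF x(1)] by simp
  let ?Z = "integer_mod_group (order G)" and ?f = "\<lambda>i::int. x [^] i"
  have "?f \<in> hom ?Z G"
  proof (rule homI)
    fix i j assume "i \<in> carrier ?Z" "j \<in> carrier ?Z"
    have "x [^] ((i + j) mod int (order G)) = x [^] (i + j)"
      using int_pow_eq[OF x(1)] n by simp
    then show "?f (i \<otimes>\<^bsub>?Z\<^esub> j) = ?f i \<otimes> ?f j" using x by (simp add: int_pow_mult)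
  qed (use x in simp)
  moreover have img: "?f ` carrier ?Z = carrier G"
  proof (intro subset_antisym subsetI)
    fix g assume "g \<in> carrier G"
    then have "g \<in> cyc x" using x by simp
    then obtain i where "i < ord x" "g = x [^] (i::nat)" by (rule mem_cycE[OF _ x(1)])
    then show "g \<in> ?f ` carrier ?Z"
      using n n0 by (intro image_eqI[of _ _ "int i"]) (simp_all add: carrier_integer_mod_group int_pow_int)
  qed (use x in auto)
  moreover have "inj_on ?f (carrier ?Z)"
  proof (rule eq_card_imp_inj_on)
    show "card (?f ` carrier ?Z) = card (carrier ?Z)"
      unfolding img using n0 by (simp add: carrier_integer_mod_group order_def)
  qed (use n0 in \<open>simp add: carrier_integer_mod_group\<close>)
  ultimately have "?f \<in> iso ?Z G" by (simp add: iso_def bij_betw_def)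
  then show ?thesis by (rule is_isoI)
qed

lemma sum_card_ord:
  assumes "finite K" "\<And>x. x \<in> carrier G \<Longrightarrow> ord x \<in> K"
  shows "(\<Sum>k\<in>K. card {x \<in> carrier G. ord x = k}) = card (carrier G)"
proof -
  have "card (carrier G) = card (\<Union>k\<in>K. {x \<in> carrier G. ord x = k})"
    by (rule arg_cong[of _ _ card]) (use assms(2) in blast)
  also have "\<dots> = (\<Sum>k\<in>K. card {x \<in> carrier G. ord x = k})"
    using assms(1) by (intro card_UN_disjoint) auto
  finally show ?thesis ..
qed

lemma card_ord_1: "card {x \<in> carrier G. ord x = 1} = 1"
proof -
  have "{x \<in> carrier G. ord x = 1} = {\<one>}" using ord_eq_1 by auto
  then show ?thesis by simp
qed

lemma non_cyclic_cases:
  assumes eight: "card (cyclic_subgroups G) = 8" and nc: "\<not> cyclic_group G"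
  shows "(\<exists>q. prime q \<and> 2 < q \<and> comm_group G \<and> order G = 4 * q) \<or>
    integer_mod_group 2 \<times>\<times> integer_mod_group 2 \<times>\<times> integer_mod_group 2 \<cong> G \<or>
    metacyclic 8 2 1 0 \<cong> G \<or> metacyclic 8 2 5 0 \<cong> G \<or> metacyclic 8 2 7 4 \<cong> G \<or>
    metacyclic 9 3 1 0 \<cong> G \<or> metacyclic 9 3 4 0 \<cong> G \<or> G \<cong> alt_group 4"
proof -
  obtain c m where c: "c \<in> carrier G" "card (carrier G) = ord c * m"
    "\<forall>x\<in>carrier G.
       totient (ord x) < totient (ord c) \<or> totient (ord x) = totient (ord c) \<and> ord x \<le> ord c"
    by (rule ex_maximal_cyclic)
  have "card (carrier G) > 0" by (auto simp: card_gt_0_iff)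
  then have "m \<noteq> 0" using c(2) by (intro notI) simp
  moreover have "m \<noteq> 1"
  proof
    assume "m = 1"
    then have "cyc c = carrier G"
      using c card_cyc[OF c(1)] by (intro card_subset_eq cyc_subset) simp_all
    then show False using nc c(1) cyclic_group_iff by blast
  qed
  ultimately have m: "2 \<le> m" by simp
  interpret E: eight_cyclic G c m
    by unfold_locales (use c m eight in auto)
  let ?t = "card {d. d dvd ord c}"
  have "?t < 8" using E.card_divisors_less eight by simp
  moreover have "?t > 0" by (rule card_divisors_pos) simp
  moreover have "?t \<noteq> 1" using card_divisors_eq_1_iff[of "ord c"] E.n_gt_1 by simp
  moreover have "?t \<noteq> 7" by (rule E.card_divisors_not_7)
  ultimately consider "?t = 2" | "?t = 3" | "?t = 4" | "?t = 5" | "?t = 6" by linarith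
  then show ?thesis
  proof cases
    case 1
    from E.card_divisors_2_cases[OF this] consider "ord c = 2" "m = 4" "ord ` E.out \<subseteq> {2}"
      | "ord c = 3" "m = 4" "E.N 2 = 3" "E.N 3 = 3" "ord ` E.out \<subseteq> {2, 3}" | "ord c = 3" "m = 5" by blast
    then show ?thesis
    proof cases
      case 1
      have "x \<otimes> x = \<one>" if x: "x \<in> carrier G" for x
      proof -
        have "ord x dvd 2"
        proof (cases "x \<in> cyc c")
          case True
          then show ?thesis using ord_dvd_of_mem_cyc[OF c(1)] 1 by simp
        next
          case False
          then have "x \<in> E.out" using x by (simp add: E.out_def)
          then have "ord x = 2" using 1 by auto
          then show ?thesis by simp
        qed
        then have "x [^] (2::nat) = \<one>" using x by (simp add: pow_eq_id)
        then show ?thesis using x by (simp add: numeral_2_eq_2)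
      qed
      moreover have "card (carrier G) = 8" using c 1 by simp
      ultimately show ?thesis using elementary_abelian_8 by simp
    next
      case 2
      have ords: "ord x \<in> {1, 2, 3}" if x: "x \<in> carrier G" for x
      proof (cases "x \<in> cyc c")
        case True
        then have "ord x dvd 3" using ord_dvd_of_mem_cyc[OF c(1)] 2 by simp
        moreover have "prime (3::nat)" by simp
        ultimately show ?thesis by (auto simp: prime_nat_iff)
      next
        case False
        then have "x \<in> E.out" using x by (simp add: E.out_def)
        then show ?thesis using 2 by auto
      qed
      have card: "card (carrier G) = 12" using c 2 by simp
      have "{x \<in> carrier G. ord x = 2} \<subseteq> E.out"
      proof
        fix x assume x: "x \<in> {x \<in> carrier G. ord x = 2}"
        have "x \<notin> cyc c" using ord_dvd_of_mem_cyc[OF c(1), of x] x 2 by auto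
        then show "x \<in> E.out" using x by (simp add: E.out_def)
      qed
      \<comment> \<open>\<open>E.N 2\<close> counts outside subgroups only, but 2 does not divide
        the order 3 of \<open>c\<close>, so it counts all of order 2. The 8 elements of order 3 are
        what remains of 12 after 1 + 3.\<close>
      have "{D \<in> cyclic_subgroups G. card D = 2} = {D \<in> cyc ` E.out. card D = 2}"
      proof (intro subset_antisym subsetI)
        fix D assume "D \<in> {D \<in> cyclic_subgroups G. card D = 2}"
        then obtain x where x: "x \<in> carrier G" "D = cyc x" "card D = 2" by (auto simp: cyclic_subgroups_eq)
        then have "x \<in> E.out" using \<open>{x \<in> carrier G. ord x = 2} \<subseteq> E.out\<close> card_cyc[of x] by auto
        then show "D \<in> {D \<in> cyc ` E.out. card D = 2}" using x by simp
      qed (auto simp: cyclic_subgroups_eq)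
      then have "card {x \<in> carrier G. ord x = 2} = 3" using card_ord_eq[of 2] 2 by (simp add: E.N_def)
      then have "card {x \<in> carrier G. ord x = 3} = 8"
        using sum_card_ord[of "{1, 2, 3}"] ords card_ord_1 card by simp
      then have "card {D \<in> cyclic_subgroups G. card D = 3} = 4" using card_ord_eq[of 3] by (simp add: totient_values)
      then show ?thesis using iso_alt_group_4[OF card ords] by simp
    next
      case 3
      then show ?thesis using E.not_order_3_index_5 by blast
    qed
  next
    case 2
    from E.card_divisors_3_cases[OF this] consider "ord c = 4" "m = 3" | "ord c = 9" "m = 2" "E.N 2 = 1" "ord ` E.out \<subseteq> {2, 6}"
      | "ord c = 9" "m = 3" "E.N 3 = 3" | "ord c = 25" "m = 5" "ord ` E.out \<subseteq> {25}" by blast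
    then show ?thesis
    proof cases
      case 1
      then show ?thesis using E.not_order_4_index_3 by blast
    next
      case 2
      then show ?thesis using E.not_order_9_index_2 by blast
    next
      case 3
      then show ?thesis using E.metacyclic_if_order_9_index_3 by blast
    next
      case 4
      then show ?thesis using E.not_order_25_index_5 by blast
    qed
  next
    case 3
    from card_divisors_eq_4[OF E.n_pos 3] consider p where "prime p" "ord c = p ^ 3"
      | p q where "prime p" "prime q" "p < q" "ord c = p * q" .
    then show ?thesis
    proof cases
      case (1 p)
      then have "ord c = p ^ Suc 2" by simp
      from E.card_divisors_4_prime_cube_cases[OF 3 1(1) this] show ?thesis
        using E.metacyclic_if_order_8_index_2 E.not_order_8_index_3 by blast
    next
      case (2 p q)
      note D = E.card_divisors_4_prime_product_cases[OF 3 2]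
      then have "comm_group G" using 2 by (intro E.comm_group_if_order_2q_index_2[of q]) simp_all
      moreover have "order G = 4 * q" using D 2 c(2) by (simp add: order_def)
      moreover have "2 < q" using D 2 by simp
      ultimately show ?thesis using 2 by blast
    qed
  next
    case 4
    from E.card_divisors_5_cases[OF 4] have False
    proof (elim disjE conjE)
      assume "ord c = 16" "m = 2" "E.N 16 = 1" "E.N 2 = 0"
      then show False by (rule E.not_order_16_index_2)
    next
      assume "ord c = 81" "m = 3" "ord ` E.out \<subseteq> {81}"
      then show False by (rule E.not_order_81_index_3)
    qed
    then show ?thesis ..
  next
    case 5
    from E.card_divisors_6_cases[OF 5] have False using E.not_order_32_index_2 by (elim conjE)
    then show ?thesis ..
  qed
qed

text \<open>An element of order 4 times one of order \<open>q\<close> would generate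
  \<open>G\<close>, so the Sylow 2-subgroup \<open>V\<close> has exponent 2 and \<open>G\<close> is
  the direct product of \<open>V\<close> and \<open>cyc z\<close>. The orders 1, 2,
  \<open>q\<close>, \<open>2 * q\<close> then occur 1, 3, \<open>q - 1\<close> and
  \<open>3 * (q - 1)\<close> times, which gives 1 + 3 + 1 + 3 cyclic subgroups.\<close>

lemma card_cyclic_subgroups_4q:
  assumes comm: "comm_group G" and q: "prime q" "2 < q" and ord_G: "order G = 4 * q" and nc: "\<not> cyclic_group G"
  shows "card (cyclic_subgroups G) = 8"
proof -
  interpret comm_group G by (rule comm)
  have card: "card (carrier G) = 4 * q" using ord_G by (simp add: order_def)
  have oq: "odd q" using prime_odd_nat[OF q] .
  obtain z where z: "z \<in> carrier G" "ord z = q" by (rule cauchy[OF q(1)]) (simp add: card)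
  have "order G = 2 ^ 2 * q" using ord_G by simp
  then obtain V where V: "subgroup V G" "card V = 2 ^ 2"
    using sylow_thm[OF two_is_prime_nat is_group] finite_carrier by blast
  interpret V: subgroup V G by (rule V)
  have no4: "ord x \<noteq> 4" if x: "x \<in> carrier G" for x
  proof
    assume x4: "ord x = 4"
    have "4 dvd ord (x \<otimes> z)" "q dvd ord (x \<otimes> z)"
    proof -
      let ?k = "ord (x \<otimes> z)"
      have xz: "(x \<otimes> z) [^] k = x [^] k \<otimes> z [^] k" for k :: nat
        using x z by (simp add: nat_pow_distrib)
      have one: "x [^] ?k \<otimes> z [^] ?k = \<one>" using xz[of ?k] x z by simp
      \<comment> \<open>Raising this product to the powers \<open>q\<close> and 4 removes one factor
        each time; coprimality of 4 and \<open>q\<close> then shows that both divide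
        \<open>?k\<close>.\<close>
      then have e: "(x [^] ?k) [^] j \<otimes> (z [^] ?k) [^] j = \<one>" for j :: nat
        using x z nat_pow_distrib[of "x [^] ?k" "z [^] ?k" j] by simp
      have "(z [^] ?k) [^] q = \<one>" "(x [^] ?k) [^] (4::nat) = \<one>"
        using x z x4 by (simp_all add: nat_pow_pow pow_eq_id)
      then have "(x [^] ?k) [^] q = \<one>" "(z [^] ?k) [^] (4::nat) = \<one>" using e[of q] e[of 4] x z by simp_all
      then have "4 dvd ?k * q" "q dvd ?k * 4" using x z x4 by (simp_all add: nat_pow_pow pow_eq_id)
      moreover have "coprime 4 q" using oq by (simp add: coprime_power_left_iff[of 2 2, simplified])
      ultimately show "4 dvd ?k" "q dvd ?k"
        by (simp_all add: coprime_dvd_mult_left_iff coprime_commute)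
    qed
    moreover have "coprime 4 q" using oq coprime_power_left_iff[of 2 2 q] by simp
    ultimately have "4 * q dvd ord (x \<otimes> z)" by (rule divides_mult)
    then have "4 * q \<le> ord (x \<otimes> z)" using ord_pos[of "x \<otimes> z"] x z by (intro dvd_imp_le) simp_all
    then have "card (cyc (x \<otimes> z)) = card (carrier G)"
      using ord_le_group_order[of "x \<otimes> z"] x z card card_cyc[of "x \<otimes> z"] ord_G by simp
    then have "cyc (x \<otimes> z) = carrier G" using x z by (intro card_subset_eq cyc_subset) simp_all
    then show False using nc cyclic_group_iff x z m_closed by blast
  qed
  have V_sq: "v \<otimes> v = \<one>" if v: "v \<in> V" for v
  proof -
    have vc: "v \<in> carrier G" using v by simp
    have "card (cyc v) dvd 4"
      using card_subgroup_dvd[OF subgroup_cyc[OF vc] V(1) cyc_minimal[OF V(1) v]] V(2) by simp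
    then have d: "ord v dvd 4" using card_cyc[OF vc] by simp
    then have "ord v \<le> 4" by (rule dvd_imp_le) simp
    then consider "ord v = 0" | "ord v = 1" | "ord v = 2" | "ord v = 3" | "ord v = 4" by linarith
    then have "ord v dvd 2" using d no4[OF vc] by cases auto
    then have "v [^] (2::nat) = \<one>" using vc by (simp add: pow_eq_id)
    then show ?thesis using vc by (simp add: numeral_2_eq_2)
  qed
  have pow_q: "v [^] q = v" if v: "v \<in> V" for v
  proof -
    obtain k where "q = Suc (2 * k)" using oq by (auto elim: oddE)
    moreover have "v [^] (2::nat) = \<one>" using V_sq[OF v] v by (simp add: numeral_2_eq_2)
    ultimately show ?thesis using v by (simp flip: nat_pow_pow)
  qed
  have Q_pow: "u [^] q = \<one>" if u: "u \<in> cyc z" for u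
    using u ord_dvd_of_mem_cyc[OF z(1) u] z cyc_subset[OF z(1)] pow_eq_id[of u q] by auto
  have Q_sq: "u = \<one>" if u: "u \<in> cyc z" "u \<otimes> u = \<one>" for u
  proof -
    have uc: "u \<in> carrier G" using u cyc_subset[OF z(1)] by auto
    have "ord u dvd q" "ord u dvd 2" using Q_pow[OF u(1)] u(2) uc by (simp_all add: numeral_2_eq_2 flip: pow_eq_id)
    moreover have "coprime q 2" using oq by simp
    ultimately have "ord u = 1" using coprime_common_divisor_nat by blast
    then show ?thesis using ord_eq_1[OF uc] by simp
  qed
  have "V \<inter> cyc z = {\<one>}"
    using V_sq Q_sq subgroup.one_closed[OF subgroup_cyc[OF z(1)]] by auto
  then have ge: "4 * q \<le> card (V <#> cyc z)"
    using card_mult_le_card_Int[OF V(1) subgroup_cyc[OF z(1)]] V(2) card_cyc[OF z(1)] z by simp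
  have sub: "V <#> cyc z \<subseteq> carrier G" using V.subset cyc_subset[OF z(1)] by (rule set_mult_closed)
  have VQ: "V <#> cyc z = carrier G"
  proof (rule card_subset_eq[OF finite_carrier sub])
    have "card (V <#> cyc z) \<le> card (carrier G)" using sub by (intro card_mono) simp_all
    then show "card (V <#> cyc z) = card (carrier G)" using ge card by simp
  qed
  have decomp: thesis if x: "x \<in> carrier G" and H: "\<And>v u. v \<in> V \<Longrightarrow> u \<in> cyc z \<Longrightarrow> x = v \<otimes> u \<Longrightarrow> thesis" for x thesis
  proof -
    have "x \<in> V <#> cyc z" using x VQ by simp
    then show thesis using H by (auto simp: set_mult_def)
  qed
  have carr: "v \<in> carrier G" "u \<in> carrier G" if "v \<in> V" "u \<in> cyc z" for v u
    using that cyc_subset[OF z(1)] by auto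
  have sq: "(v \<otimes> u) \<otimes> (v \<otimes> u) = u \<otimes> u" if "v \<in> V" "u \<in> cyc z" for v u
  proof -
    have "(v \<otimes> u) \<otimes> (v \<otimes> u) = (v \<otimes> v) \<otimes> (u \<otimes> u)" using carr[OF that] by (simp add: m_ac)
    then show ?thesis using V_sq[OF that(1)] carr[OF that] by simp
  qed
  \<comment> \<open>Since \<open>q\<close> is odd, the \<open>q\<close>-th power is the projection
    onto \<open>V\<close>.\<close>
  have powq: "(v \<otimes> u) [^] q = v" if "v \<in> V" "u \<in> cyc z" for v u
    using carr[OF that] pow_q[OF that(1)] Q_pow[OF that(2)] by (simp add: nat_pow_distrib)
  have S2: "{x \<in> carrier G. ord x dvd 2} = V"
  proof (intro subset_antisym subsetI)
    fix x assume x: "x \<in> {x \<in> carrier G. ord x dvd 2}"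
    then have xc: "x \<in> carrier G" by simp
    obtain v u where vu: "v \<in> V" "u \<in> cyc z" "x = v \<otimes> u" by (rule decomp[OF xc])
    have "x [^] (2::nat) = \<one>" using x by (simp add: pow_eq_id)
    then have "u \<otimes> u = \<one>" using sq[OF vu(1,2)] vu(3) xc by (simp add: numeral_2_eq_2)
    then show "x \<in> V" using Q_sq[OF vu(2)] vu by simp
  next
    fix v assume v: "v \<in> V"
    then have "v [^] (2::nat) = \<one>" using V_sq[OF v] by (simp add: numeral_2_eq_2)
    then show "v \<in> {x \<in> carrier G. ord x dvd 2}" using v by (simp add: pow_eq_id)
  qed
  have Sq: "{x \<in> carrier G. ord x dvd q} = cyc z"
  proof (intro subset_antisym subsetI)
    fix x assume x: "x \<in> {x \<in> carrier G. ord x dvd q}"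
    then have xc: "x \<in> carrier G" by simp
    obtain v u where vu: "v \<in> V" "u \<in> cyc z" "x = v \<otimes> u" by (rule decomp[OF xc])
    have "x [^] q = \<one>" using x by (simp add: pow_eq_id)
    then have "v = \<one>" using powq[OF vu(1,2)] vu(3) by simp
    then show "x \<in> cyc z" using vu carr[OF vu(1,2)] by simp
  next
    fix u assume u: "u \<in> cyc z"
    then have "u \<in> carrier G" using cyc_subset[OF z(1)] by auto
    then show "u \<in> {x \<in> carrier G. ord x dvd q}" using Q_pow[OF u] by (simp add: pow_eq_id)
  qed
  have K: "ord x \<in> {1, 2, q, 2 * q}" if x: "x \<in> carrier G" for x
  proof -
    obtain v u where vu: "v \<in> V" "u \<in> cyc z" "x = v \<otimes> u" by (rule decomp[OF x])
    have "x [^] (2 * q) = (x [^] q) [^] (2::nat)" using x by (simp add: nat_pow_pow mult.commute)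
    also have "\<dots> = \<one>" using powq[OF vu(1,2)] vu(3) V_sq[OF vu(1)] vu(1) by (simp add: numeral_2_eq_2)
    finally have "ord x dvd 2 * q" using x by (simp add: pow_eq_id)
    then obtain a b where ab: "ord x = a * b" "a dvd 2" "b dvd q" using division_decomp by blast
    then have "a = 1 \<or> a = 2" "b = 1 \<or> b = q" using q two_is_prime_nat by (auto simp: prime_nat_iff)
    then show ?thesis using ab by auto
  qed
  have q12: "q \<noteq> 1" "q \<noteq> 2" "2 \<noteq> 2 * q" "1 \<noteq> 2 * q" "q \<noteq> 2 * q" using q by auto
  have c2: "card {x \<in> carrier G. ord x = 2} = 3"
  proof -
    have eq: "{x \<in> carrier G. ord x dvd 2} = {x \<in> carrier G. ord x = 1} \<union> {x \<in> carrier G. ord x = 2}"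
      using two_is_prime_nat by (auto simp: prime_nat_iff)
    have "card V = card {x \<in> carrier G. ord x = 1} + card {x \<in> carrier G. ord x = 2}"
      unfolding S2[symmetric] eq by (rule card_Un_disjoint) auto
    then show ?thesis using V(2) card_ord_1 by simp
  qed
  have cq: "card {x \<in> carrier G. ord x = q} = q - 1"
  proof -
    have eq: "{x \<in> carrier G. ord x dvd q} = {x \<in> carrier G. ord x = 1} \<union> {x \<in> carrier G. ord x = q}"
      using q by (auto simp: prime_nat_iff)
    have "card (cyc z) = card {x \<in> carrier G. ord x = 1} + card {x \<in> carrier G. ord x = q}"
      unfolding Sq[symmetric] eq by (rule card_Un_disjoint) (use q12 in auto)
    then show ?thesis using card_cyc[OF z(1)] z card_ord_1 by simp
  qed
  have "1 + 3 + (q - 1) + card {x \<in> carrier G. ord x = 2 * q} = 4 * q"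
    using sum_card_ord[of "{1, 2, q, 2 * q}"] K card c2 cq card_ord_1 q12 by simp
  then have c2q: "card {x \<in> carrier G. ord x = 2 * q} = 3 * (q - 1)" using q by simp
  have t: "totient q = q - 1" "totient (2 * q) = q - 1"
    using q oq totient_double[of q] by (simp_all add: totient_prime)
  show ?thesis
    using card_cyclic_subgroups[of "{1, 2, q, 2 * q}"] K c2 cq c2q card_ord_1 q12 q by (simp add: t)
qed

end

section \<open>Counting cyclic subgroups of the listed groups\<close>

lemma card_cyclic_subgroups_iso:
  assumes "G \<cong> H" and G: "group G" "finite (carrier G)" and H: "group H"
  shows "card (cyclic_subgroups G) = card (cyclic_subgroups H)"
proof -
  obtain h where h: "h \<in> iso G H" using assms by (auto simp: is_iso_def)
  have finH: "finite (carrier H)" using iso_finite[OF assms(1)] G by simp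
  interpret G: finite_group G using G by (simp add: finite_group_def finite_group_axioms_def)
  interpret H: finite_group H using H finH by (simp add: finite_group_def finite_group_axioms_def)
  interpret h: group_hom G H h
    using h by unfold_locales (simp add: iso_def)
  have bij: "bij_betw h (carrier G) (carrier H)" using h by (simp add: iso_def)
  have cyc: "H.cyc (h x) = h ` G.cyc x" if "x \<in> carrier G" for x
    using that by (simp add: G.cyc_powers H.cyc_powers image_image h.hom_nat_pow)
  have "cyclic_subgroups H = (\<lambda>D. h ` D) ` cyclic_subgroups G"
  proof -
    have "cyclic_subgroups H = H.cyc ` h ` carrier G"
      using bij by (simp add: H.cyclic_subgroups_eq bij_betw_def)
    also have "\<dots> = (\<lambda>x. h ` G.cyc x) ` carrier G"
      unfolding image_image by (rule image_cong) (simp_all add: cyc)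
    finally show ?thesis by (simp add: G.cyclic_subgroups_eq image_image)
  qed
  moreover have "inj_on (\<lambda>D. h ` D) (cyclic_subgroups G)"
  proof (rule inj_on_subset)
    show "inj_on (\<lambda>D. h ` D) (Pow (carrier G))"
      using bij by (intro inj_on_image_Pow) (simp add: bij_betw_def)
    show "cyclic_subgroups G \<subseteq> Pow (carrier G)"
      using G.cyc_subset by (auto simp: G.cyclic_subgroups_eq)
  qed
  ultimately show ?thesis by (simp add: card_image)
qed

lemma finite_group_metacyclic:
  assumes "n > 0" "k > 0" "[r ^ k = 1] (mod n)" "[r * s = s] (mod n)"
  shows "finite_group (metacyclic n k r s)"
  using group_metacyclic[OF assms] by (simp add: finite_group_def finite_group_axioms_def carrier_metacyclic)

text \<open>Restates a count of roots of the identity as the length of a filtered list, which can be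
  evaluated.\<close>

lemma card_roots_metacyclic:
  "card {x \<in> carrier (metacyclic n k r s). x [^]\<^bsub>metacyclic n k r s\<^esub> e = \<one>\<^bsub>metacyclic n k r s\<^esub>} =
    length (filter (\<lambda>x. x [^]\<^bsub>metacyclic n k r s\<^esub> e = (0, 0)) (List.product [0..<n] [0..<k]))"
    (is "_ = length ?xs")
proof -
  have eq: "{x \<in> carrier (metacyclic n k r s). x [^]\<^bsub>metacyclic n k r s\<^esub> e = \<one>\<^bsub>metacyclic n k r s\<^esub>} = set ?xs"
    unfolding carrier_metacyclic one_metacyclic by auto
  have dist: "distinct ?xs"
    by (intro distinct_filter distinct_product distinct_upt)
  show ?thesis by (simp only: eq distinct_card[OF dist])
qed

context finite_group
begin

text \<open>Orders are replaced by root counts, because powers can be computed in a model while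
  \<open>ord\<close> cannot be evaluated directly.\<close>

lemma card_ord_prime_power:
  assumes p: "prime p"
  shows "card {x \<in> carrier G. ord x = p ^ Suc k} =
    card {x \<in> carrier G. x [^] (p ^ Suc k) = \<one>} - card {x \<in> carrier G. x [^] (p ^ k) = \<one>}"
proof -
  have iff: "ord x = p ^ Suc k \<longleftrightarrow> ord x dvd p ^ Suc k \<and> \<not> ord x dvd p ^ k" if "x \<in> carrier G" for x
  proof
    assume "ord x = p ^ Suc k"
    moreover have "\<not> p ^ Suc k dvd p ^ k"
      using power_dvd_imp_le[of p "Suc k" k] prime_gt_1_nat[OF p] by auto
    ultimately show "ord x dvd p ^ Suc k \<and> \<not> ord x dvd p ^ k" by simp
  next
    assume *: "ord x dvd p ^ Suc k \<and> \<not> ord x dvd p ^ k"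
    then obtain i where i: "i \<le> Suc k" "ord x = p ^ i"
      using divides_primepow_nat[OF p] by blast
    have "\<not> i \<le> k" using * i by (auto simp: le_imp_power_dvd)
    then show "ord x = p ^ Suc k" using i by (simp add: le_Suc_eq)
  qed
  have dvd: "m dvd p ^ Suc k" if "m dvd p ^ k" for m
    using that by (simp add: dvd_mult)
  have "{x \<in> carrier G. ord x = p ^ Suc k} =
      {x \<in> carrier G. x [^] (p ^ Suc k) = \<one>} - {x \<in> carrier G. x [^] (p ^ k) = \<one>}"
    by (auto simp: iff pow_eq_id simp del: power_Suc)
  moreover have "{x \<in> carrier G. x [^] (p ^ k) = \<one>} \<subseteq> {x \<in> carrier G. x [^] (p ^ Suc k) = \<one>}"
    using dvd by (auto simp: pow_eq_id simp del: power_Suc)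
  ultimately show ?thesis using finite_carrier by (simp add: card_Diff_subset del: power_Suc)
qed

text \<open>The square roots of the identity correspond to the subgroups of order 1 and 2; a
  subgroup of order 4 has two generators and one of order 8 has four.\<close>

lemma card_cyclic_subgroups_exponent_8:
  assumes "\<And>x. x \<in> carrier G \<Longrightarrow> x [^] (8::nat) = \<one>"
  shows "card (cyclic_subgroups G) = card {x \<in> carrier G. x [^] (2::nat) = \<one>}
    + (card {x \<in> carrier G. x [^] (4::nat) = \<one>} - card {x \<in> carrier G. x [^] (2::nat) = \<one>}) div 2
    + (order G - card {x \<in> carrier G. x [^] (4::nat) = \<one>}) div 4"
proof -
  have K: "ord x \<in> {1, 2, 4, 8}" if x: "x \<in> carrier G" for x
  proof -
    have "ord x dvd 2 ^ 3" using assms[OF x] x by (simp add: pow_eq_id)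
    then obtain i where i: "i \<le> 3" "ord x = 2 ^ i"
      using divides_primepow_nat[of 2 "ord x" 3] by auto
    then have "i = 0 \<or> i = 1 \<or> i = 2 \<or> i = 3" by auto
    then show ?thesis using i by auto
  qed
  have all: "{x \<in> carrier G. x [^] (8::nat) = \<one>} = carrier G" using assms by auto
  have one: "{x \<in> carrier G. x [^] (1::nat) = \<one>} = {\<one>}" by auto
  have pos: "card {x \<in> carrier G. x [^] (2::nat) = \<one>} > 0"
    using finite_carrier by (auto simp: card_gt_0_iff intro!: exI[of _ \<one>])
  have p2: "prime (2::nat)" by simp
  have tot: "totient 2 = 1" "totient 4 = 2" "totient 8 = 4" "totient 1 = 1"
    by (simp_all add: totient_values)
  have s: "(2::nat) ^ Suc 0 = 2" "(2::nat) ^ Suc 1 = 4" "(2::nat) ^ Suc 2 = 8"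
    "(2::nat) ^ 0 = 1" "(2::nat) ^ 1 = 2" "(2::nat) ^ 2 = 4" by simp_all
  have "card (cyclic_subgroups G) = (\<Sum>k\<in>{1, 2, 4, 8}. card {x \<in> carrier G. ord x = k} div totient k)"
    by (rule card_cyclic_subgroups) (simp_all add: K[simplified])
  also have "\<dots> = card {x \<in> carrier G. ord x = 1} div totient 1
      + card {x \<in> carrier G. ord x = 2} div totient 2
      + card {x \<in> carrier G. ord x = 4} div totient 4
      + card {x \<in> carrier G. ord x = 8} div totient 8" by simp
  finally show ?thesis
    using card_ord_prime_power[OF p2, of 0, unfolded s] card_ord_prime_power[OF p2, of 1, unfolded s]
      card_ord_prime_power[OF p2, of 2, unfolded s] pos
    unfolding tot card_ord_1 all one order_def by simp
qed

lemma card_cyclic_subgroups_exponent_9: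
  assumes "\<And>x. x \<in> carrier G \<Longrightarrow> x [^] (9::nat) = \<one>"
  shows "card (cyclic_subgroups G) = Suc ((card {x \<in> carrier G. x [^] (3::nat) = \<one>} - 1) div 2)
    + (order G - card {x \<in> carrier G. x [^] (3::nat) = \<one>}) div 6"
proof -
  have K: "ord x \<in> {1, 3, 9}" if x: "x \<in> carrier G" for x
  proof -
    have "ord x dvd 3 ^ 2" using assms[OF x] x by (simp add: pow_eq_id)
    then obtain i where i: "i \<le> 2" "ord x = 3 ^ i"
      using divides_primepow_nat[of 3 "ord x" 2] by auto
    then have "i = 0 \<or> i = 1 \<or> i = 2" by auto
    then show ?thesis using i by auto
  qed
  have all: "{x \<in> carrier G. x [^] (9::nat) = \<one>} = carrier G" using assms by auto
  have one: "{x \<in> carrier G. x [^] (1::nat) = \<one>} = {\<one>}" by auto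
  have p3: "prime (3::nat)" by simp
  have tot: "totient 3 = 2" "totient 9 = 6" "totient 1 = 1" by (simp_all add: totient_values)
  have s: "(3::nat) ^ Suc 0 = 3" "(3::nat) ^ Suc 1 = 9" "(3::nat) ^ 0 = 1" "(3::nat) ^ 1 = 3"
    by simp_all
  have "card (cyclic_subgroups G) = (\<Sum>k\<in>{1, 3, 9}. card {x \<in> carrier G. ord x = k} div totient k)"
    by (rule card_cyclic_subgroups) (simp_all add: K[simplified])
  also have "\<dots> = card {x \<in> carrier G. ord x = 1} div totient 1
      + card {x \<in> carrier G. ord x = 3} div totient 3
      + card {x \<in> carrier G. ord x = 9} div totient 9" by simp
  finally show ?thesis
    using card_ord_prime_power[OF p3, of 0, unfolded s] card_ord_prime_power[OF p3, of 1, unfolded s]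
    unfolding tot card_ord_1 all one order_def by simp
qed

end

lemma upt_values: "[0..<2] = [0, 1]" "[0..<3] = [0, 1, 2]" "[0..<8] = [0, 1, 2, 3, 4, 5, 6, 7]"
  "[0..<9] = [0, 1, 2, 3, 4, 5, 6, 7, 8]"
  by (simp_all add: upt_rec)

lemma card_cyclic_subgroups_metacyclic_8:
  assumes fg: "finite_group (metacyclic 8 2 r s)"
    and e8: "filter (\<lambda>x. x [^]\<^bsub>metacyclic 8 2 r s\<^esub> (8::nat) \<noteq> (0, 0)) (List.product [0..<8] [0..<2]) = []"
    and n: "(length (filter (\<lambda>x. x [^]\<^bsub>metacyclic 8 2 r s\<^esub> (2::nat) = (0, 0)) (List.product [0..<8] [0..<2])),
      length (filter (\<lambda>x. x [^]\<^bsub>metacyclic 8 2 r s\<^esub> (4::nat) = (0, 0)) (List.product [0..<8] [0..<2])))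
      \<in> {(4, 8), (2, 12)}"
  shows "card (cyclic_subgroups (metacyclic 8 2 r s)) = 8"
proof -
  have "x [^]\<^bsub>metacyclic 8 2 r s\<^esub> (8::nat) = \<one>\<^bsub>metacyclic 8 2 r s\<^esub>" if "x \<in> carrier (metacyclic 8 2 r s)" for x
    using e8 that unfolding filter_empty_conv carrier_metacyclic one_metacyclic by (cases x) auto
  from finite_group.card_cyclic_subgroups_exponent_8[OF fg this] n show ?thesis
    unfolding card_roots_metacyclic by (auto simp: order_def carrier_metacyclic card_cartesian_product)
qed

text \<open>Nine cube roots of the identity among 27 elements give 1 + 8/2 + 18/6 = 8.\<close>

lemma card_cyclic_subgroups_metacyclic_9:
  assumes fg: "finite_group (metacyclic 9 3 r s)"
    and e9: "filter (\<lambda>x. x [^]\<^bsub>metacyclic 9 3 r s\<^esub> (9::nat) \<noteq> (0, 0)) (List.product [0..<9] [0..<3]) = []"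
    and n: "length (filter (\<lambda>x. x [^]\<^bsub>metacyclic 9 3 r s\<^esub> (3::nat) = (0, 0)) (List.product [0..<9] [0..<3])) = 9"
  shows "card (cyclic_subgroups (metacyclic 9 3 r s)) = 8"
proof -
  have "x [^]\<^bsub>metacyclic 9 3 r s\<^esub> (9::nat) = \<one>\<^bsub>metacyclic 9 3 r s\<^esub>" if "x \<in> carrier (metacyclic 9 3 r s)" for x
    using e9 that unfolding filter_empty_conv carrier_metacyclic one_metacyclic by (cases x) auto
  from finite_group.card_cyclic_subgroups_exponent_9[OF fg this] n show ?thesis
    unfolding card_roots_metacyclic by (auto simp: order_def carrier_metacyclic card_cartesian_product)
qed

lemma card_cyclic_subgroups_metacyclic:
  "card (cyclic_subgroups (metacyclic 8 2 1 0)) = 8"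
  "card (cyclic_subgroups (metacyclic 8 2 5 0)) = 8"
  "card (cyclic_subgroups (metacyclic 8 2 7 4)) = 8"
  "card (cyclic_subgroups (metacyclic 9 3 1 0)) = 8"
  "card (cyclic_subgroups (metacyclic 9 3 4 0)) = 8"
proof -
  note eval = metacyclic_power mult_metacyclic one_metacyclic nat_pow_0
  show "card (cyclic_subgroups (metacyclic 8 2 1 0)) = 8"
    by (rule card_cyclic_subgroups_metacyclic_8, rule finite_group_metacyclic)
      (simp_all add: upt_values eval cong_def)
  show "card (cyclic_subgroups (metacyclic 8 2 5 0)) = 8"
    by (rule card_cyclic_subgroups_metacyclic_8, rule finite_group_metacyclic)
      (simp_all add: upt_values eval cong_def)
  show "card (cyclic_subgroups (metacyclic 8 2 7 4)) = 8"
    by (rule card_cyclic_subgroups_metacyclic_8, rule finite_group_metacyclic)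
      (simp_all add: upt_values eval cong_def)
  show "card (cyclic_subgroups (metacyclic 9 3 1 0)) = 8"
    by (rule card_cyclic_subgroups_metacyclic_9, rule finite_group_metacyclic)
      (simp_all add: upt_values eval cong_def)
  show "card (cyclic_subgroups (metacyclic 9 3 4 0)) = 8"
    by (rule card_cyclic_subgroups_metacyclic_9, rule finite_group_metacyclic)
      (simp_all add: upt_values eval cong_def)
qed

section \<open>Counting in A_4 and in the elementary abelian group of order 8\<close>

lemma dvd_prime_cases: "prime (p::nat) \<Longrightarrow> m dvd p \<Longrightarrow> m = 1 \<or> m = p"
  by (simp add: prime_nat_iff)

text \<open>Booleans stand for the field with two elements, with inequality as addition. The three
  cases are the identity, the linear map taking (a, b) to (b, a + b), and its square.\<close>

fun rot :: "nat \<Rightarrow> bool \<times> bool \<Rightarrow> bool \<times> bool" where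
  "rot k (a, b) = (if k = 0 then (a, b) else if k = 1 then (b, a \<noteq> b) else (a \<noteq> b, a))"

fun xor2 :: "bool \<times> bool \<Rightarrow> bool \<times> bool \<Rightarrow> bool \<times> bool" where
  "xor2 (a, b) (c, d) = (a \<noteq> c, b \<noteq> d)"

text \<open>A model of \<open>A\<^sub>4\<close>: the automorphism \<open>rot 1\<close> of order 3 permutes the involutions of \<open>C\<^sub>2 \<times> C\<^sub>2\<close> cyclically.\<close>

definition klein_rot :: "((bool \<times> bool) \<times> nat) monoid" where
  "klein_rot = \<lparr>carrier = UNIV \<times> {..<3},
    mult = (\<lambda>(u, k) (v, l). (xor2 u (rot k v), (k + l) mod 3)), one = ((False, False), 0)\<rparr>"

lemma klein_rot_simps:
  "carrier klein_rot = UNIV \<times> {..<3}"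
  "(u, k) \<otimes>\<^bsub>klein_rot\<^esub> (v, l) = (xor2 u (rot k v), (k + l) mod 3)"
  "\<one>\<^bsub>klein_rot\<^esub> = ((False, False), 0)"
  by (simp_all add: klein_rot_def)

lemma xor2_assoc: "xor2 (xor2 u v) w = xor2 u (xor2 v w)"
  by (cases u; cases v; cases w) auto

lemma rot_xor2: "rot k (xor2 u v) = xor2 (rot k u) (rot k v)"
  by (cases u; cases v) auto

lemma less_3_cases: "(k::nat) < 3 \<Longrightarrow> k = 0 \<or> k = 1 \<or> k = 2"
  by auto

lemma rot_add: "k < 3 \<Longrightarrow> l < 3 \<Longrightarrow> rot ((k + l) mod 3) u = rot k (rot l u)"
  by (cases u, drule less_3_cases, drule less_3_cases) auto

lemma finite_group_klein_rot: "finite_group klein_rot"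
proof -
  have "group klein_rot"
  proof (rule groupI)
    fix x y z
    assume xyz: "x \<in> carrier klein_rot" "y \<in> carrier klein_rot" "z \<in> carrier klein_rot"
    obtain u k v l w m where e: "x = (u, k)" "y = (v, l)" "z = (w, m)" by (cases x; cases y; cases z) blast
    have "k < 3" "l < 3" using xyz e by (simp_all add: klein_rot_simps)
    then show "x \<otimes>\<^bsub>klein_rot\<^esub> y \<otimes>\<^bsub>klein_rot\<^esub> z = x \<otimes>\<^bsub>klein_rot\<^esub> (y \<otimes>\<^bsub>klein_rot\<^esub> z)"
      unfolding e klein_rot_simps rot_xor2 xor2_assoc
      by (simp only: rot_add) (simp add: mod_simps add.assoc)
  next
    fix x assume x: "x \<in> carrier klein_rot"
    then obtain a b k where e: "x = ((a, b), k)" "k < 3" by (auto simp: klein_rot_simps)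
    then show "\<one>\<^bsub>klein_rot\<^esub> \<otimes>\<^bsub>klein_rot\<^esub> x = x" by (simp add: klein_rot_simps)
    have "(rot ((3 - k) mod 3) (a, b), (3 - k) mod 3) \<otimes>\<^bsub>klein_rot\<^esub> x = \<one>\<^bsub>klein_rot\<^esub>"
      using less_3_cases[OF e(2)] by (auto simp: e klein_rot_simps)
    then show "\<exists>y\<in>carrier klein_rot. y \<otimes>\<^bsub>klein_rot\<^esub> x = \<one>\<^bsub>klein_rot\<^esub>"
      by (rule bexI) (simp add: klein_rot_simps)
  qed (auto simp: klein_rot_simps)
  then show ?thesis by (simp add: finite_group_def finite_group_axioms_def klein_rot_simps)
qed

text \<open>The recognition lemma of the classification is applied to the explicit model, so no
  permutations have to be listed. The census 1 + 3 + 8 of orders 1, 2, 3 yields 1 + 3 + 4 cyclic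
  subgroups.\<close>

lemma card_cyclic_subgroups_alt_group_4: "card (cyclic_subgroups (alt_group 4)) = 8"
proof -
  interpret finite_group klein_rot by (rule finite_group_klein_rot)
  have ord_0: "ord ((a, b), 0) dvd 2" for a b
  proof -
    let ?x = "((a, b), 0::nat)"
    have x: "?x \<in> carrier klein_rot" by (simp add: klein_rot_simps)
    have "?x [^]\<^bsub>klein_rot\<^esub> (2::nat) = ?x \<otimes>\<^bsub>klein_rot\<^esub> ?x"
      using x by (simp add: numeral_2_eq_2)
    also have "\<dots> = \<one>\<^bsub>klein_rot\<^esub>" by (simp add: klein_rot_simps)
    finally show ?thesis by (simp only: pow_eq_id[OF x])
  qed
  have ord_pos: "ord ((a, b), k) = 3" if k: "k = 1 \<or> k = 2" for a b k
  proof -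
    let ?x = "((a, b), k)"
    have x: "?x \<in> carrier klein_rot" using k by (auto simp: klein_rot_simps)
    have "?x [^]\<^bsub>klein_rot\<^esub> (3::nat) = ?x \<otimes>\<^bsub>klein_rot\<^esub> ?x \<otimes>\<^bsub>klein_rot\<^esub> ?x"
      using x by (simp add: numeral_3_eq_3)
    also have "\<dots> = \<one>\<^bsub>klein_rot\<^esub>" using k by (elim disjE; cases a; cases b) (simp_all add: klein_rot_simps)
    finally have "ord ?x dvd 3" by (simp only: pow_eq_id[OF x])
    moreover have "ord ?x \<noteq> 1" using k unfolding ord_eq_1[OF x] by (auto simp: klein_rot_simps)
    ultimately show ?thesis using dvd_prime_cases[of 3 "ord ?x"] by simp
  qed
  have K: "ord x \<in> {1, 2, 3}" if "x \<in> carrier klein_rot" for x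
  proof -
    obtain a b k where x: "x = ((a, b), k)" by (cases x) auto
    have "k = 0 \<or> k = 1 \<or> k = 2" using that less_3_cases by (auto simp: x klein_rot_simps)
    then have "ord x dvd 2 \<or> ord x = 3" using ord_0 ord_pos by (auto simp: x)
    then show ?thesis using dvd_prime_cases[of 2] by auto
  qed
  have "{x \<in> carrier klein_rot. ord x = 3} = UNIV \<times> {1, 2}"
  proof (intro equalityI subsetI)
    fix x assume x: "x \<in> {x \<in> carrier klein_rot. ord x = 3}"
    obtain a b k where e: "x = ((a, b), k)" by (cases x) auto
    have "k = 0 \<or> k = 1 \<or> k = 2" using x less_3_cases by (auto simp: e klein_rot_simps)
    moreover have "k \<noteq> 0"
    proof
      assume "k = 0"
      then have "(3::nat) dvd 2" using ord_0[of a b] x by (simp add: e)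
      then show False by simp
    qed
    ultimately show "x \<in> UNIV \<times> {1, 2}" by (auto simp: e)
  next
    fix x :: "(bool \<times> bool) \<times> nat" assume x: "x \<in> UNIV \<times> {1, 2}"
    obtain a b k where e: "x = ((a, b), k)" by (cases x) auto
    have k: "k = 1 \<or> k = 2" using x by (simp add: e)
    then have "x \<in> carrier klein_rot" by (auto simp: e klein_rot_simps)
    then show "x \<in> {x \<in> carrier klein_rot. ord x = 3}" using ord_pos[OF k] by (simp add: e)
  qed
  then have n3: "card {x \<in> carrier klein_rot. ord x = 3} = 8"
    by (simp add: card_cartesian_product card_UNIV_bool flip: UNIV_Times_UNIV)
  have c12: "card (carrier klein_rot) = 12"
    by (simp add: klein_rot_simps card_cartesian_product flip: UNIV_Times_UNIV)
  have tot: "totient 1 = 1" "totient 2 = 1" "totient 3 = 2" by (simp_all add: totient_values)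
  have "(\<Sum>k\<in>{1, 2, 3}. card {x \<in> carrier klein_rot. ord x = k}) = card (carrier klein_rot)"
    by (rule sum_card_ord) (simp_all add: K[simplified])
  then have n2: "card {x \<in> carrier klein_rot. ord x = 2} = 3"
    using n3 c12 card_ord_1 by simp
  have "card (cyclic_subgroups klein_rot) = (\<Sum>k\<in>{1, 2, 3}. card {x \<in> carrier klein_rot. ord x = k} div totient k)"
    by (rule card_cyclic_subgroups) (simp_all add: K[simplified])
  then have eight: "card (cyclic_subgroups klein_rot) = 8"
    using n2 n3 card_ord_1 tot by simp
  have "card {D \<in> cyclic_subgroups klein_rot. card D = 3} = 4"
    using card_ord_eq[of 3] n3 tot by simp
  with c12 K have "klein_rot \<cong> alt_group 4" by (rule iso_alt_group_4)
  from card_cyclic_subgroups_iso[OF this is_group finite_carrier alt_group_is_group] eight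
  show ?thesis by simp
qed

lemma card_cyclic_subgroups_elementary_abelian_8:
  "card (cyclic_subgroups (integer_mod_group 2 \<times>\<times> integer_mod_group 2 \<times>\<times> integer_mod_group 2)) = 8"
proof -
  let ?Z = "integer_mod_group 2 \<times>\<times> integer_mod_group 2 \<times>\<times> integer_mod_group 2"
  have "group ?Z" by (intro DirProd_group group_integer_mod_group)
  then interpret finite_group ?Z
    by (simp add: finite_group_def finite_group_axioms_def carrier_integer_mod_group)
  have sq: "x [^]\<^bsub>?Z\<^esub> (2::nat) = \<one>\<^bsub>?Z\<^esub>" if "x \<in> carrier ?Z" for x
    using that by (cases x) (simp add: numeral_2_eq_2 one_DirProd mult_DirProd mod_simps flip: mult_2)
  have K: "ord x \<in> {1, 2}" if "x \<in> carrier ?Z" for x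
  proof -
    have "ord x dvd 2" using sq[OF that] unfolding pow_eq_id[OF that] .
    then show ?thesis using dvd_prime_cases[of 2 "ord x"] by simp
  qed
  have tot: "totient 1 = 1" "totient 2 = 1" by simp_all
  have "(\<Sum>k\<in>{1, 2}. card {x \<in> carrier ?Z. ord x = k}) = card (carrier ?Z)"
    by (rule sum_card_ord) (simp_all add: K[simplified])
  moreover have "card (cyclic_subgroups ?Z) = (\<Sum>k\<in>{1, 2}. card {x \<in> carrier ?Z. ord x = k} div totient k)"
    by (rule card_cyclic_subgroups) (simp_all add: K[simplified])
  ultimately have "card (cyclic_subgroups ?Z) = card (carrier ?Z)" using tot by simp
  then show ?thesis by (simp add: carrier_integer_mod_group card_cartesian_product)
qed

section \<open>Cyclic groups with eight divisors, and both directions of the equivalence\<close>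

lemma finite_group_integer_mod_group: "n > 0 \<Longrightarrow> finite_group (integer_mod_group n)"
  by (simp add: finite_group_def finite_group_axioms_def carrier_integer_mod_group)

lemma card_cyclic_subgroups_integer_mod_group:
  assumes n: "n > 0"
  shows "card (cyclic_subgroups (integer_mod_group n)) = card {d. d dvd n}"
proof -
  interpret finite_group "integer_mod_group n" using n by (rule finite_group_integer_mod_group)
  have "cyclic_group (integer_mod_group n)"
  proof -
    \<comment> \<open>Reducing the generator modulo \<open>n\<close> covers \<open>n = 1\<close>,
      where 0 is the only element.\<close>
    have 1: "1 mod int n \<in> carrier (integer_mod_group n)"
      using n by (simp add: carrier_integer_mod_group)
    have "carrier (integer_mod_group n) \<subseteq> cyc (1 mod int n)"
    proof
      fix i assume "i \<in> carrier (integer_mod_group n)"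
      then have i: "0 \<le> i" "i < int n" using n by (simp_all add: carrier_integer_mod_group)
      have "(1 mod int n) [^]\<^bsub>integer_mod_group n\<^esub> nat i = i"
        unfolding pow_integer_mod_group using i by (simp add: mod_simps)
      then show "i \<in> cyc (1 mod int n)" unfolding cyc_powers[OF 1] by (metis rangeI)
    qed
    then show ?thesis unfolding cyclic_group_iff using 1 cyc_subset[OF 1] by blast
  qed
  then have "card (cyclic_subgroups (integer_mod_group n)) = card {d. d dvd order (integer_mod_group n)}"
    by (rule card_cyclic_subgroups_cyclic)
  moreover have "order (integer_mod_group n) = n"
    using n by (simp add: order_def carrier_integer_mod_group)
  ultimately show ?thesis by simp
qed

lemma (in finite_group) card_cyclic_subgroups_eqI:
  "G \<cong> H \<Longrightarrow> group H \<Longrightarrow> card (cyclic_subgroups H) = m \<Longrightarrow> card (cyclic_subgroups G) = m"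
  by (rule HOL.trans[OF card_cyclic_subgroups_iso[OF _ is_group finite_carrier]])

lemma card_divisors_8:
  fixes p q r :: nat
  assumes p: "prime p"
  shows "card {d. d dvd p ^ 7} = 8"
    and "prime q \<Longrightarrow> p \<noteq> q \<Longrightarrow> card {d. d dvd p ^ 3 * q} = 8"
    and "prime q \<Longrightarrow> prime r \<Longrightarrow> p \<noteq> q \<Longrightarrow> p \<noteq> r \<Longrightarrow> q \<noteq> r \<Longrightarrow> card {d. d dvd p * q * r} = 8"
proof -
  have two: "card {d. d dvd s} = 2" if "prime s" for s :: nat
    using card_divisors_prime_power[OF that, of 1] by simp
  show "card {d. d dvd p ^ 7} = 8" using card_divisors_prime_power[OF p, of 7] by simp
  show "card {d. d dvd p ^ 3 * q} = 8" if q: "prime q" "p \<noteq> q"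
  proof -
    have "coprime (p ^ 3) q" using primes_coprime[OF p q] by simp
    then show ?thesis
      using card_divisors_mult_coprime[of "p ^ 3" q] card_divisors_prime_power[OF p, of 3] two[OF q(1)]
        prime_gt_0_nat[OF p] prime_gt_0_nat[OF q(1)] by simp
  qed
  show "card {d. d dvd p * q * r} = 8" if q: "prime q" "prime r" "p \<noteq> q" "p \<noteq> r" "q \<noteq> r"
  proof -
    have c: "coprime p q" "coprime (p * q) r"
      using primes_coprime[OF p q(1,3)] primes_coprime[OF p q(2,4)] primes_coprime[OF q(1,2,5)]
      by (simp_all add: coprime_mult_left_iff)
    have pos: "p > 0" "q > 0" "r > 0" using p q by (simp_all add: prime_gt_0_nat)
    show ?thesis
      using card_divisors_mult_coprime[OF c(1)] card_divisors_mult_coprime[OF c(2)] two[OF p]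
        two[OF q(1)] two[OF q(2)] pos by simp
  qed
qed

lemma card_cyclic_subgroups_integer_mod_group_8:
  "n > 0 \<Longrightarrow> card {d. d dvd n} = 8 \<Longrightarrow> card (cyclic_subgroups (integer_mod_group n)) = 8"
  by (simp add: card_cyclic_subgroups_integer_mod_group)

lemma group_metacyclic_values:
  "group (metacyclic 8 2 1 0)" "group (metacyclic 8 2 5 0)" "group (metacyclic 8 2 7 4)"
  "group (metacyclic 9 3 1 0)" "group (metacyclic 9 3 4 0)"
  by (rule group_metacyclic; simp add: cong_def)+

theorem theorem4p3:
  fixes G :: "('a, 'b) monoid_scheme"
  assumes "group G" and "finite (carrier G)"
  shows "card (cyclic_subgroups G) = 8 \<longleftrightarrow>
    (\<exists>p q r :: nat. prime p \<and> prime q \<and> prime r \<and> p < q \<and> q < r \<and>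
      ((G \<cong> integer_mod_group (p * q * r) \<or>
        G \<cong> integer_mod_group (p ^ 3 * q) \<or>
        G \<cong> integer_mod_group (p * q ^ 3) \<or>
        G \<cong> integer_mod_group (p ^ 7) \<or>
        (comm_group G \<and> \<not> cyclic_group G \<and> order G = 4 * q)) \<or>
       (G \<cong> integer_mod_group (2 ^ 3) \<times>\<times> integer_mod_group 2 \<or>
        G \<cong> integer_mod_group 2 \<times>\<times> integer_mod_group 2 \<times>\<times> integer_mod_group 2 \<or>
        G \<cong> integer_mod_group (3 ^ 2) \<times>\<times> integer_mod_group 3) \<or>
       (G \<cong> G11 \<or> G \<cong> G14 \<or> G \<cong> G27 \<or> G \<cong> alt_group 4)))"
    (is "_ \<longleftrightarrow> (\<exists>p q r. prime p \<and> prime q \<and> prime r \<and> p < q \<and> q < r \<and> (?A p q r \<or> ?B \<or> ?C))")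
proof
  interpret finite_group G using assms by (simp add: finite_group_def finite_group_axioms_def)
  have pow: "(2::nat) ^ 3 = 8" "(3::nat) ^ 2 = 9" by simp_all
  have "metacyclic 8 2 1 0 \<cong> integer_mod_group (2 ^ 3) \<times>\<times> integer_mod_group 2"
    "metacyclic 9 3 1 0 \<cong> integer_mod_group (3 ^ 2) \<times>\<times> integer_mod_group 3"
    unfolding pow by (rule metacyclic_iso_DirProd; simp)+
  note isos = this metacyclic_iso_G11 metacyclic_iso_G14 metacyclic_iso_G27
  note grps = group_metacyclic_values(1,4,2,3,5)
  {
    assume eight: "card (cyclic_subgroups G) = 8"
    show "\<exists>p q r :: nat. prime p \<and> prime q \<and> prime r \<and> p < q \<and> q < r \<and> (?A p q r \<or> ?B \<or> ?C)" (is "\<exists>p q r. ?P p q r")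
    proof (cases "cyclic_group G")
      case True
      have iso: "G \<cong> integer_mod_group (order G)"
        using cyclic_iso_integer_mod_group[OF True] by (rule group.iso_sym[OF group_integer_mod_group])
      have "order G > 0" using order_gt_0_iff_finite finite_carrier by blast
      moreover have "card {d. d dvd order G} = 8" using card_cyclic_subgroups_cyclic[OF True] eight by simp
      ultimately show ?thesis
      proof (cases rule: card_divisors_eq_8)
        case (1 p)
        \<comment> \<open>The group fixes \<open>p\<close>; larger primes complete the required
          increasing triple.\<close>
        obtain q where q: "prime q" "p < q" using bigger_prime[of p] by auto
        obtain r where r: "prime r" "q < r" using bigger_prime[of q] by auto
        have "G \<cong> integer_mod_group (p ^ 7)" using iso 1 by simp
        then have "?P p q r" using 1(1) q r by (intro conjI) simp_all
        then show ?thesis by (intro exI)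
      next
        case (2 p q)
        show ?thesis
        proof (cases "p < q")
          case True
          obtain r where r: "prime r" "q < r" using bigger_prime[of q] by auto
          have "G \<cong> integer_mod_group (p ^ 3 * q)" using iso 2 by simp
          then have "?P p q r" using 2(1,2) True r by (intro conjI) simp_all
          then show ?thesis by (intro exI)
        next
          case False
          \<comment> \<open>When the cubed prime is the larger one, the roles are exchanged and the
            group falls under the shape with the cube on the second prime.\<close>
          then have qp: "q < p" using 2(3) by simp
          obtain r where r: "prime r" "p < r" using bigger_prime[of p] by auto
          have "G \<cong> integer_mod_group (q * p ^ 3)" using iso 2 by (simp add: mult.commute)
          then have "?P q p r" using 2(1,2) qp r by (intro conjI) simp_all
          then show ?thesis by (intro exI)
        qed
      next
        case (3 p q r)
        have "G \<cong> integer_mod_group (p * q * r)" using iso 3 by simp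
        then have "?P p q r" using 3(1-5) by (intro conjI) simp_all
        then show ?thesis by (intro exI)
      qed
    next
      case False
      have primes: "prime (2::nat)" "prime (3::nat)" "prime (5::nat)" "(2::nat) < 3" "(3::nat) < 5"
        by simp_all
      \<comment> \<open>The groups of (b) and (c) are fixed, so 2, 3, 5 serve as the increasing
        primes.\<close>
      have special: ?thesis if "?B \<or> ?C"
        by (rule exI[of _ 2], rule exI[of _ 3], rule exI[of _ 5])
          (rule conjI[OF primes(1) conjI[OF primes(2) conjI[OF primes(3) conjI[OF primes(4) conjI[OF primes(5) disjI2[OF that]]]]]])
      have iso: "G \<cong> H" if "metacyclic n k r s \<cong> G" "group (metacyclic n k r s)" "metacyclic n k r s \<cong> H"
        for n k r s and H :: "generator word set set monoid"
        by (rule iso_trans[OF group.iso_sym[OF that(2,1)] that(3)])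
      have iso': "G \<cong> H" if "metacyclic n k r s \<cong> G" "group (metacyclic n k r s)" "metacyclic n k r s \<cong> H"
        for n k r s and H :: "(int \<times> int) monoid"
        by (rule iso_trans[OF group.iso_sym[OF that(2,1)] that(3)])
      from non_cyclic_cases[OF eight False] show ?thesis
      proof (elim disjE exE conjE)
        fix q assume q: "prime q" "2 < q" "comm_group G" "order G = 4 * q"
        obtain r where r: "prime r" "q < r" using bigger_prime[of q] by auto
        \<comment> \<open>The odd prime in the order \<open>4 * q\<close> must be the middle one of
          the triple, so 2 is placed below it and a larger prime above.\<close>
        have A: "?A 2 q r \<or> ?B \<or> ?C"
          by (rule disjI1, rule disjI2, rule disjI2, rule disjI2, rule disjI2, rule conjI[OF q(3) conjI[OF False q(4)]])
        show ?thesis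
          by (rule exI[of _ 2], rule exI[of _ q], rule exI[of _ r])
            (rule conjI[OF primes(1) conjI[OF q(1) conjI[OF r(1) conjI[OF q(2) conjI[OF r(2) A]]]]])
      next
        note Z2 = group_integer_mod_group[of 2]
        assume "integer_mod_group 2 \<times>\<times> integer_mod_group 2 \<times>\<times> integer_mod_group 2 \<cong> G"
        then have "G \<cong> integer_mod_group 2 \<times>\<times> integer_mod_group 2 \<times>\<times> integer_mod_group 2"
          by (rule group.iso_sym[OF DirProd_group[OF Z2 DirProd_group[OF Z2 Z2]]])
        then have "?B \<or> ?C" by (simp only: simp_thms)
        then show ?thesis by (rule special)
      next
        assume "metacyclic 8 2 1 0 \<cong> G"
        from iso'[OF this grps(1) isos(1)] have "?B \<or> ?C" by (simp only: simp_thms)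
        then show ?thesis by (rule special)
      next
        assume "metacyclic 8 2 5 0 \<cong> G"
        from iso[OF this grps(3) isos(3)] have "?B \<or> ?C" by (simp only: simp_thms)
        then show ?thesis by (rule special)
      next
        assume "metacyclic 8 2 7 4 \<cong> G"
        from iso[OF this grps(4) isos(4)] have "?B \<or> ?C" by (simp only: simp_thms)
        then show ?thesis by (rule special)
      next
        assume "metacyclic 9 3 1 0 \<cong> G"
        from iso'[OF this grps(2) isos(2)] have "?B \<or> ?C" by (simp only: simp_thms)
        then show ?thesis by (rule special)
      next
        assume "metacyclic 9 3 4 0 \<cong> G"
        from iso[OF this grps(5) isos(5)] have "?B \<or> ?C" by (simp only: simp_thms)
        then show ?thesis by (rule special)
      next
        assume "G \<cong> alt_group 4"
        then have "?B \<or> ?C" by (simp only: simp_thms)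
        then show ?thesis by (rule special)
      qed
    qed
  next
    assume "\<exists>p q r :: nat. prime p \<and> prime q \<and> prime r \<and> p < q \<and> q < r \<and> (?A p q r \<or> ?B \<or> ?C)"
    then obtain p q r :: nat where P: "prime p" "prime q" "prime r" "p < q" "q < r"
      and cases: "(G \<cong> integer_mod_group (p * q * r) \<or>
        G \<cong> integer_mod_group (p ^ 3 * q) \<or>
        G \<cong> integer_mod_group (p * q ^ 3) \<or>
        G \<cong> integer_mod_group (p ^ 7) \<or>
        (comm_group G \<and> \<not> cyclic_group G \<and> order G = 4 * q)) \<or>
       (G \<cong> integer_mod_group (2 ^ 3) \<times>\<times> integer_mod_group 2 \<or>
        G \<cong> integer_mod_group 2 \<times>\<times> integer_mod_group 2 \<times>\<times> integer_mod_group 2 \<or>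
        G \<cong> integer_mod_group (3 ^ 2) \<times>\<times> integer_mod_group 3) \<or>
       (G \<cong> G11 \<or> G \<cong> G14 \<or> G \<cong> G27 \<or> G \<cong> alt_group 4)"
      by (elim exE conjE) (rule that)
    have pos: "p > 0" "q > 0" "r > 0" using P by (simp_all add: prime_gt_0_nat)
    note 8 = card_cyclic_subgroups_integer_mod_group_8
    note sym = grps(1)[THEN group.iso_sym, OF isos(1)] grps(2)[THEN group.iso_sym, OF isos(2)]
      grps(3)[THEN group.iso_sym, OF isos(3)] grps(4)[THEN group.iso_sym, OF isos(4)]
      grps(5)[THEN group.iso_sym, OF isos(5)]
    from cases show "card (cyclic_subgroups G) = 8"
    proof (elim disjE conjE)
      assume "G \<cong> integer_mod_group (p * q * r)"
      from this group_integer_mod_group show ?thesis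
        by (rule card_cyclic_subgroups_eqI) (use P pos in \<open>intro 8 card_divisors_8; simp\<close>)
    next
      assume "G \<cong> integer_mod_group (p ^ 3 * q)"
      from this group_integer_mod_group show ?thesis
        by (rule card_cyclic_subgroups_eqI) (use P pos in \<open>intro 8 card_divisors_8; simp\<close>)
    next
      assume "G \<cong> integer_mod_group (p * q ^ 3)"
      then have "G \<cong> integer_mod_group (q ^ 3 * p)" by (simp add: mult.commute)
      from this group_integer_mod_group show ?thesis
        by (rule card_cyclic_subgroups_eqI) (use P pos in \<open>intro 8 card_divisors_8; simp\<close>)
    next
      assume "G \<cong> integer_mod_group (p ^ 7)"
      from this group_integer_mod_group show ?thesis
        by (rule card_cyclic_subgroups_eqI) (use P pos in \<open>intro 8 card_divisors_8; simp\<close>)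
    next
      assume *: "comm_group G" "\<not> cyclic_group G" "order G = 4 * q"
      have "2 < q" using P prime_ge_2_nat[of p] by simp
      from card_cyclic_subgroups_4q[OF *(1) P(2) this *(3,2)] show ?thesis .
    next
      assume "G \<cong> integer_mod_group (2 ^ 3) \<times>\<times> integer_mod_group 2"
      from iso_trans[OF this sym(1)] grps(1) card_cyclic_subgroups_metacyclic(1) show ?thesis
        by (rule card_cyclic_subgroups_eqI)
    next
      assume "G \<cong> integer_mod_group 2 \<times>\<times> integer_mod_group 2 \<times>\<times> integer_mod_group 2"
      then show ?thesis
        by (rule card_cyclic_subgroups_eqI)
          (intro DirProd_group group_integer_mod_group card_cyclic_subgroups_elementary_abelian_8)+
    next
      assume "G \<cong> integer_mod_group (3 ^ 2) \<times>\<times> integer_mod_group 3"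
      from iso_trans[OF this sym(2)] grps(2) card_cyclic_subgroups_metacyclic(4) show ?thesis
        by (rule card_cyclic_subgroups_eqI)
    next
      assume "G \<cong> G11"
      from iso_trans[OF this sym(3)] grps(3) card_cyclic_subgroups_metacyclic(2) show ?thesis
        by (rule card_cyclic_subgroups_eqI)
    next
      assume "G \<cong> G14"
      from iso_trans[OF this sym(4)] grps(4) card_cyclic_subgroups_metacyclic(3) show ?thesis
        by (rule card_cyclic_subgroups_eqI)
    next
      assume "G \<cong> G27"
      from iso_trans[OF this sym(5)] grps(5) card_cyclic_subgroups_metacyclic(5) show ?thesis
        by (rule card_cyclic_subgroups_eqI)
    next
      assume "G \<cong> alt_group 4"
      from this alt_group_is_group card_cyclic_subgroups_alt_group_4 show ?thesis
        by (rule card_cyclic_subgroups_eqI)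
    qed
  }
qed

end
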